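(* Let $\mu$ be a probability distribution on $\mathbb{R}$ with finite first moment such that, for every $t_0\in[0,1)$, the variance of the posterior distribution $\mu_{t,z}$ is bounded over $(t,z)\in[0,t_0]\times\mathbb{R}$. Let $v$ be the value function for the Brownian bridge with unknown pinning point with prior $\mu$, with continuation region $\mathcal{C}$ and stopping region $\mathcal{D}$. For $r\in\mathbb{R}$, let $v_r$ and $v_{-r}$ be the value functions for known pinning points $r$ and $-r$, respectively. (i) If $\operatorname{supp}\mu\subseteq(-\infty,r]$, then $v\le v_r$. Consequently, $\mathcal{D}_r:=\{(t,z)\in[0,1]\times\mathbb{R}:z\ge r+\beta\sqrt{1-t}\}\subseteq\mathcal{D}$. (ii) If $\operatorname{supp}\mu\subseteq[-r,\infty)$, then $v\ge v_{-r}$. Consequently, $\mathcal{C}_{-r}:=\{(t,z)\in[0,1)\times\mathbb{R}:z<-r+\beta\sqrt{1-t}\}\subseteq\mathcal{C}$.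
   Context: For $(t,z)\in[0,1)\times\mathbb{R}$, $$\mu_{t,z}(du):=\frac{e^{\frac{uz}{1-t}-\frac{tu^2}{2(1-t)}}\,\mu(du)}{\int_{\mathbb{R}}e^{\frac{uz}{1-t}-\frac{tu^2}{2(1-t)}}\,\mu(du)},\qquad h(t,z):=\int_{\mathbb{R}}u\,\mu_{t,z}(du).$$ The process $Z^{t,z}$ is the solution of $$dZ_{t+s}=\frac{h(t+s,Z_{t+s})-Z_{t+s}}{1-(t+s)}\,ds+d\hat W_{t+s},\quad0\le s<1-t,\qquad Z_t=z,$$ with $\hat W$ a standard Brownian motion, extended to time $1$ by its a.s. limit; equivalently, in law, it is a Brownian bridge started at time $t$ from $z$ whose (unknown) pinning point at time $1$ has distribution $\mu_{t,z}$. The value function is $$v(t,z)=\sup_{\tau\in\mathcal{T}^Z_{1-t}}\mathbb{E}[Z^{t,z}_{t+\tau}],\qquad(t,z)\in[0,1)\times\mathbb{R},$$ where $\mathcal{T}^Z_{1-t}$ is the set of $[0,1-t]$-valued stopping times with respect to the filtration generated by $s\mapsto Z^{t,z}_{t+s}$. The continuation region is $\mathcal{C}:=\{(t,z)\in[0,1)\times\mathbb{R}:v(t,z)>z\}$ and the stopping region is $\mathcal{D}:=([0,1]\times\mathbb{R})\setminus\mathcal{C}$. For $q\in\mathbb{R}$, $v_q(t,z)$ denotes the same value function when $\mu=\delta_q$ (so the drift is $(q-Z)/(1-\cdot)$). It is known (Shepp) that, for $t\in[0,1)$, $$v_q(t,z)=\begin{cases}q+\sqrt{2\pi(1-t)}\,(1-\beta^2)\exp\left(\frac{(z-q)^2}{2(1-t)}\right)\Phi\left(\frac{z-q}{\sqrt{1-t}}\right)&\text{if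 }z<q+\beta\sqrt{1-t},\\ z&\text{if }z\ge q+\beta\sqrt{1-t},\end{cases}$$ where $\Phi$ is the standard normal distribution function and $\beta\approx0.839924$ is the unique positive solution of $\sqrt{2\pi}(1-\beta^2)e^{\beta^2/2}\Phi(\beta)=\beta$. The inequalities between value functions are pointwise on $[0,1)\times\mathbb{R}$. *)

theory Defs
  imports "HOL-Probability.Probability"
begin

section \<open>Posterior distribution of the pinning point\<close>

definition tilt :: "real \<Rightarrow> real \<Rightarrow> real \<Rightarrow> real" where
  "tilt t z u = exp (u * z / (1 - t) - t * u\<^sup>2 / (2 * (1 - t)))"

definition posterior :: "real measure \<Rightarrow> real \<Rightarrow> real \<Rightarrow> real measure" where
  "posterior \<mu> t z = density \<mu> (\<lambda>u. ennreal (tilt t z u) / (\<integral>\<^sup>+ x. ennreal (tilt t z x) \<partial>\<mu>))"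

definition post_mean :: "real measure \<Rightarrow> real \<Rightarrow> real \<Rightarrow> real" where
  "post_mean \<mu> t z = (\<integral>u. u \<partial>posterior \<mu> t z)"

text \<open>
  The first two conjuncts say that the posterior is a well-defined distribution with finite second
  moment, so that the Bochner integral in the third one is its variance and not a default value.
  They add no restriction when \<open>\<mu>\<close> has a finite first moment: for \<open>t > 0\<close> the weight is at most a
  Gaussian, and at \<open>t = 0\<close> they follow from the variance bound for \<open>0 < t \<le> t0\<close> by letting
  \<open>t\<close> tend to 0 (the variance is the second \<open>z\<close>-derivative of the logarithm of the normalising
  constant, up to the factor \<open>(1 - t)\<^sup>2\<close>).
\<close>

definition bounded_post_variance :: "real measure \<Rightarrow> bool" where
  "bounded_post_variance \<mu> \<longleftrightarrow>
     (\<forall>t0\<in>{0..<1}. \<exists>K. \<forall>t\<in>{0..t0}. \<forall>z.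
        integrable \<mu> (tilt t z) \<and>
        integrable (posterior \<mu> t z) (\<lambda>u. u\<^sup>2) \<and>
        (\<integral>u. (u - post_mean \<mu> t z)\<^sup>2 \<partial>posterior \<mu> t z) \<le> K)"

definition measure_support :: "'a::topological_space measure \<Rightarrow> 'a set" where
  "measure_support \<mu> = {x. \<forall>U. open U \<and> x \<in> U \<longrightarrow> emeasure \<mu> U > 0}"

section \<open>The observed process\<close>

definition brownian_motion :: "'a measure \<Rightarrow> (real \<Rightarrow> 'a \<Rightarrow> real) \<Rightarrow> bool" where
  "brownian_motion M W \<longleftrightarrow>
     prob_space M \<and>
     (\<forall>s\<ge>0. W s \<in> borel_measurable M) \<and>
     (AE \<omega> in M. W 0 \<omega> = 0) \<and>
     (AE \<omega> in M. continuous_on {0..} (\<lambda>s. W s \<omega>)) \<and>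
     (\<forall>s u. 0 \<le> s \<and> s < u \<longrightarrow>
        distributed M lborel (\<lambda>\<omega>. W u \<omega> - W s \<omega>) (normal_density 0 (sqrt (u - s)))) \<and>
     (\<forall>(n::nat) (ts::nat \<Rightarrow> real). 0 \<le> ts 0 \<and> mono ts \<longrightarrow>
        prob_space.indep_vars M (\<lambda>_. borel) (\<lambda>i \<omega>. W (ts (Suc i)) \<omega> - W (ts i) \<omega>) {..<n})"

text \<open>
  \<open>Z\<close> is indexed by absolute time in \<open>[t,1]\<close>.  Because the noise is additive, the stochastic
  differential equation is the pathwise integral equation below.  All paths are continuous on the
  closed interval \<open>[t,1]\<close>, so \<open>Z 1\<close> is the limit of \<open>Z\<close> at time 1, but the equation itself is only
  required almost surely.
\<close>

definition bridge_solution ::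
    "'a measure \<Rightarrow> (real \<Rightarrow> 'a \<Rightarrow> real) \<Rightarrow> real measure \<Rightarrow> real \<Rightarrow> real \<Rightarrow> (real \<Rightarrow> 'a \<Rightarrow> real) \<Rightarrow> bool" where
  "bridge_solution M W \<mu> t z Z \<longleftrightarrow>
     (\<forall>u\<in>{t..1}. Z u \<in> borel_measurable M) \<and>
     (\<forall>\<omega>\<in>space M. continuous_on {t..1} (\<lambda>u. Z u \<omega>)) \<and>
     (AE \<omega> in M. \<forall>u\<in>{t..<1}.
        set_integrable lborel {t..u} (\<lambda>s. (post_mean \<mu> s (Z s \<omega>) - Z s \<omega>) / (1 - s)) \<and>
        Z u \<omega> = z + (LBINT s:{t..u}. (post_mean \<mu> s (Z s \<omega>) - Z s \<omega>) / (1 - s))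
                  + (W u \<omega> - W t \<omega>))"

definition bridge_model ::
    "'a measure \<Rightarrow> (real \<Rightarrow> 'a \<Rightarrow> real) \<Rightarrow> real measure \<Rightarrow> (real \<Rightarrow> real \<Rightarrow> real \<Rightarrow> 'a \<Rightarrow> real) \<Rightarrow> bool" where
  "bridge_model M W \<mu> Z \<longleftrightarrow>
     brownian_motion M W \<and> (\<forall>t\<in>{0..<1}. \<forall>z. bridge_solution M W \<mu> t z (Z t z))"

section \<open>The stopping problem\<close>

definition gen_filtration :: "'a measure \<Rightarrow> (real \<Rightarrow> 'a \<Rightarrow> real) \<Rightarrow> real \<Rightarrow> real \<Rightarrow> 'a measure" where
  "gen_filtration M Z t s =
     sigma (space M) {Z (t + u) -` A \<inter> space M | u A. u \<in> {0..s} \<inter> {0..1 - t} \<and> A \<in> sets borel}"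

definition stopping_times :: "'a measure \<Rightarrow> (real \<Rightarrow> 'a \<Rightarrow> real) \<Rightarrow> real \<Rightarrow> ('a \<Rightarrow> real) set" where
  "stopping_times M Z t =
     {\<tau>. \<tau> \<in> space M \<rightarrow> {0..1 - t} \<and> stopping_time (gen_filtration M Z t) \<tau>}"

text \<open>
  The supremum is taken in the extended reals, so no boundedness is presupposed.  The integrability
  clause only keeps out the default value 0 of the Bochner integral: \<open>Z\<close> has the law of a bridge
  with an integrable pinning point, so its running maximum is integrable and the clause removes no
  stopping time.
\<close>

definition value_fn ::
    "'a measure \<Rightarrow> (real \<Rightarrow> real \<Rightarrow> real \<Rightarrow> 'a \<Rightarrow> real) \<Rightarrow> real \<Rightarrow> real \<Rightarrow> ereal" where
  "value_fn M Z t z =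
     (SUP \<tau> \<in> {\<tau> \<in> stopping_times M (Z t z) t. integrable M (\<lambda>\<omega>. Z t z (t + \<tau> \<omega>) \<omega>)}.
        ereal (\<integral>\<omega>. Z t z (t + \<tau> \<omega>) \<omega> \<partial>M))"

definition continuation_region :: "(real \<Rightarrow> real \<Rightarrow> ereal) \<Rightarrow> (real \<times> real) set" where
  "continuation_region v = {(t, z). t \<in> {0..<1} \<and> v t z > ereal z}"

definition stopping_region :: "(real \<Rightarrow> real \<Rightarrow> ereal) \<Rightarrow> (real \<times> real) set" where
  "stopping_region v = ({0..1} \<times> UNIV) - continuation_region v"

definition shepp_beta :: real where
  "shepp_beta = (THE b. b > 0 \<and>
     sqrt (2 * pi) * (1 - b\<^sup>2) * exp (b\<^sup>2 / 2) * cdf std_normal_distribution b = b)"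

end

theory Submission
  imports Defs
begin

text \<open>
  Put \<open>\<theta> = 1 / (1 - s)\<close> and \<open>X = (Z - q) / (1 - s)\<close>.  When the prior lies below (above) \<open>q\<close>, the process
  \<open>X\<close> is a Brownian motion in the clock \<open>\<theta>\<close> plus a decreasing (increasing) term, and the payoff
  becomes \<open>Z - q = X / \<theta>\<close>.  Integrating the exponential martingales \<open>exp (l X - l\<^sup>2 \<theta> / 2)\<close> over
  \<open>l \<ge> 0\<close> gives \<open>mills (X / sqrt \<theta>) / sqrt \<theta>\<close>, which is Shepp's solution up to the factor
  \<open>1 - \<beta>\<^sup>2\<close>; it dominates \<open>X / \<theta>\<close>, with equality exactly on the boundary \<open>X = \<beta> sqrt \<theta>\<close>.  So for a prior
  below \<open>q\<close> Shepp's function bounds every payoff from above, and for a prior above \<open>q\<close> the first hitting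
  time of Shepp's boundary earns at least Shepp's value.  Both comparisons go through the known
  pinning point, whose prior is both below and above \<open>q\<close>.

  No stochastic integral is needed: on a fine grid \<open>X\<close> differs from a weighted sum of Brownian
  increments only by a pathwise vanishing error, and Fatou's lemma passes to the limit.  The increments
  are independent of the past of \<open>Z\<close> because \<open>Z\<close> is the almost sure limit of its Euler scheme.
\<close>

section \<open>Mills ratio and the constant of Shepp\<close>

text \<open>The clock is the quadratic variation of X: the noise enters X with weight 1 / (1 - s),
  and the integral of 1 / (1 - s)^2 from t to s is 1 / (1 - s) - 1 / (1 - t). The restriction l >= 0
  is what lets the comparison of drifts survive: exp (l X) inherits the order between X and its
  driftless part exactly for such l, and a mixture of inequalities in one direction keeps that
  direction.

  Three obstacles shape the rest. The models live on unrelated probability spaces, so their paths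
  cannot be compared; an explicit number has to separate the two values. From a start strictly above
  the boundary the plain mixture exceeds z - q, so the upper bound carries a parameter a that damps
  the mixture by exp (- l^2 a / 2). And the clock explodes at time 1, so all estimates run up to a
  horizon T < 1: the upper bound then passes to time 1 by Fatou's lemma, the lower bound by showing
  that paths still below the boundary at T cost, in expectation, at most a multiple of sqrt (1 -
  T).\<close>

definition mills :: "real \<Rightarrow> real" where
  "mills y = sqrt (2 * pi) * exp (y\<^sup>2 / 2) * cdf std_normal_distribution y"

lemma cdf_std_normal_has_derivative:
  "(cdf std_normal_distribution has_real_derivative std_normal_density x) (at x)"
proof -
  interpret N: real_distribution std_normal_distribution by (rule real_dist_normal_dist)
  define a where "a = x - 1"
  have cont: "continuous_on S std_normal_density" for S
    unfolding std_normal_density_def by (intro continuous_intros) auto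
  have eq: "cdf std_normal_distribution y = cdf std_normal_distribution a + integral {a..y} std_normal_density"
    if "a < y" for y
  proof -
    have "cdf std_normal_distribution y - cdf std_normal_distribution a = measure std_normal_distribution {a<..y}"
      using N.cdf_diff_eq[OF that] .
    also have "\<dots> = (LINT u|std_normal_distribution. indicator {a<..y} u)"
      by simp
    also have "\<dots> = (LBINT u. std_normal_density u * indicator {a<..y} u)"
      by (subst integral_density) auto
    also have "\<dots> = (LBINT u:{a..y}. std_normal_density u)"
      unfolding set_lebesgue_integral_def
      by (intro integral_cong_AE) (auto simp: indicator_def intro!: eventually_mono[OF AE_lborel_singleton[of a]])
    also have "\<dots> = integral {a..y} std_normal_density"
      by (intro set_borel_integral_eq_integral borel_integrable_atLeastAtMost' cont)
    finally show ?thesis by simp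
  qed
  have "((\<lambda>y. integral {a..y} std_normal_density) has_real_derivative std_normal_density x) (at x within {a..x+1})"
    by (intro integral_has_real_derivative cont) (auto simp: a_def)
  then have "((\<lambda>y. cdf std_normal_distribution a + integral {a..y} std_normal_density)
      has_real_derivative 0 + std_normal_density x) (at x)"
    by (intro derivative_intros) (auto simp: a_def at_within_Icc_at)
  moreover have "\<forall>\<^sub>F y in nhds x. cdf std_normal_distribution y
      = cdf std_normal_distribution a + integral {a..y} std_normal_density"
    by (rule eventually_mono[OF eventually_nhds_in_open[of "{a<..}" x]]) (auto simp: a_def eq)
  ultimately show ?thesis
    by (subst DERIV_cong_ev[OF refl _ refl]) simp_all
qed

lemma mills_pos: "mills y > 0"
proof -
  interpret N: real_distribution std_normal_distribution by (rule real_dist_normal_dist)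
  have "cdf std_normal_distribution (y - 1) < cdf std_normal_distribution y"
    by (rule DERIV_pos_imp_increasing)
       (auto intro!: exI[of _ "std_normal_density _"] cdf_std_normal_has_derivative simp: normal_density_pos)
  with N.cdf_nonneg[of "y - 1"] show ?thesis
    unfolding mills_def by (intro mult_pos_pos) auto
qed

text \<open>\<open>mills\<close> is the normal distribution function divided by its density, the
  Mills ratio of the lower tail. Differentiating makes the density cancel and leaves a linear
  equation, on which the monotonicity facts about \<open>shepp_beta\<close> rest.\<close>

lemma mills_has_derivative:
  "(mills has_real_derivative y * mills y + 1) (at y)"
proof -
  have "(mills has_real_derivative sqrt (2 * pi) * (exp (y\<^sup>2 / 2) * (2 * y / 2)) * cdf std_normal_distribution y
      + std_normal_density y * (sqrt (2 * pi) * exp (y\<^sup>2 / 2))) (at y)"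
    unfolding mills_def[abs_def]
    by (intro DERIV_mult cdf_std_normal_has_derivative) (auto intro!: derivative_eq_intros)
  moreover have "std_normal_density y * (sqrt (2 * pi) * exp (y\<^sup>2 / 2)) = 1"
    unfolding std_normal_density_def by (simp add: exp_minus)
  ultimately show ?thesis by (simp add: mills_def algebra_simps)
qed

text \<open>Complete the square: with r = sqrt \<open>\<theta>\<close> and l = x /
  \<open>\<theta>\<close> - y / r the exponent becomes (x / r)^2 / 2 - y^2 / 2. The substitution
  reverses orientation, so l >= 0 becomes y <= x / r and the normal distribution function
  appears.\<close>

lemma nn_integral_exp_quadratic:
  assumes "\<theta> > 0"
  shows "(\<integral>\<^sup>+l.  ennreal (exp (l * x - l\<^sup>2 * \<theta> / 2)) * indicator {0..} l \<partial>lborel)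
    = ennreal (mills (x / sqrt \<theta>) / sqrt \<theta>)"
proof -
  interpret N: real_distribution std_normal_distribution by (rule real_dist_normal_dist)
  define r where "r = sqrt \<theta>"
  have r: "r > 0" "\<theta> = r\<^sup>2" using assms by (auto simp: r_def)
  have e: "(x / \<theta> + - 1 / r * y) * x - (x / \<theta> + - 1 / r * y)\<^sup>2 * \<theta> / 2 = (x / r)\<^sup>2 / 2 - y\<^sup>2 / 2" for y
    using r(1) unfolding r(2) by (simp add: field_simps power2_eq_square)
  have i: "indicator {0..} (x / \<theta> + - 1 / r * y) = (indicator {..x / r} y :: ennreal)" for y
  proof -
    have "x / \<theta> + - 1 / r * y = (x / r - y) / r"
      using r(1) unfolding r(2) by (simp add: field_simps power2_eq_square)
    then show ?thesis using r(1) by (auto simp: indicator_def zero_le_divide_iff divide_le_0_iff)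
  qed
  have "(\<integral>\<^sup>+l.  ennreal (exp (l * x - l\<^sup>2 * \<theta> / 2)) * indicator {0..} l \<partial>lborel)
    = ennreal \<bar>- 1 / r\<bar> * (\<integral>\<^sup>+y. ennreal (exp ((x / \<theta> + - 1 / r * y) * x - (x / \<theta> + - 1 / r * y)\<^sup>2 * \<theta> / 2))
        * indicator {0..} (x / \<theta> + - 1 / r * y) \<partial>lborel)"
    by (rule nn_integral_real_affine) (use r in auto)
  also have "(\<integral>\<^sup>+y. ennreal (exp ((x / \<theta> + - 1 / r * y) * x - (x / \<theta> + - 1 / r * y)\<^sup>2 * \<theta> / 2))
        * indicator {0..} (x / \<theta> + - 1 / r * y) \<partial>lborel)
    = (\<integral>\<^sup>+y. ennreal (sqrt (2 * pi) * exp ((x / r)\<^sup>2 / 2)) * (ennreal (std_normal_density y) * indicator {..x / r} y) \<partial>lborel)"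
    unfolding e i
    by (intro nn_integral_cong)
       (auto simp: indicator_def std_normal_density_def ennreal_mult[symmetric] diff_divide_distrib exp_diff exp_minus
          simp flip: power_divide; simp add: field_simps)
  also have "\<dots> = ennreal (sqrt (2 * pi) * exp ((x / r)\<^sup>2 / 2)) * emeasure std_normal_distribution {..x / r}"
    by (subst nn_integral_cmult) (auto simp: emeasure_density)
  also have "\<dots> = ennreal (mills (x / r))"
    by (simp add: N.emeasure_eq_measure mills_def cdf_def ennreal_mult[symmetric])
  finally show ?thesis
    using r mills_pos[of "x / r"] by (simp add: ennreal_mult[symmetric] r_def[symmetric])
qed

lemma mills_gap_has_derivative:
  "((\<lambda>b. (1 - b\<^sup>2) * mills b - b) has_real_derivative - (b * mills b * (1 + b\<^sup>2) + b\<^sup>2)) (at b)"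
  by (rule derivative_eq_intros mills_has_derivative refl)+ (simp add: algebra_simps power2_eq_square)

text \<open>Every term in the bracket of the derivative is positive for b > 0. The gap is also the
  numerator in the derivative of y / mills y, so this yields both the uniqueness of the root and the
  global inequality below.\<close>

lemma mills_gap_decreasing:
  assumes "0 < a" "a < b"
  shows "(1 - b\<^sup>2) * mills b - b < (1 - a\<^sup>2) * mills a - a"
proof (rule DERIV_neg_imp_decreasing[OF assms(2)])
  fix x assume "a \<le> x" "x \<le> b"
  then have "x > 0" using assms by simp
  then have "- (x * mills x * (1 + x\<^sup>2) + x\<^sup>2) < 0"
    using mills_pos[of x] by (intro neg_less_0_iff_less[THEN iffD2] add_pos_pos mult_pos_pos) auto
  then show "\<exists>d. ((\<lambda>b. (1 - b\<^sup>2) * mills b - b) has_real_derivative d) (at x) \<and> d < 0"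
    using mills_gap_has_derivative by blast
qed

lemma shepp_beta_unique:
  "\<exists>!b. b > 0 \<and> sqrt (2 * pi) * (1 - b\<^sup>2) * exp (b\<^sup>2 / 2) * cdf std_normal_distribution b = b"
proof -
  define k where "k b = (1 - b\<^sup>2) * mills b - b" for b :: real
  have k_cont: "isCont k b" for b
    using mills_gap_has_derivative[of b] DERIV_isCont by (simp add: k_def[abs_def])
  have k_less: "k b < k a" if "0 < a" "a < b" for a b
    using mills_gap_decreasing[OF that] by (simp add: k_def)
  \<comment> \<open>The gap is \<open>mills 0\<close> > 0 at 0 and -1 at 1.\<close>
  obtain b where b: "0 \<le> b" "b \<le> 1" "k b = 0"
    using IVT2[of k 1 0 0] k_cont mills_pos[of 0] by (auto simp: k_def)
  have "b \<noteq> 0" using b(3) mills_pos[of 0] by (auto simp: k_def)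
  with b have b0: "b > 0" by simp
  have iff: "(b > 0 \<and> sqrt (2 * pi) * (1 - b\<^sup>2) * exp (b\<^sup>2 / 2) * cdf std_normal_distribution b = b)
      \<longleftrightarrow> (b > 0 \<and> k b = 0)" for b
    by (auto simp: k_def mills_def algebra_simps)
  show ?thesis unfolding iff
  proof (rule ex1I[of _ b])
    show "0 < b \<and> k b = 0" using b b0 by auto
    fix b' assume b': "0 < b' \<and> k b' = 0"
    show "b' = b"
      using k_less[of b b'] k_less[of b' b] b b0 b' by (cases b b' rule: linorder_cases) auto
  qed
qed

lemma shepp_beta:
  shows shepp_beta_pos: "shepp_beta > 0"
    and mills_shepp_beta: "(1 - shepp_beta\<^sup>2) * mills shepp_beta = shepp_beta"
  using theI'[OF shepp_beta_unique] unfolding shepp_beta_def[symmetric]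
  by (auto simp: mills_def algebra_simps)

text \<open>In the defining equation the other factor \<open>mills shepp_beta\<close> and the
  right-hand side are both positive.\<close>

lemma shepp_beta_square_less: "shepp_beta\<^sup>2 < 1"
  using mills_shepp_beta shepp_beta_pos mills_pos[of shepp_beta]
  by (metis diff_gt_0_iff_gt zero_less_mult_pos2)

text \<open>The ratio of \<open>y\<close> and \<open>mills y\<close> has derivative \<open>((1 - y\<^sup>2) mills y - y) / (mills y)\<^sup>2\<close>, which
  changes sign only at \<open>shepp_beta\<close>.\<close>

lemma mills_above_diagonal:
  assumes "y \<noteq> shepp_beta"
  shows "y < (1 - shepp_beta\<^sup>2) * mills y"
proof (cases "y \<le> 0")
  case True
  have "0 < (1 - shepp_beta\<^sup>2) * mills y"
    using shepp_beta_square_less mills_pos[of y] by simp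
  with True show ?thesis by linarith
next
  case False
  let ?b = shepp_beta
  define k where "k b = (1 - b\<^sup>2) * mills b - b" for b :: real
  have k_less: "k b < k a" if "0 < a" "a < b" for a b
    using mills_gap_decreasing[OF that] by (simp add: k_def)
  have kb: "k ?b = 0" using mills_shepp_beta by (simp add: k_def)
  define R where "R b = b / mills b" for b
  have R_deriv: "(R has_real_derivative k b / (mills b)\<^sup>2) (at b)" for b
    unfolding R_def
    by (rule derivative_eq_intros mills_has_derivative refl)+
       (use mills_pos[of b] in \<open>auto simp: k_def algebra_simps power2_eq_square\<close>)
  have R_cont: "continuous_on S R" for S
    using R_deriv DERIV_isCont continuous_at_imp_continuous_on by blast
  have "R y < R ?b"
  proof (cases "y < ?b")
    case True
    show ?thesis
      by (rule DERIV_pos_imp_increasing_open[OF True])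
         (use False kb k_less[of _ ?b] mills_pos in \<open>auto intro!: exI R_deriv R_cont simp: less_imp_neq[symmetric]\<close>)
  next
    case b: False
    then have "?b < y" using assms by simp
    then show ?thesis
      by (rule DERIV_neg_imp_decreasing_open)
         (use kb k_less[of ?b] shepp_beta_pos mills_pos[THEN less_imp_neq] in
           \<open>auto intro!: exI R_deriv R_cont divide_neg_pos\<close>)
  qed
  \<comment> \<open>The defining equation gives the value of y / mills y at beta. As the maximum of
    this ratio, 1 - beta^2 is the smallest factor with which \<open>mills\<close> dominates the
    diagonal; this is where the constant in Shepp's formula comes from.\<close>
  moreover have "R ?b = 1 - ?b\<^sup>2"
    using mills_shepp_beta mills_pos[of ?b] by (simp add: R_def field_simps)
  ultimately have "R y < 1 - ?b\<^sup>2" by simp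
  then show ?thesis using mills_pos[of y] by (simp add: R_def pos_divide_less_eq)
qed

lemma mills_ge_diagonal: "y \<le> (1 - shepp_beta\<^sup>2) * mills y"
  using mills_above_diagonal[of y] mills_shepp_beta by (cases "y = shepp_beta") auto

section \<open>Posterior means of a prior with exponential moments\<close>

text \<open>The assumption is integrability of \<open>tilt 0 z\<close> for every z, a part of
  \<open>bounded_post_variance\<close> at time 0. Point masses satisfy it too, so
  \<open>\<mu>\<close> and the known pinning points share all later lemmas.\<close>

locale light_tailed = real_distribution \<mu> for \<mu> :: "real measure" +
  assumes exp_integrable: "integrable \<mu> (\<lambda>u. exp (u * C))"
begin

text \<open>A power costs one unit of exponential rate, because |u|^k / k! is a term of the series
  of exp |u|. An exponential of |u| is one of the two exponentials of u and - u, hence at most their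
  sum.\<close>

lemma power_exp_integrable: "integrable \<mu> (\<lambda>u. \<bar>u\<bar> ^ k * exp (C * \<bar>u\<bar>))"
proof (rule Bochner_Integration.integrable_bound)
  show "integrable \<mu> (\<lambda>u. fact k * (exp (u * (C + 1)) + exp (u * - (C + 1))))"
    by (intro integrable_mult_right Bochner_Integration.integrable_add exp_integrable)
  have "\<bar>u\<bar> ^ k * exp (C * \<bar>u\<bar>) \<le> fact k * (exp (u * (C + 1)) + exp (u * - (C + 1)))" for u :: real
  proof -
    have "\<bar>u\<bar> ^ k \<le> fact k * exp \<bar>u\<bar>"
      using sum_le_suminf[OF summable_exp_generic[of "\<bar>u\<bar>"], of "{k}"]
      by (simp add: exp_def divide_simps mult.commute)
    then have "\<bar>u\<bar> ^ k * exp (C * \<bar>u\<bar>) \<le> fact k * exp \<bar>u\<bar> * exp (C * \<bar>u\<bar>)"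
      by (rule mult_right_mono) simp
    also have "\<dots> = fact k * exp ((C + 1) * \<bar>u\<bar>)"
      by (simp add: exp_add[symmetric] algebra_simps)
    also have "exp ((C + 1) * \<bar>u\<bar>) \<le> exp (u * (C + 1)) + exp (u * - (C + 1))"
    proof -
      have "exp ((C + 1) * \<bar>u\<bar>) = exp (u * (C + 1)) \<or> exp ((C + 1) * \<bar>u\<bar>) = exp (u * - (C + 1))"
        by (cases "u \<ge> 0") (simp_all add: algebra_simps)
      then show ?thesis
        using exp_ge_zero[of "u * (C + 1)"] exp_ge_zero[of "u * - (C + 1)"]
        by (elim disjE) linarith+
    qed
    finally show ?thesis by simp
  qed
  then show "AE u in \<mu>. norm (\<bar>u\<bar> ^ k * exp (C * \<bar>u\<bar>))
      \<le> norm (fact k * (exp (u * (C + 1)) + exp (u * - (C + 1))))"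
    by (intro AE_I2) (simp add: abs_mult)
qed simp

text \<open>The Gaussian factor has a nonpositive exponent and is dropped. What remains depends on
  (s, z) only through T and R, so it is a dominating function for the whole box.\<close>

lemma tilt_bound:
  assumes "0 \<le> s" "s \<le> T" "T < 1" "\<bar>z\<bar> \<le> R"
  shows "tilt s z u \<le> exp (R / (1 - T) * \<bar>u\<bar>)"
proof -
  have "u * z / (1 - s) \<le> \<bar>u\<bar> * R / (1 - T)"
  proof (rule frac_le)
    have "u * z \<le> \<bar>u\<bar> * \<bar>z\<bar>" using abs_ge_self[of "u * z"] by (simp add: abs_mult)
    also have "\<dots> \<le> \<bar>u\<bar> * R" using assms by (intro mult_left_mono) auto
    finally show "u * z \<le> \<bar>u\<bar> * R" .
    show "0 \<le> \<bar>u\<bar> * R" using assms by (intro mult_nonneg_nonneg) auto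
  qed (use assms in auto)
  moreover have "0 \<le> s * u\<^sup>2 / (2 * (1 - s))" using assms by simp
  ultimately show ?thesis unfolding tilt_def by (simp add: mult.commute)
qed

lemma tilt_pos: "tilt s z u > 0"
  by (simp add: tilt_def)

lemma tilt_measurable [measurable]: "tilt s z \<in> borel_measurable borel"
  unfolding tilt_def[abs_def] by measurable

lemma tilt_moment_integrable:
  assumes "0 \<le> s" "s < 1"
  shows "integrable \<mu> (\<lambda>u. u ^ k * tilt s z u)"
  by (rule Bochner_Integration.integrable_bound[OF power_exp_integrable[of k "\<bar>z\<bar> / (1 - s)"]])
     (use assms tilt_bound[of s s z "\<bar>z\<bar>"] tilt_pos[THEN less_imp_le] in
       \<open>auto simp: abs_mult power_abs intro!: mult_left_mono\<close>)

text \<open>k = 0 is the normalising constant and k = 1 the unnormalised mean. Regularity is shown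
  for each and then carried over to the quotient \<open>post_mean\<close>.\<close>

definition tilt_moment :: "nat \<Rightarrow> real \<Rightarrow> real \<Rightarrow> real" where
  "tilt_moment k s z = (\<integral>u. u ^ k * tilt s z u \<partial>\<mu>)"

lemma tilt_moment_continuous:
  assumes "T < 1"
  shows "continuous_on ({0..T} \<times> {-R..R}) (\<lambda>(s, z). tilt_moment k s z)"
proof (rule continuous_on_sequentiallyI, clarsimp simp: tilt_moment_def split_beta)
  fix x :: "nat \<Rightarrow> real \<times> real" and s z
  assume x: "\<forall>n. x n \<in> {0..T} \<times> {- R..R}" and x_lim: "x \<longlonglongrightarrow> (s, z)"
    and sz: "0 \<le> s" "s \<le> T" "- R \<le> z" "z \<le> R"
  show "(\<lambda>n. \<integral>u. u ^ k * tilt (fst (x n)) (snd (x n)) u \<partial>\<mu>) \<longlonglongrightarrow> (\<integral>u. u ^ k * tilt s z u \<partial>\<mu>)"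
  proof (rule integral_dominated_convergence[where w = "\<lambda>u. \<bar>u\<bar> ^ k * exp (R / (1 - T) * \<bar>u\<bar>)"])
    have "(\<lambda>n. fst (x n)) \<longlonglongrightarrow> s" "(\<lambda>n. snd (x n)) \<longlonglongrightarrow> z"
      using tendsto_fst[OF x_lim] tendsto_snd[OF x_lim] by auto
    then show "AE u in \<mu>. (\<lambda>n. u ^ k * tilt (fst (x n)) (snd (x n)) u) \<longlonglongrightarrow> u ^ k * tilt s z u"
      unfolding tilt_def using sz assms by (intro AE_I2 tendsto_intros) auto
    have "norm (u ^ k * tilt (fst (x n)) (snd (x n)) u) \<le> \<bar>u\<bar> ^ k * exp (R / (1 - T) * \<bar>u\<bar>)" for n u
    proof -
      have "0 \<le> fst (x n)" "fst (x n) \<le> T" "\<bar>snd (x n)\<bar> \<le> R"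
        using x[rule_format, of n] by (auto simp: mem_Times_iff)
      then show ?thesis
        using tilt_bound[of "fst (x n)" T "snd (x n)" R u] assms tilt_pos[THEN less_imp_le]
        by (auto simp: abs_mult power_abs intro!: mult_left_mono)
    qed
    then show "AE u in \<mu>. norm (u ^ k * tilt (fst (x n)) (snd (x n)) u) \<le> \<bar>u\<bar> ^ k * exp (R / (1 - T) * \<bar>u\<bar>)" for n
      by simp
  qed (use power_exp_integrable[of k "R / (1 - T)"] in auto)
qed

text \<open>A derivative in z would bring down a factor u / (1 - s), so the constant is a moment of
  order \<open>Suc k\<close>. The mean value estimate |exp a - exp b| <= |a - b| max (exp a) (exp
  b), applied under the integral, replaces differentiation.\<close>

lemma tilt_moment_lipschitz:
  assumes "T < 1"
  shows "\<exists>L. \<forall>s\<in>{0..T}. \<forall>x\<in>{-R..R}. \<forall>y\<in>{-R..R}. \<bar>tilt_moment k s x - tilt_moment k s y\<bar> \<le> L * \<bar>x - y\<bar>"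
proof -
  let ?w = "\<lambda>u::real. \<bar>u\<bar> ^ Suc k * exp (R / (1 - T) * \<bar>u\<bar>)"
  have main: "\<bar>tilt_moment k s x - tilt_moment k s y\<bar> \<le> (\<integral>u. ?w u \<partial>\<mu>) / (1 - T) * \<bar>x - y\<bar>"
    if s: "s \<in> {0..T}" and xy: "x \<in> {-R..R}" "y \<in> {-R..R}" for s x y
  proof -
    have pw: "\<bar>u ^ k * tilt s x u - u ^ k * tilt s y u\<bar> \<le> ?w u * (\<bar>x - y\<bar> / (1 - T))" for u :: real
    proof -
      have exp_diff_le: "\<bar>exp a - exp b\<bar> \<le> \<bar>a - b\<bar> * B" if "exp a \<le> B" "exp b \<le> B" for a b B :: real
      proof -
        have *: "exp p - exp q \<le> \<bar>p - q\<bar> * exp p" for p q :: real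
        proof -
          have "exp p - exp q = exp p * (1 - exp (q - p))"
            by (simp add: algebra_simps exp_add[symmetric])
          also have "\<dots> \<le> exp p * (p - q)"
            using exp_ge_add_one_self[of "q - p"] by (intro mult_left_mono, linarith) simp
          also have "\<dots> \<le> exp p * \<bar>p - q\<bar>" by (intro mult_left_mono) auto
          finally show ?thesis by (simp add: mult.commute)
        qed
        have "\<bar>a - b\<bar> * exp a \<le> \<bar>a - b\<bar> * B" "\<bar>a - b\<bar> * exp b \<le> \<bar>a - b\<bar> * B"
          using that by (auto intro: mult_left_mono)
        moreover have "exp a - exp b \<le> \<bar>a - b\<bar> * exp a" "exp b - exp a \<le> \<bar>a - b\<bar> * exp b"
          using *[of a b] *[of b a] by (simp_all add: abs_minus_commute)
        ultimately show ?thesis unfolding abs_le_iff by linarith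
      qed
      have "\<bar>tilt s x u - tilt s y u\<bar>
          \<le> \<bar>(u * x / (1 - s) - s * u\<^sup>2 / (2 * (1 - s))) - (u * y / (1 - s) - s * u\<^sup>2 / (2 * (1 - s)))\<bar>
            * exp (R / (1 - T) * \<bar>u\<bar>)"
        using tilt_bound[of s T x R u] tilt_bound[of s T y R u] s xy assms
        unfolding tilt_def by (intro exp_diff_le) auto
      also have "\<bar>(u * x / (1 - s) - s * u\<^sup>2 / (2 * (1 - s))) - (u * y / (1 - s) - s * u\<^sup>2 / (2 * (1 - s)))\<bar>
          = \<bar>u\<bar> * (\<bar>x - y\<bar> / (1 - s))"
      proof -
        have "(u * x / (1 - s) - s * u\<^sup>2 / (2 * (1 - s))) - (u * y / (1 - s) - s * u\<^sup>2 / (2 * (1 - s)))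
            = u * ((x - y) / (1 - s))"
          by (simp add: right_diff_distrib diff_divide_distrib)
        then show ?thesis using s assms by (simp add: abs_mult)
      qed
      also have "\<dots> \<le> \<bar>u\<bar> * (\<bar>x - y\<bar> / (1 - T))"
        using s assms by (intro mult_left_mono divide_left_mono) auto
      finally have "\<bar>tilt s x u - tilt s y u\<bar> \<le> \<bar>u\<bar> * (\<bar>x - y\<bar> / (1 - T)) * exp (R / (1 - T) * \<bar>u\<bar>)"
        by (simp add: mult_right_mono)
      then have "\<bar>u\<bar> ^ k * \<bar>tilt s x u - tilt s y u\<bar> \<le> \<bar>u\<bar> ^ k * (\<bar>u\<bar> * (\<bar>x - y\<bar> / (1 - T)) * exp (R / (1 - T) * \<bar>u\<bar>))"
        by (rule mult_left_mono) simp
      then show ?thesis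
        by (simp add: right_diff_distrib[symmetric] abs_mult power_abs mult_ac)
    qed
    have "\<bar>tilt_moment k s x - tilt_moment k s y\<bar> = \<bar>\<integral>u. u ^ k * tilt s x u - u ^ k * tilt s y u \<partial>\<mu>\<bar>"
      unfolding tilt_moment_def using s assms
      by (subst Bochner_Integration.integral_diff) (auto intro!: tilt_moment_integrable)
    also have "\<dots> \<le> (\<integral>u. \<bar>u ^ k * tilt s x u - u ^ k * tilt s y u\<bar> \<partial>\<mu>)"
      by (rule integral_abs_bound)
    also have "\<dots> \<le> (\<integral>u. ?w u * (\<bar>x - y\<bar> / (1 - T)) \<partial>\<mu>)"
      using s assms pw
      by (intro integral_mono integrable_abs Bochner_Integration.integrable_diff tilt_moment_integrable
          integrable_mult_left power_exp_integrable) auto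
    also have "\<dots> = (\<integral>u. ?w u \<partial>\<mu>) / (1 - T) * \<bar>x - y\<bar>" by simp
    finally show ?thesis .
  qed
  then show ?thesis by blast
qed

lemma tilt_moment_0_pos:
  assumes "0 \<le> s" "s < 1"
  shows "tilt_moment 0 s z > 0"
proof -
  have "tilt_moment 0 s z \<noteq> 0"
  proof
    assume "tilt_moment 0 s z = 0"
    then have "AE u in \<mu>. u ^ 0 * tilt s z u = 0"
      unfolding tilt_moment_def
      by (subst (asm) integral_nonneg_eq_0_iff_AE[OF tilt_moment_integrable[OF assms]])
         (auto simp: tilt_pos[THEN less_imp_le])
    then show False using tilt_pos by (simp add: less_imp_neq[symmetric])
  qed
  moreover have "tilt_moment 0 s z \<ge> 0"
    unfolding tilt_moment_def by (intro Bochner_Integration.integral_nonneg) (simp add: tilt_pos[THEN less_imp_le])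
  ultimately show ?thesis by simp
qed

text \<open>The normalising constant in \<open>posterior\<close> is an \<open>ennreal\<close>. It is
  finite and positive here, so the quotient moves to the reals.\<close>

lemma post_mean_eq:
  assumes "0 \<le> s" "s < 1"
  shows "post_mean \<mu> s z = tilt_moment 1 s z / tilt_moment 0 s z"
proof -
  let ?B = "tilt_moment 0 s z"
  have "(\<integral>\<^sup>+ x. ennreal (tilt s z x) \<partial>\<mu>) = ennreal ?B"
    using nn_integral_eq_integral[OF tilt_moment_integrable[OF assms, of 0]] tilt_pos[THEN less_imp_le]
    by (simp add: tilt_moment_def)
  then have "posterior \<mu> s z = density \<mu> (\<lambda>u. ennreal (tilt s z u / ?B))"
    unfolding posterior_def using tilt_moment_0_pos[OF assms] tilt_pos[THEN less_imp_le]
    by (simp add: divide_ennreal)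
  then have "post_mean \<mu> s z = (\<integral>u. tilt s z u / ?B * u \<partial>\<mu>)"
    unfolding post_mean_def using tilt_moment_0_pos[OF assms, of z] tilt_pos[THEN less_imp_le]
    by (simp only:) (subst integral_density, auto)
  also have "\<dots> = (\<integral>u. u ^ 1 * tilt s z u / ?B \<partial>\<mu>)"
    by (intro Bochner_Integration.integral_cong) auto
  finally show ?thesis by (simp add: tilt_moment_def)
qed

lemma post_mean_le:
  assumes "0 \<le> s" "s < 1" "AE u in \<mu>. u \<le> q"
  shows "post_mean \<mu> s z \<le> q"
proof -
  have "AE u in \<mu>. u ^ 1 * tilt s z u \<le> q * (u ^ 0 * tilt s z u)"
    using assms(3) by eventually_elim (simp add: mult_right_mono tilt_pos[THEN less_imp_le])
  then have "tilt_moment 1 s z \<le> (\<integral>u. q * (u ^ 0 * tilt s z u) \<partial>\<mu>)"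
    unfolding tilt_moment_def
    by (intro integral_mono_AE integrable_mult_right tilt_moment_integrable assms(1,2))
  then show ?thesis
    using tilt_moment_0_pos[OF assms(1,2), of z]
    by (simp add: post_mean_eq[OF assms(1,2)] tilt_moment_def[of 0] pos_divide_le_eq)
qed

lemma post_mean_ge:
  assumes "0 \<le> s" "s < 1" "AE u in \<mu>. q \<le> u"
  shows "q \<le> post_mean \<mu> s z"
proof -
  have "AE u in \<mu>. q * (u ^ 0 * tilt s z u) \<le> u ^ 1 * tilt s z u"
    using assms(3) by eventually_elim (simp add: mult_right_mono tilt_pos[THEN less_imp_le])
  then have "(\<integral>u. q * (u ^ 0 * tilt s z u) \<partial>\<mu>) \<le> tilt_moment 1 s z"
    unfolding tilt_moment_def
    by (intro integral_mono_AE integrable_mult_right tilt_moment_integrable assms(1,2))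
  then show ?thesis
    using tilt_moment_0_pos[OF assms(1,2), of z]
    by (simp add: post_mean_eq[OF assms(1,2)] tilt_moment_def[of 0] pos_le_divide_eq)
qed

lemma post_mean_continuous:
  assumes "T < 1"
  shows "continuous_on ({0..T} \<times> {-R..R}) (\<lambda>(s, z). post_mean \<mu> s z)"
proof -
  have "continuous_on ({0..T} \<times> {-R..R}) (\<lambda>p. (\<lambda>(s, z). tilt_moment 1 s z) p / (\<lambda>(s, z). tilt_moment 0 s z) p)"
  proof (intro continuous_on_divide tilt_moment_continuous assms ballI)
    fix p assume "p \<in> {0..T} \<times> {-R..R}"
    then show "(\<lambda>(s, z). tilt_moment 0 s z) p \<noteq> 0"
      using assms tilt_moment_0_pos[of "fst p" "snd p"] by (auto simp: split_beta)
  qed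
  then show ?thesis
    by (rule continuous_on_eq) (use assms in \<open>auto simp: post_mean_eq\<close>)
qed

text \<open>Quotient rule for differences: a1/b1 - a2/b2 = ((a1 - a2) + (a2/b2) (b2 - b1)) / b1.
  Compactness of the box supplies a positive lower bound for the denominators and a bound
  \<open>D\<close> for the mean a2/b2.\<close>

lemma post_mean_lipschitz:
  assumes "T < 1"
  shows "\<exists>L\<ge>0. \<forall>s\<in>{0..T}. \<forall>x\<in>{-R..R}. \<forall>y\<in>{-R..R}. \<bar>post_mean \<mu> s x - post_mean \<mu> s y\<bar> \<le> L * \<bar>x - y\<bar>"
proof (cases "0 \<le> T \<and> 0 \<le> R")
  \<comment> \<open>The box is empty.\<close>
  case False
  then show ?thesis by (intro exI[of _ 0]) auto
next
  case True
  let ?K = "{0..T} \<times> {-R..R}"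
  have K: "compact ?K" "?K \<noteq> {}" using True by (auto intro: compact_Times)
  obtain L0 where L0: "\<And>s x y. s\<in>{0..T} \<Longrightarrow> x\<in>{-R..R} \<Longrightarrow> y\<in>{-R..R} \<Longrightarrow>
      \<bar>tilt_moment 0 s x - tilt_moment 0 s y\<bar> \<le> L0 * \<bar>x - y\<bar>"
    using tilt_moment_lipschitz[OF assms, of R 0] by blast
  obtain L1 where L1: "\<And>s x y. s\<in>{0..T} \<Longrightarrow> x\<in>{-R..R} \<Longrightarrow> y\<in>{-R..R} \<Longrightarrow>
      \<bar>tilt_moment 1 s x - tilt_moment 1 s y\<bar> \<le> L1 * \<bar>x - y\<bar>"
    using tilt_moment_lipschitz[OF assms, of R 1] by blast
  obtain p0 where p0: "p0 \<in> ?K"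
    and p0_min: "\<forall>p\<in>?K. (\<lambda>(s, z). tilt_moment 0 s z) p0 \<le> (\<lambda>(s, z). tilt_moment 0 s z) p"
    using continuous_attains_inf[OF K tilt_moment_continuous[OF assms]] by blast
  define b where "b = tilt_moment 0 (fst p0) (snd p0)"
  have b: "b > 0" "b \<le> tilt_moment 0 s x" if "s \<in> {0..T}" "x \<in> {-R..R}" for s x
    using p0 bspec[OF p0_min, of "(s, x)"] that assms by (auto simp: b_def split_beta tilt_moment_0_pos)
  have b0: "b > 0" using b[of 0 0] True by auto
  have "bounded ((\<lambda>(s, z). post_mean \<mu> s z) ` ?K)"
    by (intro compact_imp_bounded compact_continuous_image post_mean_continuous K assms)
  then obtain D where "\<forall>m\<in>(\<lambda>(s, z). post_mean \<mu> s z) ` ?K. norm m \<le> D"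
    unfolding bounded_iff by (elim exE)
  then have D: "\<bar>post_mean \<mu> s x\<bar> \<le> D" if "s\<in>{0..T}" "x\<in>{-R..R}" for s x
    using that by auto
  show ?thesis
  proof (intro exI[of _ "(\<bar>L1\<bar> + D * \<bar>L0\<bar>) / b"] conjI ballI)
    show "0 \<le> (\<bar>L1\<bar> + D * \<bar>L0\<bar>) / b"
      using b0 D[of 0 0] True by (intro divide_nonneg_nonneg add_nonneg_nonneg mult_nonneg_nonneg) auto
    fix s x y assume s: "s\<in>{0..T}" and x: "x\<in>{-R..R}" and y: "y\<in>{-R..R}"
    define a1 where "a1 = tilt_moment 1 s x"
    define b1 where "b1 = tilt_moment 0 s x"
    define a2 where "a2 = tilt_moment 1 s y"
    define b2 where "b2 = tilt_moment 0 s y"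
    have pos: "b1 > 0" "b2 > 0" "b \<le> b1"
      using b(2)[OF s x] s assms by (auto simp: b1_def b2_def tilt_moment_0_pos)
    have pm: "post_mean \<mu> s x = a1 / b1" "post_mean \<mu> s y = a2 / b2"
      using s assms by (auto simp: post_mean_eq a1_def a2_def b1_def b2_def)
    have "a1 / b1 - a2 / b2 = ((a1 - a2) + a2 / b2 * (b2 - b1)) / b1"
      using pos(1,2) by (simp add: field_simps)
    then have "\<bar>a1 / b1 - a2 / b2\<bar> = \<bar>(a1 - a2) + a2 / b2 * (b2 - b1)\<bar> / b1"
      using pos(1) by simp
    also have "\<dots> \<le> (\<bar>a1 - a2\<bar> + \<bar>a2 / b2\<bar> * \<bar>b2 - b1\<bar>) / b1"
      using abs_triangle_ineq[of "a1 - a2" "a2 / b2 * (b2 - b1)"] pos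
      by (intro divide_right_mono) (auto simp: abs_mult)
    also have "\<dots> \<le> (\<bar>a1 - a2\<bar> + \<bar>a2 / b2\<bar> * \<bar>b2 - b1\<bar>) / b"
      using pos b0 by (intro divide_left_mono add_nonneg_nonneg mult_nonneg_nonneg mult_pos_pos) auto
    also have "\<dots> \<le> (\<bar>L1\<bar> * \<bar>x - y\<bar> + D * (\<bar>L0\<bar> * \<bar>x - y\<bar>)) / b"
    proof (intro divide_right_mono add_mono mult_mono)
      show "\<bar>a1 - a2\<bar> \<le> \<bar>L1\<bar> * \<bar>x - y\<bar>"
        using L1[OF s x y] mult_right_mono[OF abs_ge_self[of L1], of "\<bar>x - y\<bar>"]
        by (simp add: a1_def a2_def)
      show "\<bar>a2 / b2\<bar> \<le> D" using D[OF s y] by (simp add: pm)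
      show "\<bar>b2 - b1\<bar> \<le> \<bar>L0\<bar> * \<bar>x - y\<bar>"
        using L0[OF s x y] mult_right_mono[OF abs_ge_self[of L0], of "\<bar>x - y\<bar>"]
        by (simp add: b1_def b2_def abs_minus_commute)
      show "D \<ge> 0" using D[OF s y] by linarith
    qed (use b0 in auto)
    finally show "\<bar>post_mean \<mu> s x - post_mean \<mu> s y\<bar> \<le> (\<bar>L1\<bar> + D * \<bar>L0\<bar>) / b * \<bar>x - y\<bar>"
      unfolding pm by (simp add: algebra_simps)
  qed
qed

end

section \<open>Independence of Brownian increments from the completed past\<close>

locale brownian_past = prob_space M for M :: "'a measure" +
  fixes W :: "real \<Rightarrow> 'a \<Rightarrow> real" and t :: real
  assumes brownian: "brownian_motion M W" and start_nonneg: "0 \<le> t"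
begin

lemma W_measurable [measurable]: "s \<ge> 0 \<Longrightarrow> W s \<in> borel_measurable M"
  using brownian by (simp add: brownian_motion_def)

lemma increment_distributed:
  "0 \<le> s \<Longrightarrow> s < u \<Longrightarrow> distributed M lborel (\<lambda>\<omega>. W u \<omega> - W s \<omega>) (normal_density 0 (sqrt (u - s)))"
  using brownian by (simp add: brownian_motion_def)

text \<open>Finite-dimensional cylinders form a \<open>\<pi>\<close>-system. Independence from a
  later increment then has to be checked only for finitely many observation times, which is what
  \<open>brownian_motion\<close> provides.\<close>

definition fd_events :: "real \<Rightarrow> 'a set set" where
  "fd_events s = (\<Union>J\<in>{J. finite J \<and> J \<subseteq> {t..s}}.
     {(\<lambda>\<omega>. \<lambda>v\<in>J. W v \<omega> - W t \<omega>) -` A \<inter> space M |A. A \<in> sets (PiM J (\<lambda>_. borel))})"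

lemma fd_measurable:
  "J \<subseteq> {t..s} \<Longrightarrow> (\<lambda>\<omega>. \<lambda>v\<in>J. W v \<omega> - W t \<omega>) \<in> M \<rightarrow>\<^sub>M PiM J (\<lambda>_. borel)"
  using start_nonneg by (intro measurable_restrict borel_measurable_diff W_measurable) auto

lemma fd_events_subset: "fd_events s \<subseteq> events"
  unfolding fd_events_def using fd_measurable[THEN measurable_sets] by auto

lemma Int_stable_fd_events: "Int_stable (fd_events s)"
proof (rule Int_stableI)
  fix a b assume "a \<in> fd_events s" "b \<in> fd_events s"
  then obtain I J A B where IJ: "finite I" "I \<subseteq> {t..s}" "finite J" "J \<subseteq> {t..s}"
    and A: "A \<in> sets (PiM I (\<lambda>_. borel))" "a = (\<lambda>\<omega>. \<lambda>v\<in>I. W v \<omega> - W t \<omega>) -` A \<inter> space M"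
    and B: "B \<in> sets (PiM J (\<lambda>_. borel))" "b = (\<lambda>\<omega>. \<lambda>v\<in>J. W v \<omega> - W t \<omega>) -` B \<inter> space M"
    unfolding fd_events_def by auto
  let ?K = "I \<union> J"
  let ?P = "PiM ?K (\<lambda>_. borel :: real measure)"
  define D where "D = ((\<lambda>x. restrict x I) -` A \<inter> space ?P) \<inter> ((\<lambda>x. restrict x J) -` B \<inter> space ?P)"
  have "D \<in> sets ?P" unfolding D_def
    by (intro sets.Int measurable_sets[OF measurable_restrict_subset A(1)]
        measurable_sets[OF measurable_restrict_subset B(1)]) auto
  moreover have "a \<inter> b = (\<lambda>\<omega>. \<lambda>v\<in>?K. W v \<omega> - W t \<omega>) -` D \<inter> space M"
  proof -
    have "restrict (\<lambda>v\<in>?K. W v \<omega> - W t \<omega>) I = (\<lambda>v\<in>I. W v \<omega> - W t \<omega>)"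
      "restrict (\<lambda>v\<in>?K. W v \<omega> - W t \<omega>) J = (\<lambda>v\<in>J. W v \<omega> - W t \<omega>)" for \<omega>
      by (auto simp: restrict_def)
    then show ?thesis
      unfolding D_def A(2) B(2) vimage_def by (auto simp: space_PiM simp del: restrict_restrict)
  qed
  ultimately show "a \<inter> b \<in> fd_events s"
    unfolding fd_events_def using IJ by (intro UN_I[of ?K]) auto
qed

text \<open>Sort the observation times and append s'. The values observed up to s are partial sums
  of the increments before the last one, and the last increment is independent of them.\<close>

lemma fd_events_indep:
  assumes s: "t \<le> s" "s < s'" and B: "B \<in> fd_events s" and A: "A \<in> sets borel"
  shows "prob (B \<inter> ((\<lambda>\<omega>. W s' \<omega> - W s \<omega>) -` A \<inter> space M))
    = prob B * prob ((\<lambda>\<omega>. W s' \<omega> - W s \<omega>) -` A \<inter> space M)"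
proof -
  from B obtain J D where J: "finite J" "J \<subseteq> {t..s}" and D: "D \<in> sets (PiM J (\<lambda>_. borel))"
    and B_eq: "B = (\<lambda>\<omega>. \<lambda>v\<in>J. W v \<omega> - W t \<omega>) -` D \<inter> space M"
    unfolding fd_events_def by auto
  \<comment> \<open>With t and s adjoined the sorted list begins at t and ends at s, so the next
    increment is exactly \<open>W s' - W s\<close>.\<close>
  define S where "S = insert t (insert s J)"
  define xs where "xs = sorted_list_of_set S"
  have S: "finite S" "S \<noteq> {}" using J by (auto simp: S_def)
  then have set_xs: "set xs = S" and sorted_xs: "sorted xs" by (auto simp: xs_def)
  define k where "k = length xs - 1"
  have len: "length xs = Suc k"
    using set_xs S by (cases xs) (auto simp: k_def)
  have bounds: "t \<le> v" "v \<le> s" if "v \<in> S" for v using that J s by (auto simp: S_def)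
  have "t \<in> set xs" "s \<in> set xs" by (auto simp: set_xs S_def)
  then obtain i0 i1 where i: "i0 < length xs" "xs ! i0 = t" "i1 < length xs" "xs ! i1 = s"
    unfolding in_set_conv_nth by auto
  have first: "xs ! 0 = t"
    using sorted_nth_mono[OF sorted_xs, of 0 i0] i bounds(1)[of "xs ! 0"] set_xs len
    by (metis le0 nth_mem order_antisym zero_less_Suc)
  have last: "xs ! k = s"
    using sorted_nth_mono[OF sorted_xs, of i1 k] i bounds(2)[of "xs ! k"] set_xs len
    by (metis less_Suc_eq_le lessI nth_mem order_antisym)
  \<comment> \<open>\<open>brownian_motion\<close> speaks of monotone sequences over all naturals,
    so from index \<open>Suc k\<close> on the sequence stays at s'. Increment k is then the future
    one; those below k belong to the past.\<close>
  define ts where "ts i = (if i \<le> k then xs ! i else s')" for i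
  have "mono ts"
  proof (rule monoI)
    fix i j :: nat assume "i \<le> j"
    then show "ts i \<le> ts j"
      using sorted_nth_mono[OF sorted_xs, of i j] bounds(2)[of "xs ! i"] set_xs len s
      by (auto simp: ts_def less_Suc_eq_le intro!: order_trans[OF bounds(2) less_imp_le])
  qed
  define X where "X i \<omega> = W (ts (Suc i)) \<omega> - W (ts i) \<omega>" for i \<omega>
  have "0 \<le> ts 0" using first start_nonneg by (simp add: ts_def)
  with \<open>mono ts\<close> have "indep_vars (\<lambda>_. borel) X {..<Suc k}"
    using brownian[unfolded brownian_motion_def, THEN conjunct2, THEN conjunct2, THEN conjunct2, THEN conjunct2, THEN conjunct2]
    unfolding X_def[abs_def] by simp
  then have ind: "indep_var (PiM {..<k} (\<lambda>_. borel)) (\<lambda>\<omega>. restrict (\<lambda>i. X i \<omega>) {..<k})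
      (PiM {k} (\<lambda>_. borel)) (\<lambda>\<omega>. restrict (\<lambda>i. X i \<omega>) {k})"
    by (rule indep_var_restrict) auto
  have "\<forall>v\<in>J. \<exists>i\<le>k. xs ! i = v"
    using set_xs len by (auto simp: S_def in_set_conv_nth less_Suc_eq_le dest!: equalityD2)
  then obtain idx where idx: "\<And>v. v \<in> J \<Longrightarrow> idx v \<le> k" "\<And>v. v \<in> J \<Longrightarrow> xs ! idx v = v"
    by metis
  have tele: "(\<Sum>j<i. X j \<omega>) = W (xs ! i) \<omega> - W t \<omega>" if "i \<le> k" for i \<omega>
  proof -
    have "(\<Sum>j<i. X j \<omega>) = W (ts i) \<omega> - W (ts 0) \<omega>"
      unfolding X_def by (rule sum_lessThan_telescope)
    then show ?thesis using that first by (simp add: ts_def)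
  qed
  \<comment> \<open>Partial sums recover the observed values, so the cylinder becomes an event of
    the first k increments.\<close>
  let ?\<phi> = "\<lambda>x. \<lambda>v\<in>J. \<Sum>j<idx v. x j :: real"
  have \<phi>: "?\<phi> \<in> PiM {..<k} (\<lambda>_. borel) \<rightarrow>\<^sub>M PiM J (\<lambda>_. borel)"
    by (intro measurable_restrict borel_measurable_sum measurable_component_singleton)
       (use idx in force)
  have \<psi>: "(\<lambda>x. x k) \<in> PiM {k} (\<lambda>_. borel :: real measure) \<rightarrow>\<^sub>M borel"
    by (rule measurable_component_singleton) simp
  let ?D = "?\<phi> -` D \<inter> space (PiM {..<k} (\<lambda>_. borel))"
  let ?A = "(\<lambda>x. x k) -` A \<inter> space (PiM {k} (\<lambda>_. borel :: real measure))"
  have past_eq: "(\<lambda>\<omega>. restrict (\<lambda>i. X i \<omega>) {..<k}) -` ?D \<inter> space M = B"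
  proof -
    have "?\<phi> (restrict (\<lambda>i. X i \<omega>) {..<k}) = (\<lambda>v\<in>J. W v \<omega> - W t \<omega>)" for \<omega>
    proof (intro ext)
      fix v
      have "(\<Sum>j<idx v. restrict (\<lambda>i. X i \<omega>) {..<k} j) = (\<Sum>j<idx v. X j \<omega>)" if "v \<in> J"
        using idx(1)[OF that] by (intro sum.cong) auto
      then show "?\<phi> (restrict (\<lambda>i. X i \<omega>) {..<k}) v = (\<lambda>v\<in>J. W v \<omega> - W t \<omega>) v"
        using idx tele by simp
    qed
    then show ?thesis unfolding B_eq by (auto simp: space_PiM)
  qed
  have next_eq: "(\<lambda>\<omega>. restrict (\<lambda>i. X i \<omega>) {k}) -` ?A \<inter> space M = (\<lambda>\<omega>. W s' \<omega> - W s \<omega>) -` A \<inter> space M"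
    using last by (auto simp: X_def ts_def space_PiM)
  have both_eq: "(\<lambda>\<omega>. (restrict (\<lambda>i. X i \<omega>) {..<k}, restrict (\<lambda>i. X i \<omega>) {k})) -` (?D \<times> ?A) \<inter> space M
      = B \<inter> ((\<lambda>\<omega>. W s' \<omega> - W s \<omega>) -` A \<inter> space M)"
    unfolding past_eq[symmetric] next_eq[symmetric] by blast
  from indep_varD[OF ind measurable_sets[OF \<phi> D] measurable_sets[OF \<psi> A]] show ?thesis
    unfolding both_eq past_eq next_eq .
qed

text \<open>Completed with the null sets of \<open>M\<close>, because the observed process is a functional of the noise only
  almost surely.\<close>

definition past :: "real \<Rightarrow> 'a measure" where
  "past s = sigma (space M) {B \<in> events. \<exists>B'\<in>sigma_sets (space M) (fd_events s). AE \<omega> in M. \<omega> \<in> B \<longleftrightarrow> \<omega> \<in> B'}"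

lemma sigma_sets_fd_events: "sigma_sets (space M) (fd_events s) \<subseteq> events"
  using fd_events_subset by (rule sets.sigma_sets_subset)

lemma space_past [simp]: "space (past s) = space M"
  unfolding past_def by (rule space_measure_of) (use sets.sets_into_space in auto)

text \<open>Almost sure agreement with a raw event survives complements and countable unions, so the
  generating collection is already a sigma-algebra and membership can be unfolded.\<close>

lemma sets_past:
  "sets (past s) = {B \<in> events. \<exists>B'\<in>sigma_sets (space M) (fd_events s). AE \<omega> in M. \<omega> \<in> B \<longleftrightarrow> \<omega> \<in> B'}"
    (is "_ = ?C")
proof -
  interpret F: sigma_algebra "space M" "sigma_sets (space M) (fd_events s)"
    by (rule sigma_algebra_sigma_sets) (use fd_events_subset sets.sets_into_space in blast)
  have "sigma_algebra (space M) ?C"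
  proof (unfold sigma_algebra_iff2, intro conjI ballI allI impI)
    show "?C \<subseteq> Pow (space M)" using sets.sets_into_space by auto
    show "{} \<in> ?C" by (auto intro!: bexI[of _ "{}"] sigma_sets.Empty)
    fix B assume "B \<in> ?C"
    then obtain B' where B: "B \<in> events" "B' \<in> sigma_sets (space M) (fd_events s)"
      "AE \<omega> in M. \<omega> \<in> B \<longleftrightarrow> \<omega> \<in> B'" by auto
    have "AE \<omega> in M. \<omega> \<in> space M - B \<longleftrightarrow> \<omega> \<in> space M - B'"
      using B(3) by eventually_elim auto
    moreover have "space M - B' \<in> sigma_sets (space M) (fd_events s)"
      using B(2) by (rule sigma_sets.Compl)
    moreover have "space M - B \<in> events" using B(1) by (rule sets.compl_sets)
    ultimately show "space M - B \<in> ?C" by blast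
  next
    fix B :: "nat \<Rightarrow> 'a set" assume "range B \<subseteq> ?C"
    then have "\<forall>i. \<exists>B'\<in>sigma_sets (space M) (fd_events s). AE \<omega> in M. \<omega> \<in> B i \<longleftrightarrow> \<omega> \<in> B'"
      and ev: "range B \<subseteq> events" by auto
    then obtain B' where B': "\<And>i. B' i \<in> sigma_sets (space M) (fd_events s)"
      "\<And>i. AE \<omega> in M. \<omega> \<in> B i \<longleftrightarrow> \<omega> \<in> B' i" by metis
    have "AE \<omega> in M. \<forall>i. \<omega> \<in> B i \<longleftrightarrow> \<omega> \<in> B' i" using B'(2) by (simp add: AE_all_countable)
    then have "AE \<omega> in M. \<omega> \<in> (\<Union>i. B i) \<longleftrightarrow> \<omega> \<in> (\<Union>i. B' i)" by eventually_elim auto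
    moreover have "(\<Union>i. B' i) \<in> sigma_sets (space M) (fd_events s)"
      using B'(1) by (rule sigma_sets.Union)
    moreover have "(\<Union>i. B i) \<in> events" using ev by (rule sets.countable_UN)
    ultimately show "(\<Union>i. B i) \<in> ?C" by blast
  qed
  then show ?thesis unfolding past_def by (rule sigma_algebra.sets_measure_of_eq)
qed

lemma sets_past_subset: "sets (past s) \<subseteq> events"
  by (auto simp: sets_past)

lemma measurable_past: "f \<in> past s \<rightarrow>\<^sub>M N \<Longrightarrow> f \<in> M \<rightarrow>\<^sub>M N"
  using sets_past_subset by (auto simp: measurable_def)

lemma fd_events_mono:
  assumes "s \<le> u"
  shows "fd_events s \<subseteq> fd_events u"
  unfolding fd_events_def
proof (rule UN_mono)
  have "{t..s} \<subseteq> {t..u}" using assms by simp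
  then show "{J. finite J \<and> J \<subseteq> {t..s}} \<subseteq> {J. finite J \<and> J \<subseteq> {t..u}}" by blast
qed (rule subset_refl)

lemma past_mono:
  assumes "s \<le> u"
  shows "sets (past s) \<subseteq> sets (past u)"
proof
  fix B assume "B \<in> sets (past s)"
  then obtain B' where "B \<in> events" "B' \<in> sigma_sets (space M) (fd_events s)" "AE \<omega> in M. \<omega> \<in> B \<longleftrightarrow> \<omega> \<in> B'"
    by (auto simp: sets_past)
  moreover have "B' \<in> sigma_sets (space M) (fd_events u)"
    by (rule subsetD[OF sigma_sets_mono'[OF fd_events_mono[OF assms]]]) fact
  ultimately show "B \<in> sets (past u)" by (auto simp: sets_past)
qed

lemma measurable_past_mono:
  assumes "s \<le> u" "f \<in> past s \<rightarrow>\<^sub>M N"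
  shows "f \<in> past u \<rightarrow>\<^sub>M N"
  by (rule subsetD[OF measurable_mono assms(2)]) (simp_all add: past_mono[OF assms(1)])

text \<open>The \<open>\<pi>\<close>-system argument extends independence from cylinders to the
  sigma-algebra they generate. Replacing an event by one that agrees almost surely changes no
  probability, which covers the completion.\<close>

lemma past_indep:
  assumes s: "t \<le> s" "s < s'" and B: "B \<in> sets (past s)" and A: "A \<in> sets borel"
  shows "prob (B \<inter> ((\<lambda>\<omega>. W s' \<omega> - W s \<omega>) -` A \<inter> space M))
    = prob B * prob ((\<lambda>\<omega>. W s' \<omega> - W s \<omega>) -` A \<inter> space M)"
proof -
  let ?X = "\<lambda>\<omega>. W s' \<omega> - W s \<omega>"
  let ?E = "{?X -` A \<inter> space M |A. A \<in> sets borel}"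
  have X: "?X \<in> borel_measurable M" using s start_nonneg by simp
  have E: "?E \<subseteq> events" using measurable_sets[OF X] by auto
  have "Int_stable ?E"
  proof (rule Int_stableI)
    fix a b assume "a \<in> ?E" "b \<in> ?E"
    then obtain A B where "A \<in> sets borel" "B \<in> sets borel" "a = ?X -` A \<inter> space M" "b = ?X -` B \<inter> space M"
      by auto
    then show "a \<inter> b \<in> ?E" by (auto intro!: exI[of _ "A \<inter> B"])
  qed
  moreover have "indep_set (fd_events s) ?E"
    unfolding indep_sets2_eq using fd_events_subset E fd_events_indep[OF s] by auto
  ultimately have ind: "indep_set (sigma_sets (space M) (fd_events s)) (sigma_sets (space M) ?E)"
    using Int_stable_fd_events by (intro indep_set_sigma_sets)
  from B obtain B' where B': "B \<in> events" "B' \<in> sigma_sets (space M) (fd_events s)"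
    "AE \<omega> in M. \<omega> \<in> B \<longleftrightarrow> \<omega> \<in> B'" by (auto simp: sets_past)
  have ev: "B' \<in> events" "?X -` A \<inter> space M \<in> events"
    using B' sigma_sets_fd_events measurable_sets[OF X A] by auto
  have "prob (B' \<inter> (?X -` A \<inter> space M)) = prob B' * prob (?X -` A \<inter> space M)"
    using A by (intro indep_setD[OF ind] B' sigma_sets.Basic) auto
  moreover have "prob B' = prob B"
    by (rule measure_eq_AE) (use B' ev in auto)
  moreover have "prob (B' \<inter> (?X -` A \<inter> space M)) = prob (B \<inter> (?X -` A \<inter> space M))"
    by (rule measure_eq_AE) (use B' ev in auto)
  ultimately show ?thesis by simp
qed

text \<open>Independence in the form used for martingales. Stated in \<open>ennreal\<close>, it
  applies to products of unbounded exponentials without an integrability argument.\<close>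

lemma past_nn_integral_mult:
  fixes g :: "'a \<Rightarrow> ennreal" and \<phi> :: "real \<Rightarrow> ennreal"
  assumes s: "t \<le> s" "s < s'" and g: "g \<in> borel_measurable (past s)" and \<phi>: "\<phi> \<in> borel_measurable borel"
  shows "(\<integral>\<^sup>+\<omega>. g \<omega> * \<phi> (W s' \<omega> - W s \<omega>) \<partial>M) = (\<integral>\<^sup>+\<omega>. g \<omega> \<partial>M) * (\<integral>\<^sup>+\<omega>. \<phi> (W s' \<omega> - W s \<omega>) \<partial>M)"
proof -
  let ?X = "\<lambda>\<omega>. W s' \<omega> - W s \<omega>"
  let ?E = "{?X -` A \<inter> space M |A. A \<in> sets borel}"
  have X: "?X \<in> borel_measurable M" using s start_nonneg by simp
  have \<phi>X: "(\<lambda>\<omega>. \<phi> (?X \<omega>)) \<in> borel_measurable M" using X \<phi> by simp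
  have "indep_var borel g borel (\<lambda>\<omega>. \<phi> (?X \<omega>))"
    unfolding indep_var_eq
  proof (intro conjI)
    show "random_variable borel g" using g by (rule measurable_past)
    show "random_variable borel (\<lambda>\<omega>. \<phi> (?X \<omega>))" by fact
    have 1: "sigma_sets (space M) {g -` A \<inter> space M |A. A \<in> sets borel} \<subseteq> sets (past s)"
      using measurable_sets[OF g] sets.sigma_sets_subset[of "{g -` A \<inter> space M |A. A \<in> sets borel}" "past s"] by auto
    have 2: "sigma_sets (space M) {(\<lambda>\<omega>. \<phi> (?X \<omega>)) -` A \<inter> space M |A. A \<in> sets borel} \<subseteq> ?E"
    proof -
      have "{(\<lambda>\<omega>. \<phi> (?X \<omega>)) -` A \<inter> space M |A. A \<in> sets borel} \<subseteq> sets (vimage_algebra (space M) ?X borel)"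
      proof (clarsimp simp: sets_vimage_algebra2)
        fix A :: "ennreal set" assume "A \<in> sets borel"
        then show "\<exists>B. (\<lambda>\<omega>. \<phi> (?X \<omega>)) -` A \<inter> space M = ?X -` B \<inter> space M \<and> B \<in> sets borel"
          using measurable_sets[OF \<phi>, of A] by (intro exI[of _ "\<phi> -` A"]) auto
      qed
      from sets.sigma_sets_subset[OF this] show ?thesis by (simp add: sets_vimage_algebra2)
    qed
    show "indep_set (sigma_sets (space M) {g -` A \<inter> space M |A. A \<in> sets borel})
        (sigma_sets (space M) {(\<lambda>\<omega>. \<phi> (?X \<omega>)) -` A \<inter> space M |A. A \<in> sets borel})"
      unfolding indep_sets2_eq
    proof (intro conjI ballI)
      show "sigma_sets (space M) {g -` A \<inter> space M |A. A \<in> sets borel} \<subseteq> events"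
        using 1 sets_past_subset by blast
      show "sigma_sets (space M) {(\<lambda>\<omega>. \<phi> (?X \<omega>)) -` A \<inter> space M |A. A \<in> sets borel} \<subseteq> events"
        using 2 measurable_sets[OF X] by blast
      fix a b assume "a \<in> sigma_sets (space M) {g -` A \<inter> space M |A. A \<in> sets borel}"
        "b \<in> sigma_sets (space M) {(\<lambda>\<omega>. \<phi> (?X \<omega>)) -` A \<inter> space M |A. A \<in> sets borel}"
      then show "prob (a \<inter> b) = prob a * prob b"
        using 1 2 past_indep[OF s] by blast
    qed
  qed
  \<comment> \<open>\<open>indep_vars_nn_integral\<close> works with indexed families, so the pair
    becomes a family over \<open>bool\<close>.\<close>
  then have "indep_vars (\<lambda>_. borel) (case_bool g (\<lambda>\<omega>. \<phi> (?X \<omega>))) UNIV"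
    unfolding indep_var_def by (simp add: case_bool_if if_distrib cong: if_cong)
  from indep_vars_nn_integral[OF _ this] show ?thesis
    by (simp add: UNIV_bool mult.commute)
qed

lemma increment_measurable_past:
  assumes "t \<le> v" "v \<le> s"
  shows "(\<lambda>\<omega>. W v \<omega> - W t \<omega>) \<in> borel_measurable (past s)"
proof (rule measurableI)
  fix A :: "real set" assume A: "A \<in> sets borel"
  have "(\<lambda>x. x v) -` A \<inter> space (PiM {v} (\<lambda>_. borel)) \<in> sets (PiM {v} (\<lambda>_. borel))"
    by (intro measurable_sets[OF _ A] measurable_component_singleton) simp
  then have "(\<lambda>\<omega>. \<lambda>v\<in>{v}. W v \<omega> - W t \<omega>) -` ((\<lambda>x. x v) -` A \<inter> space (PiM {v} (\<lambda>_. borel))) \<inter> space M \<in> fd_events s"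
    unfolding fd_events_def using assms by (intro UN_I[of "{v}"] CollectI exI conjI refl) auto
  also have "(\<lambda>\<omega>. \<lambda>v\<in>{v}. W v \<omega> - W t \<omega>) -` ((\<lambda>x. x v) -` A \<inter> space (PiM {v} (\<lambda>_. borel))) \<inter> space M
      = (\<lambda>\<omega>. W v \<omega> - W t \<omega>) -` A \<inter> space M"
    by (auto simp: space_PiM)
  finally have "(\<lambda>\<omega>. W v \<omega> - W t \<omega>) -` A \<inter> space M \<in> fd_events s" .
  then show "(\<lambda>\<omega>. W v \<omega> - W t \<omega>) -` A \<inter> space (past s) \<in> sets (past s)"
    using fd_events_subset by (auto simp: sets_past intro!: bexI[of _ "(\<lambda>\<omega>. W v \<omega> - W t \<omega>) -` A \<inter> space M"])
qed simp

text \<open>This is what the completion buys: a random variable that agrees almost surely with a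
  functional of the noise is itself measurable for the past.\<close>

lemma measurable_past_AE_cong:
  fixes f g :: "'a \<Rightarrow> 'b::topological_space"
  assumes f: "f \<in> borel_measurable (past s)" and g: "g \<in> borel_measurable M" and eq: "AE \<omega> in M. f \<omega> = g \<omega>"
  shows "g \<in> borel_measurable (past s)"
proof (rule measurableI)
  fix A :: "'b set" assume A: "A \<in> sets borel"
  have "f -` A \<inter> space M \<in> sets (past s)" using measurable_sets[OF f A] by simp
  then obtain B where B: "B \<in> sigma_sets (space M) (fd_events s)" "AE \<omega> in M. \<omega> \<in> f -` A \<inter> space M \<longleftrightarrow> \<omega> \<in> B"
    by (auto simp: sets_past)
  have "AE \<omega> in M. \<omega> \<in> g -` A \<inter> space M \<longleftrightarrow> \<omega> \<in> B"
    using eq B(2) by eventually_elim auto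
  then show "g -` A \<inter> space (past s) \<in> sets (past s)"
    using B measurable_sets[OF g A] by (auto simp: sets_past)
qed simp

text \<open>Exponential tilting of a centred normal density by exp (a x) gives a constant times the
  normal density with mean a \<open>\<sigma>\<close>^2; the constant is the moment.\<close>

lemma increment_exp_moment:
  assumes "0 \<le> s" "s < u"
  shows "(\<integral>\<^sup>+\<omega>. ennreal (exp (a * (W u \<omega> - W s \<omega>))) \<partial>M) = ennreal (exp (a\<^sup>2 * (u - s) / 2))"
proof -
  define \<sigma> where "\<sigma> = sqrt (u - s)"
  have \<sigma>: "\<sigma> > 0" "\<sigma>\<^sup>2 = u - s" using assms by (auto simp: \<sigma>_def)
  interpret N: prob_space "density lborel (normal_density (a * \<sigma>\<^sup>2) \<sigma>)"
    using \<sigma> by (intro prob_space_normal_density)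
  have e: "normal_density 0 \<sigma> x * exp (a * x) = exp (a\<^sup>2 * \<sigma>\<^sup>2 / 2) * normal_density (a * \<sigma>\<^sup>2) \<sigma> x" for x
  proof -
    have "- x\<^sup>2 / (2 * \<sigma>\<^sup>2) + a * x = a\<^sup>2 * \<sigma>\<^sup>2 / 2 + - (x - a * \<sigma>\<^sup>2)\<^sup>2 / (2 * \<sigma>\<^sup>2)"
      using \<sigma>(1) by (simp add: field_simps power2_eq_square)
    then show ?thesis
      unfolding normal_density_def by (simp add: exp_add[symmetric])
  qed
  have "(\<integral>\<^sup>+\<omega>. ennreal (exp (a * (W u \<omega> - W s \<omega>))) \<partial>M)
      = (\<integral>\<^sup>+x. ennreal (normal_density 0 \<sigma> x) * ennreal (exp (a * x)) \<partial>lborel)"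
    using distributed_nn_integral[OF increment_distributed[OF assms], of "\<lambda>x. ennreal (exp (a * x))"]
    by (simp add: \<sigma>_def)
  also have "\<dots> = (\<integral>\<^sup>+x. ennreal (exp (a\<^sup>2 * \<sigma>\<^sup>2 / 2)) * ennreal (normal_density (a * \<sigma>\<^sup>2) \<sigma> x) \<partial>lborel)"
    by (intro nn_integral_cong) (simp add: ennreal_mult[symmetric] e)
  also have "\<dots> = ennreal (exp (a\<^sup>2 * \<sigma>\<^sup>2 / 2))"
    using N.emeasure_space_1 by (subst nn_integral_cmult) (auto simp: emeasure_density)
  finally show ?thesis by (simp add: \<sigma>)
qed

text \<open>One-step martingale property of the normalised exponential. Testing against every
  nonnegative g from the past takes the place of conditional expectation.\<close>

lemma past_exp_increment:
  fixes g :: "'a \<Rightarrow> ennreal"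
  assumes s: "t \<le> s" "s < u" and g: "g \<in> borel_measurable (past s)"
  shows "(\<integral>\<^sup>+\<omega>. g \<omega> * ennreal (exp (a * (W u \<omega> - W s \<omega>) - a\<^sup>2 * (u - s) / 2)) \<partial>M) = (\<integral>\<^sup>+\<omega>. g \<omega> \<partial>M)"
proof -
  let ?c = "exp (- (a\<^sup>2 * (u - s) / 2))"
  have "0 \<le> s" using s start_nonneg by simp
  have "(\<integral>\<^sup>+\<omega>. g \<omega> * ennreal (exp (a * (W u \<omega> - W s \<omega>) - a\<^sup>2 * (u - s) / 2)) \<partial>M)
      = (\<integral>\<^sup>+\<omega>. g \<omega> \<partial>M) * (\<integral>\<^sup>+\<omega>. ennreal (exp (a * (W u \<omega> - W s \<omega>) - a\<^sup>2 * (u - s) / 2)) \<partial>M)"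
    by (rule past_nn_integral_mult[OF s g, of "\<lambda>x. ennreal (exp (a * x - a\<^sup>2 * (u - s) / 2))"]) measurable
  also have "(\<integral>\<^sup>+\<omega>. ennreal (exp (a * (W u \<omega> - W s \<omega>) - a\<^sup>2 * (u - s) / 2)) \<partial>M)
      = (\<integral>\<^sup>+\<omega>. ennreal ?c * ennreal (exp (a * (W u \<omega> - W s \<omega>))) \<partial>M)"
    by (intro nn_integral_cong) (simp add: ennreal_mult[symmetric] exp_add[symmetric])
  also have "\<dots> = ennreal ?c * ennreal (exp (a\<^sup>2 * (u - s) / 2))"
    using \<open>0 \<le> s\<close> s by (subst nn_integral_cmult) (auto simp: increment_exp_moment)
  also have "\<dots> = 1" by (simp add: ennreal_mult[symmetric] exp_add[symmetric])
  finally show ?thesis by simp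
qed

end

section \<open>Euler scheme and scaled paths on a grid\<close>

definition grid :: "real \<Rightarrow> real \<Rightarrow> nat \<Rightarrow> nat \<Rightarrow> real" where
  "grid t T n k = t + (T - t) * real k / real n"

lemma grid_0 [simp]: "grid t T n 0 = t"
  by (simp add: grid_def)

lemma grid_last [simp]: "n > 0 \<Longrightarrow> grid t T n n = T"
  by (simp add: grid_def)

lemma grid_Suc: "grid t T n (Suc k) = grid t T n k + (T - t) / real n"
  by (simp add: grid_def add_divide_distrib[symmetric] ring_distribs)

lemma grid_mono: "t \<le> T \<Longrightarrow> j \<le> k \<Longrightarrow> grid t T n j \<le> grid t T n k"
  by (auto simp: grid_def intro!: divide_right_mono mult_left_mono)

lemma grid_strict_mono: "t < T \<Longrightarrow> n > 0 \<Longrightarrow> j < k \<Longrightarrow> grid t T n j < grid t T n k"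
  by (auto simp: grid_def intro!: divide_strict_right_mono mult_strict_left_mono)

lemma grid_bounds: "t \<le> T \<Longrightarrow> k \<le> n \<Longrightarrow> n > 0 \<Longrightarrow> grid t T n k \<in> {t..T}"
  using grid_mono[of t T 0 k n] grid_mono[of t T k n n] by simp

text \<open>The path w enters only through its increments between grid times, so each approximation
  is a measurable function of finitely many increments of the noise.\<close>

fun euler :: "(real \<Rightarrow> real \<Rightarrow> real) \<Rightarrow> (real \<Rightarrow> real) \<Rightarrow> real \<Rightarrow> real \<Rightarrow> nat \<Rightarrow> real \<Rightarrow> nat \<Rightarrow> real" where
  "euler f w t T n z 0 = z"
| "euler f w t T n z (Suc k) = euler f w t T n z k
     + f (grid t T n k) (euler f w t T n z k) * ((T - t) / real n)
     + (w (grid t T n (Suc k)) - w (grid t T n k))"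

lemma gronwall_discrete:
  fixes e :: "nat \<Rightarrow> real"
  assumes "e 0 = 0" "\<And>k. k < n \<Longrightarrow> e (Suc k) \<le> (1 + a) * e k + b" "0 \<le> a" "0 \<le> b" "k \<le> n"
  shows "e k \<le> real k * b * exp (real k * a)"
  using \<open>k \<le> n\<close>
proof (induction k)
  case 0
  then show ?case using assms(1) by simp
next
  case (Suc k)
  have "e (Suc k) \<le> (1 + a) * (real k * b * exp (real k * a)) + b"
  proof -
    have "(1 + a) * e k \<le> (1 + a) * (real k * b * exp (real k * a))"
      using Suc assms(3) by (intro mult_left_mono) auto
    with assms(2)[of k] Suc.prems show ?thesis by simp
  qed
  also have "\<dots> \<le> exp a * (real k * b * exp (real k * a)) + b * exp (real (Suc k) * a)"
    using assms(3,4) exp_ge_add_one_self[of a]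
    by (intro add_mono mult_right_mono mult_left_le_one_le) (auto intro!: mult_le_cancel_left1[THEN iffD2] mult_nonneg_nonneg)
  also have "\<dots> = real (Suc k) * b * exp (real (Suc k) * a)"
    by (simp add: algebra_simps exp_add)
  finally show ?case .
qed

lemma uniform_modulus_grid:
  fixes g :: "real \<Rightarrow> real"
  assumes "continuous_on {t..T} g" "t < T" "\<epsilon> > 0"
  shows "\<forall>\<^sub>F n in sequentially. \<forall>k<n. \<forall>x\<in>{grid t T n k..grid t T n (Suc k)}. \<forall>y\<in>{grid t T n k..grid t T n (Suc k)}.
    \<bar>g x - g y\<bar> < \<epsilon>"
proof -
  have "uniformly_continuous_on {t..T} g"
    using assms(1) by (rule compact_uniformly_continuous) simp
  then obtain d where d: "d > 0" "\<And>x y. x \<in> {t..T} \<Longrightarrow> y \<in> {t..T} \<Longrightarrow> dist y x < d \<Longrightarrow> dist (g y) (g x) < \<epsilon>"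
    using assms(3) unfolding uniformly_continuous_on_def by metis
  have "(\<lambda>n. (T - t) / real n) \<longlonglongrightarrow> 0" by real_asymp
  then have "\<forall>\<^sub>F n in sequentially. (T - t) / real n < d" using d(1) by (rule order_tendstoD)
  then show ?thesis
  proof (rule eventually_mono[OF eventually_conj[OF _ eventually_gt_at_top[of 0]]], intro allI impI ballI)
    fix n k x y assume n: "(T - t) / real n < d \<and> 0 < n" and k: "k < n"
      and xy: "x \<in> {grid t T n k..grid t T n (Suc k)}" "y \<in> {grid t T n k..grid t T n (Suc k)}"
    have "grid t T n k \<in> {t..T}" "grid t T n (Suc k) \<in> {t..T}"
      using grid_bounds[of t T _ n] n k assms(2) by auto
    then have "x \<in> {t..T}" "y \<in> {t..T}" using xy by auto
    moreover have "dist x y < d"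
      using xy n by (auto simp: grid_Suc dist_real_def)
    ultimately show "\<bar>g x - g y\<bar> < \<epsilon>" using d(2)[of y x] by (simp add: dist_real_def)
  qed
qed

lemma integral_deviation_le:
  fixes f :: "real \<Rightarrow> real"
  assumes "a \<le> b" "continuous_on {a..b} f" "\<And>x. x \<in> {a..b} \<Longrightarrow> \<bar>f x - c\<bar> \<le> \<epsilon>"
  shows "\<bar>integral {a..b} f - c * (b - a)\<bar> \<le> \<epsilon> * (b - a)"
proof -
  have int: "(\<lambda>x. f x - c) integrable_on {a..b}"
    using assms(2) by (intro integrable_continuous_real continuous_intros)
  have "integral {a..b} f - c * (b - a) = integral {a..b} (\<lambda>x. f x - c)"
    using assms by (subst integral_diff) (auto intro: integrable_continuous_real)
  also have "\<bar>\<dots>\<bar> \<le> integral {a..b} (\<lambda>x. \<epsilon>)"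
    unfolding real_norm_def[symmetric]
    by (rule integral_norm_bound_integral[OF int]) (use assms(3) in auto)
  finally show ?thesis using assms(1) by (simp add: mult.commute)
qed

text \<open>Additive noise cancels in the difference between the path and the scheme. Each step adds
  an error from freezing the drift, controlled by the modulus of continuity along the path, and the
  Lipschitz bound propagates earlier errors; the discrete Gronwall inequality sums them.\<close>

lemma euler_converges:
  fixes f :: "real \<Rightarrow> real \<Rightarrow> real" and p w :: "real \<Rightarrow> real"
  assumes tT: "t < T"
    and cont: "continuous_on {t..T} (\<lambda>s. f s (p s))"
    and eq: "\<And>a b. t \<le> a \<Longrightarrow> a \<le> b \<Longrightarrow> b \<le> T \<Longrightarrow> p b - p a = integral {a..b} (\<lambda>s. f s (p s)) + (w b - w a)"
    and lip: "\<And>s x y. s \<in> {t..T} \<Longrightarrow> \<bar>f s x - f s y\<bar> \<le> L * \<bar>x - y\<bar>"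
  shows "(\<lambda>n. euler f w t T n (p t) n) \<longlonglongrightarrow> p T"
proof -
  have L: "L \<ge> 0" using lip[of t 0 1] tT by auto
  let ?C = "(T - t) * exp (L * (T - t))"
  show ?thesis
  proof (rule LIMSEQ_I)
    fix r :: real assume r: "0 < r"
    \<comment> \<open>The accumulated error is at most \<open>\<epsilon>\<close> times
      \<open>?C\<close>, here r / 2.\<close>
    define \<epsilon> where "\<epsilon> = r / (2 * ?C)"
    have C: "?C > 0" using tT by simp
    have \<epsilon>: "\<epsilon> > 0" using r C by (simp add: \<epsilon>_def)
    have "\<forall>\<^sub>F n in sequentially. norm (euler f w t T n (p t) n - p T) < r"
    proof (rule eventually_mono[OF eventually_conj[OF uniform_modulus_grid[OF cont tT \<epsilon>] eventually_gt_at_top[of 0]]], elim conjE)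
      fix n :: nat
      assume mod: "\<forall>k<n. \<forall>x\<in>{grid t T n k..grid t T n (Suc k)}. \<forall>y\<in>{grid t T n k..grid t T n (Suc k)}.
          \<bar>f x (p x) - f y (p y)\<bar> < \<epsilon>" and n: "0 < n"
      define \<Delta> where "\<Delta> = (T - t) / real n"
      have \<Delta>: "\<Delta> > 0" using tT n by (simp add: \<Delta>_def)
      let ?u = "grid t T n" and ?y = "euler f w t T n (p t)"
      have "\<bar>p (?u n) - ?y n\<bar> \<le> real n * (\<epsilon> * \<Delta>) * exp (real n * (L * \<Delta>))"
      proof (rule gronwall_discrete[of "\<lambda>k. \<bar>p (?u k) - ?y k\<bar>" n])
        fix k assume k: "k < n"
        have u: "t \<le> ?u k" "?u k \<le> ?u (Suc k)" "?u (Suc k) \<le> T" "?u (Suc k) = ?u k + \<Delta>"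
          using grid_bounds[of t T k n] grid_bounds[of t T "Suc k" n] grid_mono[of t T k "Suc k" n] k n tT
          by (auto simp: grid_Suc \<Delta>_def)
        have "\<bar>integral {?u k..?u (Suc k)} (\<lambda>s. f s (p s)) - f (?u k) (p (?u k)) * (?u (Suc k) - ?u k)\<bar>
            \<le> \<epsilon> * (?u (Suc k) - ?u k)"
        proof (rule integral_deviation_le)
          show "continuous_on {?u k..?u (Suc k)} (\<lambda>s. f s (p s))"
            using u by (intro continuous_on_subset[OF cont]) auto
          fix x assume "x \<in> {?u k..?u (Suc k)}"
          then show "\<bar>f x (p x) - f (?u k) (p (?u k))\<bar> \<le> \<epsilon>"
            using mod[rule_format, OF k, of x "?u k"] u by auto
        qed (use u in auto)
        moreover have "\<bar>(f (?u k) (p (?u k)) - f (?u k) (?y k)) * \<Delta>\<bar> \<le> L * \<bar>p (?u k) - ?y k\<bar> * \<Delta>"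
          using lip[of "?u k" "p (?u k)" "?y k"] u \<Delta> by (auto simp: abs_mult intro!: mult_right_mono)
        moreover have "p (?u (Suc k)) - ?y (Suc k) = (p (?u k) - ?y k)
            + (integral {?u k..?u (Suc k)} (\<lambda>s. f s (p s)) - f (?u k) (p (?u k)) * (?u (Suc k) - ?u k))
            + (f (?u k) (p (?u k)) - f (?u k) (?y k)) * \<Delta>"
          using eq[of "?u k" "?u (Suc k)"] u by (simp add: \<Delta>_def[symmetric] algebra_simps)
        ultimately show "\<bar>p (?u (Suc k)) - ?y (Suc k)\<bar> \<le> (1 + L * \<Delta>) * \<bar>p (?u k) - ?y k\<bar> + \<epsilon> * \<Delta>"
          using u(4) by (simp add: algebra_simps)
      qed (use L \<Delta> \<epsilon> in auto)
      also have "\<dots> = \<epsilon> * ?C"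
        using n by (simp add: \<Delta>_def mult_ac)
      also have "\<dots> < r" using r C by (simp add: \<epsilon>_def)
      finally show "norm (?y n - p T) < r" using n by (simp add: abs_minus_commute)
    qed
    then show "\<exists>no. \<forall>n\<ge>no. norm (euler f w t T n (p t) n - p T) < r"
      by (simp add: eventually_sequentially)
  qed
qed

text \<open>Formally, dp <= (q - p) / (1 - s) ds + dw gives d ((p - q) / (1 - s)) <= dw / (1 - s),
  since the drift cancels the derivative of 1 / (1 - s). On the grid this product rule is exact if
  the integrand is frozen at the right endpoint while the noise weight is taken at the left one; the
  only error is the freezing.\<close>

lemma scaled_gap_le:
  fixes p w :: "real \<Rightarrow> real"
  assumes tT: "t < T" "T < 1" and \<epsilon>: "\<epsilon> > 0"
    and cont: "continuous_on {t..T} p"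
    and le: "\<And>a b. t \<le> a \<Longrightarrow> a \<le> b \<Longrightarrow> b \<le> T \<Longrightarrow> p b - p a \<le> integral {a..b} (\<lambda>s. (q - p s) / (1 - s)) + (w b - w a)"
  shows "\<forall>\<^sub>F n in sequentially. \<forall>k\<le>n. (p (grid t T n k) - q) / (1 - grid t T n k)
    \<le> (p t - q) / (1 - t) + (\<Sum>j<k. (w (grid t T n (Suc j)) - w (grid t T n j)) / (1 - grid t T n j)) + \<epsilon>"
proof -
  define g where "g s = (p s - q) / (1 - s)" for s
  have g_cont: "continuous_on {t..T} g"
    unfolding g_def using tT by (intro continuous_intros cont) auto
  \<comment> \<open>Summed over n steps, the error \<open>\<delta>\<close> (T - t) / n / (1 - T) of
    a single step amounts to \<open>\<epsilon>\<close>.\<close>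
  define \<delta> where "\<delta> = \<epsilon> * (1 - T) / (T - t)"
  have \<delta>: "\<delta> > 0" using \<epsilon> tT by (simp add: \<delta>_def)
  show ?thesis
  proof (rule eventually_mono[OF eventually_conj[OF uniform_modulus_grid[OF g_cont tT(1) \<delta>] eventually_gt_at_top[of 0]]], elim conjE)
    fix n :: nat
    assume mod: "\<forall>k<n. \<forall>x\<in>{grid t T n k..grid t T n (Suc k)}. \<forall>y\<in>{grid t T n k..grid t T n (Suc k)}. \<bar>g x - g y\<bar> < \<delta>"
      and n: "0 < n"
    define \<Delta> where "\<Delta> = (T - t) / real n"
    have \<Delta>: "\<Delta> > 0" using tT n by (simp add: \<Delta>_def)
    let ?u = "grid t T n"
    have "g (?u k) \<le> g t + (\<Sum>j<k. (w (?u (Suc j)) - w (?u j)) / (1 - ?u j)) + real k * (\<delta> * \<Delta> / (1 - T))"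
      if "k \<le> n" for k
      using that
    proof (induction k)
      case (Suc k)
      have u: "t \<le> ?u k" "?u k \<le> ?u (Suc k)" "?u (Suc k) \<le> T" "?u (Suc k) = ?u k + \<Delta>"
        using grid_bounds[of t T k n] grid_bounds[of t T "Suc k" n] grid_mono[of t T k "Suc k" n] Suc n tT
        by (auto simp: grid_Suc \<Delta>_def)
      have int: "(\<lambda>s. (q - p s) / (1 - s)) = (\<lambda>s. - g s)"
        by (auto simp: g_def diff_divide_distrib)
      have "\<bar>integral {?u k..?u (Suc k)} (\<lambda>s. - g s) - (- g (?u (Suc k))) * (?u (Suc k) - ?u k)\<bar>
          \<le> \<delta> * (?u (Suc k) - ?u k)"
      proof (rule integral_deviation_le)
        show "continuous_on {?u k..?u (Suc k)} (\<lambda>s. - g s)"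
          using u by (intro continuous_on_subset[OF continuous_on_minus[OF g_cont]]) auto
        fix x assume "x \<in> {?u k..?u (Suc k)}"
        then show "\<bar>- g x - - g (?u (Suc k))\<bar> \<le> \<delta>"
          using mod[rule_format, of k "?u (Suc k)" x] u Suc.prems by auto
      qed (use u in auto)
      then have "p (?u (Suc k)) - p (?u k) \<le> - g (?u (Suc k)) * \<Delta> + \<delta> * \<Delta> + (w (?u (Suc k)) - w (?u k))"
        using le[of "?u k" "?u (Suc k)"] u unfolding int by auto
      then have "(p (?u (Suc k)) - p (?u k) + g (?u (Suc k)) * \<Delta>) / (1 - ?u k)
          \<le> (\<delta> * \<Delta> + (w (?u (Suc k)) - w (?u k))) / (1 - ?u k)"
        using u tT by (intro divide_right_mono) auto
      \<comment> \<open>The exact discrete product rule: write p - q as g times (1 - time) at both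
        endpoints and use that the two times differ by \<open>\<Delta>\<close>.\<close>
      moreover have "(p (?u (Suc k)) - p (?u k) + g (?u (Suc k)) * \<Delta>) / (1 - ?u k) = g (?u (Suc k)) - g (?u k)"
      proof -
        have "p (?u (Suc k)) - q = g (?u (Suc k)) * (1 - ?u (Suc k))" "p (?u k) - q = g (?u k) * (1 - ?u k)"
          using u(1-3) tT by (simp_all add: g_def)
        moreover have "1 - ?u (Suc k) = 1 - ?u k - \<Delta>" using u(4) by simp
        ultimately have "p (?u (Suc k)) - p (?u k) + g (?u (Suc k)) * \<Delta> = (g (?u (Suc k)) - g (?u k)) * (1 - ?u k)"
          by (simp add: algebra_simps)
        then show ?thesis using u tT by simp
      qed
      moreover have "\<delta> * \<Delta> / (1 - ?u k) \<le> \<delta> * \<Delta> / (1 - T)"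
        using u tT \<delta> \<Delta> by (intro divide_left_mono mult_pos_pos) auto
      moreover have "(\<delta> * \<Delta> + (w (?u (Suc k)) - w (?u k))) / (1 - ?u k)
          = \<delta> * \<Delta> / (1 - ?u k) + (w (?u (Suc k)) - w (?u k)) / (1 - ?u k)"
        by (rule add_divide_distrib)
      moreover have "real (Suc k) * (\<delta> * \<Delta> / (1 - T)) = real k * (\<delta> * \<Delta> / (1 - T)) + \<delta> * \<Delta> / (1 - T)"
        unfolding of_nat_Suc by (simp only: distrib_right mult_1_left)
      moreover have "g (?u k) \<le> g t + (\<Sum>j<k. (w (?u (Suc j)) - w (?u j)) / (1 - ?u j)) + real k * (\<delta> * \<Delta> / (1 - T))"
        using Suc by simp
      ultimately show ?case unfolding sum.lessThan_Suc by linarith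
    qed (simp add: g_def)
    moreover have "real k * (\<delta> * \<Delta> / (1 - T)) \<le> \<epsilon>" if "k \<le> n" for k
    proof -
      have "real k * (\<delta> * \<Delta> / (1 - T)) \<le> real n * (\<delta> * \<Delta> / (1 - T))"
        using that tT \<delta> \<Delta> by (intro mult_right_mono) auto
      also have "\<dots> = \<epsilon>" using n tT by (simp add: \<delta>_def \<Delta>_def)
      finally show ?thesis .
    qed
    ultimately show "\<forall>k\<le>n. (p (?u k) - q) / (1 - ?u k)
        \<le> (p t - q) / (1 - t) + (\<Sum>j<k. (w (?u (Suc j)) - w (?u j)) / (1 - ?u j)) + \<epsilon>"
      unfolding g_def by (meson add_left_mono order_trans)
  qed
qed

text \<open>Reflection of the previous estimate: p, q and w are replaced by their negatives.\<close>

lemma scaled_gap_ge: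
  fixes p w :: "real \<Rightarrow> real"
  assumes tT: "t < T" "T < 1" and \<epsilon>: "\<epsilon> > 0"
    and cont: "continuous_on {t..T} p"
    and ge: "\<And>a b. t \<le> a \<Longrightarrow> a \<le> b \<Longrightarrow> b \<le> T \<Longrightarrow> p b - p a \<ge> integral {a..b} (\<lambda>s. (q - p s) / (1 - s)) + (w b - w a)"
  shows "\<forall>\<^sub>F n in sequentially. \<forall>k\<le>n. (p (grid t T n k) - q) / (1 - grid t T n k)
    \<ge> (p t - q) / (1 - t) + (\<Sum>j<k. (w (grid t T n (Suc j)) - w (grid t T n j)) / (1 - grid t T n j)) - \<epsilon>"
proof -
  have neg: "(\<lambda>s. (- q - - p s) / (1 - s)) = (\<lambda>s. - ((q - p s) / (1 - s)))"
    by (auto simp: diff_divide_distrib fun_eq_iff)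
  have "\<forall>\<^sub>F n in sequentially. \<forall>k\<le>n. (- p (grid t T n k) - - q) / (1 - grid t T n k)
    \<le> (- p t - - q) / (1 - t) + (\<Sum>j<k. (- w (grid t T n (Suc j)) - - w (grid t T n j)) / (1 - grid t T n j)) + \<epsilon>"
  proof (rule scaled_gap_le[OF tT \<epsilon>])
    show "continuous_on {t..T} (\<lambda>s. - p s)" by (intro continuous_intros cont)
    fix a b assume "t \<le> a" "a \<le> b" "b \<le> T"
    from ge[OF this] show "- p b - - p a \<le> integral {a..b} (\<lambda>s. (- q - - p s) / (1 - s)) + (- w b - - w a)"
      unfolding neg integral_neg by linarith
  qed
  then show ?thesis
  proof (rule eventually_mono, intro allI impI)
    fix n k assume "\<forall>k\<le>n. (- p (grid t T n k) - - q) / (1 - grid t T n k)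
      \<le> (- p t - - q) / (1 - t) + (\<Sum>j<k. (- w (grid t T n (Suc j)) - - w (grid t T n j)) / (1 - grid t T n j)) + \<epsilon>"
      "k \<le> n"
    then have "(- p (grid t T n k) - - q) / (1 - grid t T n k)
      \<le> (- p t - - q) / (1 - t) + (\<Sum>j<k. (- w (grid t T n (Suc j)) - - w (grid t T n j)) / (1 - grid t T n j)) + \<epsilon>"
      by blast
    moreover have "(- p (grid t T n k) - - q) / (1 - grid t T n k) = - ((p (grid t T n k) - q) / (1 - grid t T n k))"
      "(- p t - - q) / (1 - t) = - ((p t - q) / (1 - t))"
      by (simp_all add: minus_divide_left)
    moreover have "(\<Sum>j<k. (- w (grid t T n (Suc j)) - - w (grid t T n j)) / (1 - grid t T n j))
        = - (\<Sum>j<k. (w (grid t T n (Suc j)) - w (grid t T n j)) / (1 - grid t T n j))"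
      unfolding sum_negf[symmetric] by (intro sum.cong) (simp_all add: minus_divide_left)
    ultimately show "(p (grid t T n k) - q) / (1 - grid t T n k)
      \<ge> (p t - q) / (1 - t) + (\<Sum>j<k. (w (grid t T n (Suc j)) - w (grid t T n j)) / (1 - grid t T n j)) - \<epsilon>"
      by linarith
  qed
qed

section \<open>Adaptedness of the observed process\<close>

locale observed_bridge = prior: light_tailed \<mu> + brownian_past M W t
  for \<mu> :: "real measure" and M :: "'a measure" and W t +
  fixes z :: real and Z :: "real \<Rightarrow> 'a \<Rightarrow> real"
  assumes start_less: "t < 1" and solution: "bridge_solution M W \<mu> t z Z"
begin

abbreviation drift :: "real \<Rightarrow> real \<Rightarrow> real" where
  "drift s x \<equiv> (post_mean \<mu> s x - x) / (1 - s)"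

lemma Z_measurable: "u \<in> {t..1} \<Longrightarrow> Z u \<in> borel_measurable M"
  using solution by (simp add: bridge_solution_def)

lemma Z_continuous: "\<omega> \<in> space M \<Longrightarrow> continuous_on {t..1} (\<lambda>u. Z u \<omega>)"
  using solution by (simp add: bridge_solution_def)

lemma Z_bounded:
  assumes "\<omega> \<in> space M"
  obtains R :: nat where "\<And>s. s \<in> {t..1} \<Longrightarrow> \<bar>Z s \<omega>\<bar> \<le> real R"
proof -
  have "bounded ((\<lambda>s. Z s \<omega>) ` {t..1})"
    by (intro compact_imp_bounded compact_continuous_image Z_continuous assms compact_Icc)
  then obtain B where B: "\<forall>x\<in>(\<lambda>s. Z s \<omega>) ` {t..1}. norm x \<le> B"
    unfolding bounded_iff by (elim exE)
  obtain R :: nat where "B \<le> real R" using real_arch_simple by blast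
  with B show ?thesis by (intro that[of R]) force
qed

lemma drift_continuous:
  assumes "\<omega> \<in> space M" "T < 1"
  shows "continuous_on {t..T} (\<lambda>s. drift s (Z s \<omega>))"
proof -
  obtain R :: nat where R: "\<And>s. s \<in> {t..1} \<Longrightarrow> \<bar>Z s \<omega>\<bar> \<le> real R"
    using Z_bounded[OF assms(1)] by blast
  have Z: "continuous_on {t..T} (\<lambda>s. Z s \<omega>)"
    by (rule continuous_on_subset[OF Z_continuous[OF assms(1)]]) (use assms in auto)
  have "continuous_on {t..T} (\<lambda>s. (\<lambda>(s, z). post_mean \<mu> s z) (s, Z s \<omega>))"
  proof (rule continuous_on_compose2[OF prior.post_mean_continuous[OF assms(2), of "real R"]])
    show "(\<lambda>s. (s, Z s \<omega>)) ` {t..T} \<subseteq> {0..T} \<times> {- real R..real R}"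
      using R start_nonneg assms(2) by (force simp: abs_le_iff)
  qed (intro continuous_intros Z)
  then show ?thesis
    using assms(2) by (intro continuous_intros Z) auto
qed

text \<open>One null set serves all pairs a, b. The equation from t is split at a, and its Lebesgue
  integrals become \<open>integral\<close>, the form in which the pathwise estimates are
  stated.\<close>

lemma AE_increments:
  "AE \<omega> in M. Z t \<omega> = z \<and> (\<forall>a b. t \<le> a \<longrightarrow> a \<le> b \<longrightarrow> b < 1 \<longrightarrow>
     Z b \<omega> - Z a \<omega> = integral {a..b} (\<lambda>s. drift s (Z s \<omega>)) + (W b \<omega> - W a \<omega>))"
proof -
  have "AE \<omega> in M. \<forall>u\<in>{t..<1}. set_integrable lborel {t..u} (\<lambda>s. drift s (Z s \<omega>)) \<and>
      Z u \<omega> = z + (LBINT s:{t..u}. drift s (Z s \<omega>)) + (W u \<omega> - W t \<omega>)"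
    using solution by (simp add: bridge_solution_def)
  then show ?thesis
    using AE_space
  proof eventually_elim
    case (elim \<omega>)
    have Z: "Z u \<omega> = z + integral {t..u} (\<lambda>s. drift s (Z s \<omega>)) + (W u \<omega> - W t \<omega>)" if "t \<le> u" "u < 1" for u
    proof -
      have *: "set_integrable lborel {t..u} (\<lambda>s. drift s (Z s \<omega>))"
        "Z u \<omega> = z + (LBINT s:{t..u}. drift s (Z s \<omega>)) + (W u \<omega> - W t \<omega>)"
        using elim(1) that by auto
      then show ?thesis using set_borel_integral_eq_integral(2)[OF *(1)] by simp
    qed
    show ?case
    proof (intro conjI allI impI)
      show "Z t \<omega> = z" using Z[of t] start_less by simp
      fix a b assume ab: "t \<le> a" "a \<le> b" "b < 1"
      have "integral {t..a} (\<lambda>s. drift s (Z s \<omega>)) + integral {a..b} (\<lambda>s. drift s (Z s \<omega>))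
          = integral {t..b} (\<lambda>s. drift s (Z s \<omega>))"
        using ab by (intro Henstock_Kurzweil_Integration.integral_combine integrable_continuous_real drift_continuous elim)
      then show "Z b \<omega> - Z a \<omega> = integral {a..b} (\<lambda>s. drift s (Z s \<omega>)) + (W b \<omega> - W a \<omega>)"
        using Z[of a] Z[of b] ab by simp
    qed
  qed
qed

lemma AE_start: "AE \<omega> in M. Z t \<omega> = z"
  using AE_increments by eventually_elim simp

text \<open>The posterior mean is only locally Lipschitz, so the Euler scheme runs with a clamped argument;
  on each path the clamping is eventually inactive.\<close>

definition clamp :: "real \<Rightarrow> real \<Rightarrow> real" where
  "clamp R x = max (- R) (min R x)"

lemma clamp_measurable [measurable]: "clamp R \<in> borel_measurable borel"
  unfolding clamp_def[abs_def] by measurable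

lemma clamp_bounds: "R \<ge> 0 \<Longrightarrow> clamp R x \<in> {- R..R}"
  by (auto simp: clamp_def)

lemma clamp_id: "\<bar>x\<bar> \<le> R \<Longrightarrow> clamp R x = x"
  by (auto simp: clamp_def)

lemma clamp_lipschitz: "\<bar>clamp R x - clamp R y\<bar> \<le> \<bar>x - y\<bar>"
  by (auto simp: clamp_def)

text \<open>Only the argument of the posterior mean is clamped; the linear term is globally
  Lipschitz up to any time before 1.\<close>

definition clamped_drift :: "real \<Rightarrow> real \<Rightarrow> real \<Rightarrow> real" where
  "clamped_drift R s x = (post_mean \<mu> s (clamp R x) - x) / (1 - s)"

lemma clamped_drift_lipschitz:
  assumes "T < 1" "R \<ge> 0"
  shows "\<exists>L. \<forall>s\<in>{0..T}. \<forall>x y. \<bar>clamped_drift R s x - clamped_drift R s y\<bar> \<le> L * \<bar>x - y\<bar>"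
proof -
  obtain L where L: "L \<ge> 0" "\<And>s x y. s \<in> {0..T} \<Longrightarrow> x \<in> {-R..R} \<Longrightarrow> y \<in> {-R..R} \<Longrightarrow>
      \<bar>post_mean \<mu> s x - post_mean \<mu> s y\<bar> \<le> L * \<bar>x - y\<bar>"
    using prior.post_mean_lipschitz[OF assms(1), of R] by blast
  have "\<bar>clamped_drift R s x - clamped_drift R s y\<bar> \<le> (L + 1) / (1 - T) * \<bar>x - y\<bar>" if s: "s \<in> {0..T}" for s x y
  proof -
    have "\<bar>post_mean \<mu> s (clamp R x) - post_mean \<mu> s (clamp R y)\<bar> \<le> L * \<bar>clamp R x - clamp R y\<bar>"
      by (intro L s clamp_bounds assms)
    also have "\<dots> \<le> L * \<bar>x - y\<bar>" by (intro mult_left_mono clamp_lipschitz L)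
    finally have *: "\<bar>(post_mean \<mu> s (clamp R x) - x) - (post_mean \<mu> s (clamp R y) - y)\<bar> \<le> (L + 1) * \<bar>x - y\<bar>"
      by (simp add: algebra_simps)
    have "\<bar>clamped_drift R s x - clamped_drift R s y\<bar>
        = \<bar>(post_mean \<mu> s (clamp R x) - x) - (post_mean \<mu> s (clamp R y) - y)\<bar> / (1 - s)"
      using s assms by (simp add: clamped_drift_def diff_divide_distrib[symmetric] del: abs_divide) (simp add: abs_divide)
    also have "\<dots> \<le> (L + 1) * \<bar>x - y\<bar> / (1 - T)"
      using s assms L(1) by (intro frac_le * ) auto
    finally show ?thesis by simp
  qed
  then show ?thesis by blast
qed

lemma clamped_drift_measurable:
  assumes "0 \<le> s" "s < 1" "R \<ge> 0"
  shows "clamped_drift R s \<in> borel_measurable borel"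
proof -
  have "continuous_on {-R..R} (\<lambda>x. (\<lambda>(s, z). post_mean \<mu> s z) (s, x))"
    by (rule continuous_on_compose2[OF prior.post_mean_continuous[OF assms(2), of R]])
       (use assms in \<open>auto intro!: continuous_intros\<close>)
  then have "continuous_on UNIV (\<lambda>x. post_mean \<mu> s (clamp R x))"
    by (intro continuous_on_compose2[of "{-R..R}" "post_mean \<mu> s" UNIV "clamp R"])
       (use clamp_bounds[OF assms(3)] in \<open>auto simp: clamp_def[abs_def] intro!: continuous_intros\<close>)
  then have "(\<lambda>x. post_mean \<mu> s (clamp R x)) \<in> borel_measurable borel"
    by (rule borel_measurable_continuous_onI)
  then show ?thesis unfolding clamped_drift_def[abs_def] by measurable
qed

lemma euler_measurable:
  assumes u: "t < u" "u < 1" and R: "R \<ge> 0" and "k \<le> n" "n > 0"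
  shows "(\<lambda>\<omega>. euler (clamped_drift R) (\<lambda>s. W s \<omega> - W t \<omega>) t u n z k) \<in> borel_measurable (past u)"
  using \<open>k \<le> n\<close>
proof (induction k)
  case (Suc k)
  have g: "grid t u n k \<in> {t..u}" "grid t u n (Suc k) \<in> {t..u}"
    using grid_bounds[of t u _ n] Suc.prems u \<open>n > 0\<close> by auto
  have "clamped_drift R (grid t u n k) \<in> borel_measurable borel"
    using g u start_nonneg by (intro clamped_drift_measurable R) auto
  moreover have "(\<lambda>\<omega>. euler (clamped_drift R) (\<lambda>s. W s \<omega> - W t \<omega>) t u n z k) \<in> borel_measurable (past u)"
    using Suc by simp
  ultimately have "(\<lambda>\<omega>. clamped_drift R (grid t u n k) (euler (clamped_drift R) (\<lambda>s. W s \<omega> - W t \<omega>) t u n z k))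
      \<in> borel_measurable (past u)"
    by (rule measurable_compose[rotated])
  then show ?case
    using Suc g unfolding euler.simps
    by (intro borel_measurable_add borel_measurable_diff borel_measurable_times borel_measurable_const
        increment_measurable_past) auto
qed simp

text \<open>\<open>bridge_solution\<close> makes Z u measurable for M only. Adaptedness comes from
  the iterated limit of Euler schemes, first in the mesh and then in the clamping level: each scheme
  is measurable for the past, and the limit equals Z u almost surely.\<close>

lemma Z_past:
  assumes "t \<le> u" "u \<le> s" "s < 1"
  shows "Z u \<in> borel_measurable (past s)"
proof (cases "t = u")
  case True
  show ?thesis
  proof (rule measurable_past_AE_cong[of "\<lambda>_. z"])
    show "Z u \<in> borel_measurable M" using Z_measurable[of t] start_less True by simp
    show "AE \<omega> in M. z = Z u \<omega>" using AE_start unfolding True[symmetric] by eventually_elim simp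
  qed simp
next
  case False
  then have u: "t < u" "u < 1" using assms by auto
  \<comment> \<open>The value at n = 0 is a dummy, since \<open>euler_measurable\<close> concerns n
    > 0. Index R is the clamping level.\<close>
  define Y where "Y R n \<omega> = (if n = 0 then 0 else euler (clamped_drift (real R)) (\<lambda>s. W s \<omega> - W t \<omega>) t u n z n)"
    for R n :: nat and \<omega>
  have Y: "Y R n \<in> borel_measurable (past u)" for R n
    unfolding Y_def[abs_def] using euler_measurable[OF u, of "real R" n n] by (cases "n = 0") auto
  have "(\<lambda>\<omega>. lim (\<lambda>R. lim (\<lambda>n. Y R n \<omega>))) \<in> borel_measurable (past u)"
    by (intro borel_measurable_lim_metric Y)
  moreover have "AE \<omega> in M. lim (\<lambda>R. lim (\<lambda>n. Y R n \<omega>)) = Z u \<omega>"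
    using AE_increments AE_space
  proof eventually_elim
    case (elim \<omega>)
    obtain R0 :: nat where R0: "\<And>s. s \<in> {t..1} \<Longrightarrow> \<bar>Z s \<omega>\<bar> \<le> real R0"
      using Z_bounded[OF elim(2)] by blast
    have "lim (\<lambda>n. Y R n \<omega>) = Z u \<omega>" if "R0 \<le> R" for R
    proof -
      have eq: "clamped_drift (real R) s (Z s \<omega>) = drift s (Z s \<omega>)" if "s \<in> {t..u}" for s
        using that R0[of s] \<open>R0 \<le> R\<close> u by (simp add: clamped_drift_def clamp_id)
      obtain L where L: "\<forall>s\<in>{0..u}. \<forall>x y. \<bar>clamped_drift (real R) s x - clamped_drift (real R) s y\<bar> \<le> L * \<bar>x - y\<bar>"
        using clamped_drift_lipschitz[OF u(2) of_nat_0_le_iff[of R]] by (elim exE)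
      have "(\<lambda>n. euler (clamped_drift (real R)) (\<lambda>s. W s \<omega> - W t \<omega>) t u n (Z t \<omega>) n) \<longlonglongrightarrow> Z u \<omega>"
      proof (rule euler_converges[OF u(1), where p = "\<lambda>s. Z s \<omega>"])
        show "continuous_on {t..u} (\<lambda>s. clamped_drift (real R) s (Z s \<omega>))"
          by (rule continuous_on_eq[OF drift_continuous[OF elim(2) u(2)]]) (simp add: eq)
        fix a b assume ab: "t \<le> a" "a \<le> b" "b \<le> u"
        have "integral {a..b} (\<lambda>s. clamped_drift (real R) s (Z s \<omega>)) = integral {a..b} (\<lambda>s. drift s (Z s \<omega>))"
          using ab by (intro integral_cong eq) auto
        moreover have "Z b \<omega> - Z a \<omega> = integral {a..b} (\<lambda>s. drift s (Z s \<omega>)) + (W b \<omega> - W a \<omega>)"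
          using ab u by (intro elim(1)[THEN conjunct2, rule_format]) auto
        ultimately show "Z b \<omega> - Z a \<omega> = integral {a..b} (\<lambda>s. clamped_drift (real R) s (Z s \<omega>))
            + (W b \<omega> - W t \<omega> - (W a \<omega> - W t \<omega>))"
          by simp
      next
        fix s x y assume "s \<in> {t..u}"
        then show "\<bar>clamped_drift (real R) s x - clamped_drift (real R) s y\<bar> \<le> L * \<bar>x - y\<bar>"
          using start_nonneg by (intro L[rule_format]) simp
      qed
      moreover have "\<forall>\<^sub>F n in sequentially. euler (clamped_drift (real R)) (\<lambda>s. W s \<omega> - W t \<omega>) t u n (Z t \<omega>) n = Y R n \<omega>"
        unfolding Y_def conjunct1[OF elim(1)]
        by (rule eventually_mono[OF eventually_gt_at_top[of "0 :: nat"]]) (simp only: neq0_conv[symmetric] if_False)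
      ultimately have "(\<lambda>n. Y R n \<omega>) \<longlonglongrightarrow> Z u \<omega>"
        by (rule Lim_transform_eventually)
      then show ?thesis by (rule limI)
    qed
    \<comment> \<open>On a fixed path the inner limit is constant in R once R exceeds the bound
      \<open>R0\<close> of the path.\<close>
    then have "(\<lambda>R. lim (\<lambda>n. Y R n \<omega>)) \<longlonglongrightarrow> Z u \<omega>"
      by (intro tendsto_eventually) (auto simp: eventually_sequentially)
    then show ?case by (rule limI)
  qed
  ultimately have "Z u \<in> borel_measurable (past u)"
    using Z_measurable[of u] u by (intro measurable_past_AE_cong[where g = "Z u"]) simp_all
  then show ?thesis using assms by (intro measurable_past_mono[of u s])
qed

text \<open>Times before 1 are those at which the integral equation determines Z; the final time is
  reached later by truncating stopping times.\<close>

lemma gen_filtration_past: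
  assumes "t + s < 1"
  shows "sets (gen_filtration M Z t s) \<subseteq> sets (past (t + s))"
proof -
  let ?G = "{Z (t + u) -` A \<inter> space M | u A. u \<in> {0..s} \<inter> {0..1 - t} \<and> A \<in> sets borel}"
  have "?G \<subseteq> sets (past (t + s))"
  proof clarify
    fix u and A :: "real set" assume u: "u \<in> {0..s}" "u \<in> {0..1 - t}" and A: "A \<in> sets borel"
    have "Z (t + u) \<in> borel_measurable (past (t + s))"
      using u assms by (intro Z_past) auto
    from measurable_sets[OF this A] show "Z (t + u) -` A \<inter> space M \<in> sets (past (t + s))" by simp
  qed
  moreover have "sets (gen_filtration M Z t s) = sigma_sets (space M) ?G"
    unfolding gen_filtration_def by (rule sets_measure_of) auto
  ultimately show ?thesis using sets.sigma_sets_subset[of ?G "past (t + s)"] by simp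
qed

lemma space_gen_filtration: "space (gen_filtration M Z t s) = space M"
  unfolding gen_filtration_def by (rule space_measure_of) auto

lemma stopping_time_past:
  assumes "\<tau> \<in> stopping_times M Z t" "s < 1"
  shows "{\<omega> \<in> space M. t + \<tau> \<omega> \<le> s} \<in> sets (past s)"
proof -
  have "Measurable.pred (gen_filtration M Z t (s - t)) (\<lambda>\<omega>. \<tau> \<omega> \<le> s - t)"
    using assms by (simp add: stopping_times_def stopping_time_def)
  then have "{\<omega> \<in> space M. \<tau> \<omega> \<le> s - t} \<in> sets (gen_filtration M Z t (s - t))"
    by (simp add: pred_def space_gen_filtration)
  then show ?thesis
    using gen_filtration_past[of "s - t"] assms by (auto simp: algebra_simps)
qed

end

section \<open>Stopped exponential martingales\<close>

text \<open>Optional stopping by induction on the grid. Factor k enters the product only on the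
  event k < K, which is known at grid time k: on that event its increment integrates out to 1, off
  it the product has stopped.\<close>

lemma (in brownian_past) stopped_exponential_martingale:
  fixes c :: "nat \<Rightarrow> real"
  assumes T: "t < T" and n: "n > 0"
    and K: "\<And>j. j < n \<Longrightarrow> {\<omega> \<in> space M. j < K \<omega>} \<in> sets (past (grid t T n j))" "\<And>\<omega>. \<omega> \<in> space M \<Longrightarrow> K \<omega> \<le> n"
  shows "(\<integral>\<^sup>+\<omega>. ennreal (exp (\<Sum>j<K \<omega>. c j * (W (grid t T n (Suc j)) \<omega> - W (grid t T n j) \<omega>)
      - (c j)\<^sup>2 * ((T - t) / real n) / 2)) \<partial>M) = 1"
proof -
  let ?u = "grid t T n"
  define a where "a j \<omega> = c j * (W (?u (Suc j)) \<omega> - W (?u j) \<omega>) - (c j)\<^sup>2 * ((T - t) / real n) / 2" for j \<omega>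
  define D where "D j \<omega> = ennreal (exp (a j \<omega>))" for j \<omega>
  define P where "P k \<omega> = (\<Prod>j<k. if j < K \<omega> then D j \<omega> else 1)" for k \<omega>
  have u: "t \<le> ?u j" "?u j < ?u (Suc j)" for j
    using grid_mono[of t T 0 j n] grid_strict_mono[of t T n j "Suc j"] T n by auto
  have D: "D j \<in> borel_measurable (past (?u (Suc j)))" for j
  proof -
    have "(\<lambda>\<omega>. (W (?u (Suc j)) \<omega> - W t \<omega>) - (W (?u j) \<omega> - W t \<omega>)) \<in> borel_measurable (past (?u (Suc j)))"
      using u[of j] u(1)[of "Suc j"] by (intro borel_measurable_diff increment_measurable_past) auto
    then show ?thesis unfolding D_def[abs_def] a_def by simp
  qed
  have factor: "(\<lambda>\<omega>. if j < K \<omega> then D j \<omega> else 1) \<in> borel_measurable (past (?u (Suc j)))" if "j < n" for j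
  proof (rule measurable_If[OF D])
    show "{\<omega> \<in> space (past (?u (Suc j))). j < K \<omega>} \<in> sets (past (?u (Suc j)))"
      using K(1)[OF that] past_mono[of "?u j" "?u (Suc j)"] u(2)[of j] by auto
  qed simp
  have P: "P k \<in> borel_measurable (past (?u k))" if "k \<le> n" for k
    using that
  proof (induction k)
    case (Suc k)
    have "(\<lambda>\<omega>. P k \<omega> * (if k < K \<omega> then D k \<omega> else 1)) \<in> borel_measurable (past (?u (Suc k)))"
      using Suc u(2)[of k]
      by (intro borel_measurable_times_ennreal measurable_past_mono[of "?u k" "?u (Suc k)" "P k"] factor) auto
    then show ?case by (simp add: P_def[abs_def])
  qed (simp add: P_def[abs_def])
  have int: "(\<integral>\<^sup>+\<omega>. P k \<omega> \<partial>M) = 1" if "k \<le> n" for k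
    using that
  proof (induction k)
    case 0
    then show ?case by (simp add: P_def emeasure_space_1)
  next
    case (Suc k)
    let ?A = "{\<omega> \<in> space M. k < K \<omega>}"
    have A: "?A \<in> sets (past (?u k))" using K(1) Suc by simp
    have Pk: "P k \<in> borel_measurable (past (?u k))" using P Suc by simp
    have m1: "(\<lambda>\<omega>. P k \<omega> * indicator ?A \<omega>) \<in> borel_measurable (past (?u k))"
      using A Pk by (intro borel_measurable_times_ennreal) auto
    have m2: "(\<lambda>\<omega>. P k \<omega> * indicator (space M - ?A) \<omega>) \<in> borel_measurable (past (?u k))"
    proof -
      have "space M - ?A \<in> sets (past (?u k))" using sets.compl_sets[OF A] by simp
      then show ?thesis using Pk by (intro borel_measurable_times_ennreal) auto
    qed
    have "(\<integral>\<^sup>+\<omega>. P (Suc k) \<omega> \<partial>M) = (\<integral>\<^sup>+\<omega>. P k \<omega> * indicator (space M - ?A) \<omega> + P k \<omega> * indicator ?A \<omega> * D k \<omega> \<partial>M)"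
      by (intro nn_integral_cong) (auto simp: P_def indicator_def)
    also have "\<dots> = (\<integral>\<^sup>+\<omega>. P k \<omega> * indicator (space M - ?A) \<omega> \<partial>M) + (\<integral>\<^sup>+\<omega>. P k \<omega> * indicator ?A \<omega> * D k \<omega> \<partial>M)"
      by (intro nn_integral_add borel_measurable_times_ennreal measurable_past[OF m1] measurable_past[OF m2] measurable_past[OF D])
    also have "(\<integral>\<^sup>+\<omega>. P k \<omega> * indicator ?A \<omega> * D k \<omega> \<partial>M) = (\<integral>\<^sup>+\<omega>. P k \<omega> * indicator ?A \<omega> \<partial>M)"
      using past_exp_increment[OF u(1)[of k] u(2)[of k] m1, of "c k"]
      unfolding D_def a_def by (simp add: grid_Suc)
    also have "(\<integral>\<^sup>+\<omega>. P k \<omega> * indicator (space M - ?A) \<omega> \<partial>M) + (\<integral>\<^sup>+\<omega>. P k \<omega> * indicator ?A \<omega> \<partial>M)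
        = (\<integral>\<^sup>+\<omega>. P k \<omega> * indicator (space M - ?A) \<omega> + P k \<omega> * indicator ?A \<omega> \<partial>M)"
      by (intro nn_integral_add[symmetric] measurable_past[OF m1] measurable_past[OF m2])
    also have "\<dots> = (\<integral>\<^sup>+\<omega>. P k \<omega> \<partial>M)"
      by (intro nn_integral_cong) (auto simp: indicator_def)
    finally show ?case using Suc by simp
  qed
  have "ennreal (exp (\<Sum>j<K \<omega>. a j \<omega>)) = P n \<omega>" if "\<omega> \<in> space M" for \<omega>
  proof -
    have "P n \<omega> = (\<Prod>j<n. if j \<in> {..<K \<omega>} then D j \<omega> else 1)" by (simp add: P_def)
    also have "\<dots> = (\<Prod>j\<in>{..<n} \<inter> {..<K \<omega>}. D j \<omega>)"
      by (rule prod.inter_restrict[symmetric]) simp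
    also have "{..<n} \<inter> {..<K \<omega>} = {..<K \<omega>}" using K(2)[OF that] by auto
    finally show ?thesis by (simp add: D_def exp_sum prod_ennreal)
  qed
  then show ?thesis using int[of n] by (simp add: a_def cong: nn_integral_cong)
qed

text \<open>The exponents b need not converge; they only dominate a convergent sequence up to
  arbitrarily small errors. That is what a comparison of drifts provides, and it is enough for the
  integrand in Fatou's lemma; \<open>limsup_exp_le\<close> is the counterpart for the reverse
  inequality.\<close>

lemma liminf_exp_ge:
  fixes a b :: "nat \<Rightarrow> real"
  assumes "a \<longlonglongrightarrow> l" "\<And>\<epsilon>. \<epsilon> > 0 \<Longrightarrow> \<forall>\<^sub>F n in sequentially. a n \<le> b n + \<epsilon>"
  shows "ennreal (exp l) \<le> liminf (\<lambda>n. ennreal (exp (b n)))"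
proof -
  have "ennreal (exp (l - d)) \<le> liminf (\<lambda>n. ennreal (exp (b n)))" if "d > 0" for d
  proof (rule Liminf_bounded)
    have "\<forall>\<^sub>F n in sequentially. a n > l - d / 2"
      by (rule order_tendstoD[OF assms(1)]) (use that in simp)
    moreover have "\<forall>\<^sub>F n in sequentially. a n \<le> b n + d / 2"
      by (rule assms(2)) (use that in simp)
    ultimately show "\<forall>\<^sub>F n in sequentially. ennreal (exp (l - d)) \<le> ennreal (exp (b n))"
      by eventually_elim (simp add: ennreal_leI)
  qed
  then have "ennreal (exp (l - 1 / Suc m)) \<le> liminf (\<lambda>n. ennreal (exp (b n)))" for m
    by simp
  moreover have "(\<lambda>m. ennreal (exp (l - 1 / Suc m))) \<longlonglongrightarrow> ennreal (exp (l - 0))"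
    by (intro tendsto_ennrealI tendsto_exp tendsto_diff tendsto_const LIMSEQ_Suc lim_1_over_n)
  ultimately show ?thesis by (intro LIMSEQ_le_const2[where X = "\<lambda>m. ennreal (exp (l - 1 / Suc m))"]) auto
qed

lemma limsup_exp_le:
  fixes a b :: "nat \<Rightarrow> real"
  assumes "a \<longlonglongrightarrow> l" "\<And>\<epsilon>. \<epsilon> > 0 \<Longrightarrow> \<forall>\<^sub>F n in sequentially. b n \<le> a n + \<epsilon>"
  shows "limsup (\<lambda>n. ennreal (exp (b n))) \<le> ennreal (exp l)"
proof -
  have "limsup (\<lambda>n. ennreal (exp (b n))) \<le> ennreal (exp (l + d))" if "d > 0" for d
  proof (rule Limsup_bounded)
    have "\<forall>\<^sub>F n in sequentially. a n < l + d / 2"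
      by (rule order_tendstoD[OF assms(1)]) (use that in simp)
    moreover have "\<forall>\<^sub>F n in sequentially. b n \<le> a n + d / 2"
      by (rule assms(2)) (use that in simp)
    ultimately show "\<forall>\<^sub>F n in sequentially. ennreal (exp (b n)) \<le> ennreal (exp (l + d))"
      by eventually_elim (simp add: ennreal_leI)
  qed
  then have "limsup (\<lambda>n. ennreal (exp (b n))) \<le> ennreal (exp (l + 1 / Suc m))" for m
    by simp
  moreover have "(\<lambda>m. ennreal (exp (l + 1 / Suc m))) \<longlonglongrightarrow> ennreal (exp (l + 0))"
    by (intro tendsto_ennrealI tendsto_exp tendsto_add tendsto_const LIMSEQ_Suc lim_1_over_n)
  ultimately show ?thesis by (intro LIMSEQ_le_const[where X = "\<lambda>m. ennreal (exp (l + 1 / Suc m))"]) auto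
qed

section \<open>Rounding random times to the grid, and the discrete clock\<close>

definition grid_index :: "real \<Rightarrow> real \<Rightarrow> nat \<Rightarrow> real \<Rightarrow> nat" where
  "grid_index t T n s = nat \<lceil>(s - t) * real n / (T - t)\<rceil>"

lemma grid_index_measurable [measurable]: "grid_index t T n \<in> borel \<rightarrow>\<^sub>M count_space UNIV"
  unfolding grid_index_def[abs_def] by measurable

text \<open>Rounding goes upwards so that the event on the left is the complement of "s is at most
  grid time j". For a stopping time this event is known at grid time j, so the rounded index is a
  stopping time of the grid.\<close>

lemma less_grid_index_iff:
  assumes "t < T" "n > 0"
  shows "j < grid_index t T n s \<longleftrightarrow> grid t T n j < s"
proof -
  have "j < grid_index t T n s \<longleftrightarrow> real j < (s - t) * real n / (T - t)"
    unfolding grid_index_def by (simp add: zless_nat_eq_int_zless less_ceiling_iff)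
  also have "\<dots> \<longleftrightarrow> grid t T n j < s"
    using assms by (simp add: grid_def field_simps)
  finally show ?thesis .
qed

lemma grid_index_le:
  assumes "t < T" "n > 0" "s \<le> T"
  shows "grid_index t T n s \<le> n"
  using less_grid_index_iff[OF assms(1,2), of n s] assms by (simp add: not_less[symmetric])

lemma grid_index_bounds:
  assumes "t < T" "n > 0" "s \<in> {t..T}"
  shows "grid t T n (grid_index t T n s) \<in> {s..s + (T - t) / real n}"
proof -
  have "\<not> grid t T n (grid_index t T n s) < s"
    using less_grid_index_iff[OF assms(1,2), of "grid_index t T n s" s] by simp
  moreover have "grid t T n (grid_index t T n s) \<le> s + (T - t) / real n"
  proof (cases "grid_index t T n s")
    case 0
    have "0 \<le> (T - t) / real n" using assms by simp
    with 0 assms(3) show ?thesis unfolding 0 grid_0 atLeastAtMost_iff by linarith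
  next
    case (Suc j)
    then have "grid t T n j < s" using less_grid_index_iff[OF assms(1,2), of j s] by simp
    then show ?thesis unfolding Suc grid_Suc by simp
  qed
  ultimately show ?thesis by simp
qed

lemma grid_index_tendsto:
  assumes "t < T" "s \<in> {t..T}"
  shows "(\<lambda>n. grid t T n (grid_index t T n s)) \<longlonglongrightarrow> s"
proof (rule tendsto_sandwich)
  show "\<forall>\<^sub>F n in sequentially. s \<le> grid t T n (grid_index t T n s)"
    "\<forall>\<^sub>F n in sequentially. grid t T n (grid_index t T n s) \<le> s + (T - t) / real n"
    using grid_index_bounds[OF assms(1) _ assms(2)] by (auto intro!: eventually_mono[OF eventually_gt_at_top[of 0]])
  show "(\<lambda>n. s + (T - t) / real n) \<longlonglongrightarrow> s" by real_asymp
qed simp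

text \<open>Quadratic variation of the discretised X: a left-endpoint Riemann sum of 1 / (1 - s)^2,
  started at 1 / (1 - t) so that its limit is 1 / (1 - s).\<close>

definition grid_clock :: "real \<Rightarrow> real \<Rightarrow> nat \<Rightarrow> nat \<Rightarrow> real" where
  "grid_clock t T n k = 1 / (1 - t) + (\<Sum>j<k. (T - t) / real n / (1 - grid t T n j)\<^sup>2)"

text \<open>The left sum of an increasing function stays below its integral. One step from distance
  x = 1 - u misses exactly \<open>\<Delta>\<close>^2 / (x^2 (x - \<open>\<Delta>\<close>)). The
  upper bound is uniform in n and serves the second moment estimate later; the error bound gives
  convergence.\<close>

lemma grid_clock_bounds:
  assumes tT: "t < T" "T < 1" and n: "n > 0" and "k \<le> n"
  shows "grid_clock t T n k \<le> 1 / (1 - grid t T n k)"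
    and "1 / (1 - grid t T n k) - grid_clock t T n k \<le> real k * ((T - t) / real n)\<^sup>2 / (1 - T) ^ 3"
proof -
  define \<Delta> where "\<Delta> = (T - t) / real n"
  have \<Delta>: "\<Delta> > 0" using tT n by (simp add: \<Delta>_def)
  have step: "0 \<le> 1 / (1 - grid t T n (Suc k)) - 1 / (1 - grid t T n k) - \<Delta> / (1 - grid t T n k)\<^sup>2
      \<and> 1 / (1 - grid t T n (Suc k)) - 1 / (1 - grid t T n k) - \<Delta> / (1 - grid t T n k)\<^sup>2 \<le> \<Delta>\<^sup>2 / (1 - T) ^ 3"
    if "k < n" for k
  proof -
    define x where "x = 1 - grid t T n k"
    have y: "1 - grid t T n (Suc k) = x - \<Delta>" by (simp add: x_def grid_Suc \<Delta>_def)
    have "1 - T \<le> x - \<Delta>" using grid_bounds[of t T "Suc k" n] that n tT y by auto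
    then have x: "x - \<Delta> > 0" "1 - T \<le> x - \<Delta>" "1 - T \<le> x" "x > 0" using tT \<Delta> by auto
    have "1 / (x - \<Delta>) - 1 / x - \<Delta> / x\<^sup>2 = \<Delta>\<^sup>2 / (x\<^sup>2 * (x - \<Delta>))"
      using x by (simp add: field_simps power2_eq_square)
    moreover have "\<Delta>\<^sup>2 / (x\<^sup>2 * (x - \<Delta>)) \<le> \<Delta>\<^sup>2 / ((1 - T)\<^sup>2 * (1 - T))"
      using x tT by (intro divide_left_mono mult_mono power_mono mult_pos_pos) auto
    moreover have "(1 - T)\<^sup>2 * (1 - T) = (1 - T) ^ 3" by (simp add: power2_eq_square power3_eq_cube)
    moreover have "0 \<le> \<Delta>\<^sup>2 / (x\<^sup>2 * (x - \<Delta>))" using x by simp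
    ultimately show ?thesis unfolding y x_def[symmetric] by simp
  qed
  have "0 \<le> 1 / (1 - grid t T n k) - grid_clock t T n k \<and>
      1 / (1 - grid t T n k) - grid_clock t T n k \<le> real k * (\<Delta>\<^sup>2 / (1 - T) ^ 3)"
    using \<open>k \<le> n\<close>
  proof (induction k)
    case (Suc k)
    have "grid_clock t T n (Suc k) = grid_clock t T n k + \<Delta> / (1 - grid t T n k)\<^sup>2"
      by (simp add: grid_clock_def \<Delta>_def)
    moreover have "real (Suc k) * (\<Delta>\<^sup>2 / (1 - T) ^ 3) = real k * (\<Delta>\<^sup>2 / (1 - T) ^ 3) + \<Delta>\<^sup>2 / (1 - T) ^ 3"
      unfolding of_nat_Suc by (simp only: distrib_right mult_1_left)
    ultimately show ?case using step[of k] Suc by simp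
  qed (simp add: grid_clock_def)
  then show "grid_clock t T n k \<le> 1 / (1 - grid t T n k)"
    and "1 / (1 - grid t T n k) - grid_clock t T n k \<le> real k * ((T - t) / real n)\<^sup>2 / (1 - T) ^ 3"
    by (auto simp: \<Delta>_def)
qed

lemma grid_clock_tendsto:
  assumes tT: "t < T" "T < 1" and s: "s \<in> {t..T}"
  shows "(\<lambda>n. grid_clock t T n (grid_index t T n s)) \<longlonglongrightarrow> 1 / (1 - s)"
proof -
  let ?k = "\<lambda>n. grid_index t T n s"
  have clock: "(\<lambda>n. 1 / (1 - grid t T n (?k n))) \<longlonglongrightarrow> 1 / (1 - s)"
    using tT s by (intro tendsto_intros grid_index_tendsto) auto
  have "(\<lambda>n. 1 / (1 - grid t T n (?k n)) - grid_clock t T n (?k n)) \<longlonglongrightarrow> 0"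
  proof (rule tendsto_sandwich[where f = "\<lambda>_. 0" and h = "\<lambda>n. (T - t)\<^sup>2 / (1 - T) ^ 3 / real n"])
    show "\<forall>\<^sub>F n in sequentially. 0 \<le> 1 / (1 - grid t T n (?k n)) - grid_clock t T n (?k n)"
      using grid_clock_bounds(1)[OF tT] grid_index_le[OF tT(1)] s
      by (auto intro!: eventually_mono[OF eventually_gt_at_top[of 0]])
    show "\<forall>\<^sub>F n in sequentially. 1 / (1 - grid t T n (?k n)) - grid_clock t T n (?k n) \<le> (T - t)\<^sup>2 / (1 - T) ^ 3 / real n"
    proof (rule eventually_mono[OF eventually_gt_at_top[of 0]])
      fix n :: nat assume n: "0 < n"
      have k: "?k n \<le> n" using grid_index_le[OF tT(1) n] s by simp
      have "real (?k n) * ((T - t) / real n)\<^sup>2 / (1 - T) ^ 3 \<le> real n * ((T - t) / real n)\<^sup>2 / (1 - T) ^ 3"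
        using k tT by (intro divide_right_mono mult_right_mono) auto
      also have "\<dots> = (T - t)\<^sup>2 / (1 - T) ^ 3 / real n"
        using n by (simp add: power2_eq_square)
      finally show "1 / (1 - grid t T n (?k n)) - grid_clock t T n (?k n) \<le> (T - t)\<^sup>2 / (1 - T) ^ 3 / real n"
        using grid_clock_bounds(2)[OF tT n k] by linarith
    qed
    show "(\<lambda>n. (T - t)\<^sup>2 / (1 - T) ^ 3 / real n) \<longlonglongrightarrow> 0"
      by real_asymp
  qed simp
  from tendsto_diff[OF clock this] show ?thesis by simp
qed

text \<open>Z is given as measurable at each fixed time. A random time is therefore replaced by one
  with countably many values, and continuity of the paths gives the limit.\<close>

lemma (in observed_bridge) evaluation_measurable:
  assumes T: "t < T" "T \<le> 1" and \<rho>: "\<rho> \<in> borel_measurable M" "\<And>\<omega>. \<omega> \<in> space M \<Longrightarrow> \<rho> \<omega> \<in> {t..T}"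
  shows "(\<lambda>\<omega>. Z (\<rho> \<omega>) \<omega>) \<in> borel_measurable M"
proof (rule borel_measurable_LIMSEQ_real)
  \<comment> \<open>The cap \<open>min\<close> keeps every index k inside the time interval,
    including those that are never attained; \<open>Suc n\<close> avoids the degenerate grid n =
    0.\<close>
  let ?u = "\<lambda>n \<omega>. grid t T (Suc n) (min (grid_index t T (Suc n) (\<rho> \<omega>)) (Suc n))"
  show "(\<lambda>\<omega>. Z (?u n \<omega>) \<omega>) \<in> borel_measurable M" for n
  proof (rule measurable_compose_countable[where g = "\<lambda>\<omega>. grid_index t T (Suc n) (\<rho> \<omega>)"
      and f = "\<lambda>k. Z (grid t T (Suc n) (min k (Suc n)))"])
    show "Z (grid t T (Suc n) (min k (Suc n))) \<in> borel_measurable M" for k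
      using grid_bounds[of t T "min k (Suc n)" "Suc n"] T by (intro Z_measurable) auto
    show "(\<lambda>\<omega>. grid_index t T (Suc n) (\<rho> \<omega>)) \<in> M \<rightarrow>\<^sub>M count_space UNIV"
      using \<rho>(1) by measurable
  qed
  fix \<omega> assume \<omega>: "\<omega> \<in> space M"
  show "(\<lambda>n. Z (?u n \<omega>) \<omega>) \<longlonglongrightarrow> Z (\<rho> \<omega>) \<omega>"
  proof (rule continuous_on_tendsto_compose[OF Z_continuous[OF \<omega>]])
    have "?u n \<omega> = grid t T (Suc n) (grid_index t T (Suc n) (\<rho> \<omega>))" for n
      using grid_index_le[OF T(1), of "Suc n" "\<rho> \<omega>"] \<rho>(2)[OF \<omega>] by simp
    then show "(\<lambda>n. ?u n \<omega>) \<longlonglongrightarrow> \<rho> \<omega>"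
      using LIMSEQ_Suc[OF grid_index_tendsto[OF T(1) \<rho>(2)[OF \<omega>]]] by simp
    show "\<rho> \<omega> \<in> {t..1}" using \<rho>(2)[OF \<omega>] T by auto
    show "\<forall>\<^sub>F n in sequentially. ?u n \<omega> \<in> {t..1}"
    proof (intro always_eventually allI)
      fix n
      have "?u n \<omega> \<in> {t..T}" using T by (intro grid_bounds) auto
      then show "?u n \<omega> \<in> {t..1}" using T by auto
    qed
  qed
qed

text \<open>Below the horizon T < 1 the clock 1 / (1 - s) is bounded. From time T on the event is
  the whole space, so its measurability is asked only before T.\<close>

locale stopped_bridge = observed_bridge \<mu> M W t z Z
  for \<mu> and M :: "'a measure" and W t z Z +
  fixes T :: real and \<sigma> :: "'a \<Rightarrow> real"
  assumes T: "t < T" "T < 1"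
    and \<sigma>_range: "\<And>\<omega>. \<omega> \<in> space M \<Longrightarrow> \<sigma> \<omega> \<in> {t..T}"
    and \<sigma>_past: "\<And>s. t \<le> s \<Longrightarrow> s < T \<Longrightarrow> {\<omega> \<in> space M. \<sigma> \<omega> \<le> s} \<in> sets (past s)"
begin

lemma \<sigma>_measurable [measurable]: "\<sigma> \<in> borel_measurable M"
proof (rule borel_measurableI_le)
  fix s
  consider "s < t" | "t \<le> s" "s < T" | "T \<le> s" by linarith
  then show "{\<omega> \<in> space M. \<sigma> \<omega> \<le> s} \<in> sets M"
  proof cases
    case 1
    then have "{\<omega> \<in> space M. \<sigma> \<omega> \<le> s} = {}" using \<sigma>_range by fastforce
    then show ?thesis by (simp only: sets.empty_sets)
  next
    case 2
    then show ?thesis using \<sigma>_past sets_past_subset by blast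
  next
    case 3
    then have "{\<omega> \<in> space M. \<sigma> \<omega> \<le> s} = space M" using \<sigma>_range by fastforce
    then show ?thesis by (simp only: sets.top)
  qed
qed

lemma Z_\<sigma>_measurable [measurable]: "(\<lambda>\<omega>. Z (\<sigma> \<omega>) \<omega>) \<in> borel_measurable M"
  using T by (intro evaluation_measurable[of T] \<sigma>_range \<sigma>_measurable) auto

abbreviation step :: "nat \<Rightarrow> 'a \<Rightarrow> nat" where
  "step n \<omega> \<equiv> grid_index t T n (\<sigma> \<omega>)"

lemma step_le: "\<omega> \<in> space M \<Longrightarrow> n > 0 \<Longrightarrow> step n \<omega> \<le> n"
  using grid_index_le[OF T(1)] \<sigma>_range by auto

lemma step_past:
  assumes "n > 0" "j < n"
  shows "{\<omega> \<in> space M. j < step n \<omega>} \<in> sets (past (grid t T n j))"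
proof -
  have "t \<le> grid t T n j" "grid t T n j < T"
    using grid_bounds[of t T j n] grid_strict_mono[of t T n j n] assms T by auto
  from sets.compl_sets[OF \<sigma>_past[OF this]]
  have "space M - {\<omega> \<in> space M. \<sigma> \<omega> \<le> grid t T n j} \<in> sets (past (grid t T n j))" by simp
  also have "space M - {\<omega> \<in> space M. \<sigma> \<omega> \<le> grid t T n j} = {\<omega> \<in> space M. j < step n \<omega>}"
    using less_grid_index_iff[OF T(1) assms(1)] by auto
  finally show ?thesis .
qed

text \<open>The driftless comparison process for X on the grid: X without the monotone term that
  stems from the gap between posterior mean and q.\<close>

definition walk :: "real \<Rightarrow> nat \<Rightarrow> nat \<Rightarrow> 'a \<Rightarrow> real" where
  "walk q n k \<omega> = (z - q) / (1 - t)
     + (\<Sum>j<k. (W (grid t T n (Suc j)) \<omega> - W (grid t T n j) \<omega>) / (1 - grid t T n j))"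

lemma walk_measurable [measurable]: "(\<lambda>\<omega>. walk q n (step n \<omega>) \<omega>) \<in> borel_measurable M"
proof (rule measurable_compose_countable[where g = "step n" and f = "walk q n"])
  have "grid t T n j \<ge> 0" for j using grid_mono[of t T 0 j n] T start_nonneg by simp
  then show "walk q n k \<in> borel_measurable M" for k
    unfolding walk_def[abs_def] by (intro borel_measurable_add borel_measurable_sum borel_measurable_divide
      borel_measurable_diff borel_measurable_const W_measurable)
qed measurable

lemma clock_measurable [measurable]: "(\<lambda>\<omega>. grid_clock t T n (step n \<omega>)) \<in> borel_measurable M"
  by (rule measurable_compose_countable[where g = "step n" and f = "\<lambda>k _. grid_clock t T n k"]) measurable

text \<open>With weights l / (1 - u_j), the squares times the mesh add up to l^2 times the increase
  of \<open>grid_clock\<close>. The compensator is thus exact for each n, and the expectation does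
  not depend on n.\<close>

lemma walk_exp_martingale:
  assumes "n > 0"
  shows "(\<integral>\<^sup>+\<omega>. ennreal (exp (l * walk q n (step n \<omega>) \<omega> - l\<^sup>2 * grid_clock t T n (step n \<omega>) / 2)) \<partial>M)
    = ennreal (exp (l * ((z - q) / (1 - t)) - l\<^sup>2 * (1 / (1 - t)) / 2))"
proof -
  let ?u = "grid t T n" and ?a = "l * ((z - q) / (1 - t)) - l\<^sup>2 * (1 / (1 - t)) / 2"
  let ?c = "\<lambda>j. l / (1 - ?u j)"
  let ?s = "\<lambda>\<omega>. \<Sum>j<step n \<omega>. ?c j * (W (?u (Suc j)) \<omega> - W (?u j) \<omega>) - (?c j)\<^sup>2 * ((T - t) / real n) / 2"
  have exponent: "l * walk q n k \<omega> - l\<^sup>2 * grid_clock t T n k / 2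
      = ?a + (\<Sum>j<k. ?c j * (W (?u (Suc j)) \<omega> - W (?u j) \<omega>) - (?c j)\<^sup>2 * ((T - t) / real n) / 2)" for k \<omega>
  proof (induction k)
    case (Suc k)
    have "walk q n (Suc k) \<omega> = walk q n k \<omega> + (W (?u (Suc k)) \<omega> - W (?u k) \<omega>) / (1 - ?u k)"
      "grid_clock t T n (Suc k) = grid_clock t T n k + (T - t) / real n / (1 - ?u k)\<^sup>2"
      by (simp_all add: walk_def grid_clock_def)
    moreover have "l * ((W (?u (Suc k)) \<omega> - W (?u k) \<omega>) / (1 - ?u k)) = ?c k * (W (?u (Suc k)) \<omega> - W (?u k) \<omega>)"
      "l\<^sup>2 * ((T - t) / real n / (1 - ?u k)\<^sup>2) = (?c k)\<^sup>2 * ((T - t) / real n)"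
      by (simp_all add: power_divide)
    ultimately show ?case using Suc by (simp only: sum.lessThan_Suc distrib_left add_divide_distrib)
  qed (simp add: walk_def grid_clock_def)
  then have "(\<integral>\<^sup>+\<omega>. ennreal (exp (l * walk q n (step n \<omega>) \<omega> - l\<^sup>2 * grid_clock t T n (step n \<omega>) / 2)) \<partial>M)
      = (\<integral>\<^sup>+\<omega>. ennreal (exp ?a) * ennreal (exp (?s \<omega>)) \<partial>M)"
    by (simp add: exp_add ennreal_mult)
  also have "\<dots> = ennreal (exp ?a) * (\<integral>\<^sup>+\<omega>. ennreal (exp (?s \<omega>)) \<partial>M)"
  proof (rule nn_integral_cmult)
    have s: "?s \<omega> = l * walk q n (step n \<omega>) \<omega> - l\<^sup>2 * grid_clock t T n (step n \<omega>) / 2 - ?a" for \<omega>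
      using exponent[of "step n \<omega>" \<omega>]
      by linarith
    show "(\<lambda>\<omega>. ennreal (exp (?s \<omega>))) \<in> borel_measurable M"
      unfolding s by measurable
  qed
  also have "(\<integral>\<^sup>+\<omega>. ennreal (exp (?s \<omega>)) \<partial>M) = 1"
    by (rule stopped_exponential_martingale[OF T(1) assms step_past[OF assms] step_le]) (use assms in auto)
  finally show ?thesis by simp
qed

abbreviation scaled :: "real \<Rightarrow> real \<Rightarrow> 'a \<Rightarrow> real" where
  "scaled q s \<omega> \<equiv> (Z s \<omega> - q) / (1 - s)"

lemma exponent_tendsto:
  assumes "\<omega> \<in> space M"
  shows "(\<lambda>n. l * scaled q (grid t T n (step n \<omega>)) \<omega> - l\<^sup>2 * grid_clock t T n (step n \<omega>) / 2)
    \<longlonglongrightarrow> l * scaled q (\<sigma> \<omega>) \<omega> - l\<^sup>2 * (1 / (1 - \<sigma> \<omega>)) / 2"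
proof -
  have u: "(\<lambda>n. grid t T n (step n \<omega>)) \<longlonglongrightarrow> \<sigma> \<omega>"
    using T(1) \<sigma>_range[OF assms] by (rule grid_index_tendsto)
  have "(\<lambda>n. Z (grid t T n (step n \<omega>)) \<omega>) \<longlonglongrightarrow> Z (\<sigma> \<omega>) \<omega>"
  proof (rule continuous_on_tendsto_compose[OF Z_continuous[OF assms] u])
    show "\<sigma> \<omega> \<in> {t..1}" using \<sigma>_range[OF assms] T by auto
    show "\<forall>\<^sub>F n in sequentially. grid t T n (step n \<omega>) \<in> {t..1}"
    proof (rule eventually_mono[OF eventually_gt_at_top[of "0 :: nat"]])
      fix n :: nat assume "0 < n"
      then have "grid t T n (step n \<omega>) \<in> {t..T}" using T step_le[OF assms] by (intro grid_bounds) auto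
      then show "grid t T n (step n \<omega>) \<in> {t..1}" using T by auto
    qed
  qed
  moreover have "\<sigma> \<omega> \<noteq> 1" using \<sigma>_range[OF assms] T by auto
  ultimately show ?thesis
    by (intro tendsto_intros u grid_clock_tendsto T \<sigma>_range assms) auto
qed

text \<open>Fatou's lemma along the grids, where the right-hand expectations are constant in n. The
  assumption covers all k <= n at once because it is evaluated at the random index
  \<open>step n\<close>.\<close>

lemma exp_martingale_le:
  assumes "AE \<omega> in M. \<forall>\<epsilon>>0. \<forall>\<^sub>F n in sequentially. \<forall>k\<le>n. l * scaled q (grid t T n k) \<omega> \<le> l * walk q n k \<omega> + \<epsilon>"
  shows "(\<integral>\<^sup>+\<omega>. ennreal (exp (l * scaled q (\<sigma> \<omega>) \<omega> - l\<^sup>2 * (1 / (1 - \<sigma> \<omega>)) / 2)) \<partial>M)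
    \<le> ennreal (exp (l * ((z - q) / (1 - t)) - l\<^sup>2 * (1 / (1 - t)) / 2))"
proof -
  let ?L = "\<lambda>n \<omega>. ennreal (exp (l * walk q n (step n \<omega>) \<omega> - l\<^sup>2 * grid_clock t T n (step n \<omega>) / 2))"
  have "(\<integral>\<^sup>+\<omega>. ennreal (exp (l * scaled q (\<sigma> \<omega>) \<omega> - l\<^sup>2 * (1 / (1 - \<sigma> \<omega>)) / 2)) \<partial>M)
      \<le> (\<integral>\<^sup>+\<omega>. liminf (\<lambda>n. ?L n \<omega>) \<partial>M)"
  proof (rule nn_integral_mono_AE)
    show "AE \<omega> in M. ennreal (exp (l * scaled q (\<sigma> \<omega>) \<omega> - l\<^sup>2 * (1 / (1 - \<sigma> \<omega>)) / 2)) \<le> liminf (\<lambda>n. ?L n \<omega>)"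
      using assms AE_space
    proof eventually_elim
      case (elim \<omega>)
      show ?case
      proof (rule liminf_exp_ge[OF exponent_tendsto[OF elim(2)]])
        fix \<epsilon> :: real assume "\<epsilon> > 0"
        with elim(1) have "\<forall>\<^sub>F n in sequentially. \<forall>k\<le>n. l * scaled q (grid t T n k) \<omega> \<le> l * walk q n k \<omega> + \<epsilon>" by blast
        then show "\<forall>\<^sub>F n in sequentially. l * scaled q (grid t T n (step n \<omega>)) \<omega> - l\<^sup>2 * grid_clock t T n (step n \<omega>) / 2
            \<le> l * walk q n (step n \<omega>) \<omega> - l\<^sup>2 * grid_clock t T n (step n \<omega>) / 2 + \<epsilon>"
          using eventually_gt_at_top[of "0 :: nat"]
        proof eventually_elim
          case (elim n)
          have "l * scaled q (grid t T n (step n \<omega>)) \<omega> \<le> l * walk q n (step n \<omega>) \<omega> + \<epsilon>"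
            by (rule elim(1)[rule_format]) (rule step_le; fact)
          then show ?case by linarith
        qed
      qed
    qed
  qed
  also have "\<dots> \<le> liminf (\<lambda>n. \<integral>\<^sup>+\<omega>. ?L n \<omega> \<partial>M)"
    by (rule nn_integral_liminf) measurable
  also have "\<dots> \<le> ennreal (exp (l * ((z - q) / (1 - t)) - l\<^sup>2 * (1 / (1 - t)) / 2))"
  proof -
    have "liminf (\<lambda>n. \<integral>\<^sup>+\<omega>. ?L n \<omega> \<partial>M) = liminf (\<lambda>n. ennreal (exp (l * ((z - q) / (1 - t)) - l\<^sup>2 * (1 / (1 - t)) / 2)))"
      by (intro Liminf_eq eventually_mono[OF eventually_gt_at_top[of "0 :: nat"]] walk_exp_martingale)
    then show ?thesis by (simp add: Liminf_const)
  qed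
  finally show ?thesis .
qed

text \<open>The lower bound needs uniform integrability, which comes from the second moment of the exponential
  (again an exponential martingale, with doubled parameter, as the clock is bounded).\<close>

lemma exp_martingale_ge:
  assumes "AE \<omega> in M. \<forall>\<epsilon>>0. \<forall>\<^sub>F n in sequentially. \<forall>k\<le>n. l * walk q n k \<omega> \<le> l * scaled q (grid t T n k) \<omega> + \<epsilon>"
  shows "ennreal (exp (l * ((z - q) / (1 - t)) - l\<^sup>2 * (1 / (1 - t)) / 2))
    \<le> (\<integral>\<^sup>+\<omega>. ennreal (exp (l * scaled q (\<sigma> \<omega>) \<omega> - l\<^sup>2 * (1 / (1 - \<sigma> \<omega>)) / 2)) \<partial>M)"
    (is "ennreal ?e \<le> ?I")
proof -
  let ?L = "\<lambda>n \<omega>. ennreal (exp (l * walk q n (step n \<omega>) \<omega> - l\<^sup>2 * grid_clock t T n (step n \<omega>) / 2))"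
  \<comment> \<open>Squaring exp (l X - l^2 \<open>\<theta>\<close> / 2) gives the exponential with
    parameter 2 l times exp (l^2 \<open>\<theta>\<close>), and the clock \<open>\<theta>\<close> is
    at most 1 / (1 - T).\<close>
  define B where "B = exp (l\<^sup>2 * (1 / (1 - T))) * exp ((2 * l) * ((z - q) / (1 - t)) - (2 * l)\<^sup>2 * (1 / (1 - t)) / 2)"
  have B: "B > 0" by (simp add: B_def)
  have second_moment: "(\<integral>\<^sup>+\<omega>. ?L n \<omega> * ?L n \<omega> \<partial>M) \<le> ennreal B" if n: "n > 0" for n
  proof -
    have "(\<integral>\<^sup>+\<omega>. ?L n \<omega> * ?L n \<omega> \<partial>M) \<le> (\<integral>\<^sup>+\<omega>. ennreal (exp (l\<^sup>2 * (1 / (1 - T))))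
        * ennreal (exp ((2 * l) * walk q n (step n \<omega>) \<omega> - (2 * l)\<^sup>2 * grid_clock t T n (step n \<omega>) / 2)) \<partial>M)"
    proof (rule nn_integral_mono)
      fix \<omega> assume \<omega>: "\<omega> \<in> space M"
      have "grid_clock t T n (step n \<omega>) \<le> 1 / (1 - grid t T n (step n \<omega>))"
        by (rule grid_clock_bounds(1)[OF T n step_le[OF \<omega> n]])
      also have "\<dots> \<le> 1 / (1 - T)"
        using grid_bounds[of t T "step n \<omega>" n] step_le[OF \<omega> n] n T by (intro divide_left_mono) auto
      finally have "l\<^sup>2 * grid_clock t T n (step n \<omega>) \<le> l\<^sup>2 * (1 / (1 - T))"
        by (rule mult_left_mono) simp
      then have "(l * walk q n (step n \<omega>) \<omega> - l\<^sup>2 * grid_clock t T n (step n \<omega>) / 2)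
          + (l * walk q n (step n \<omega>) \<omega> - l\<^sup>2 * grid_clock t T n (step n \<omega>) / 2)
          \<le> l\<^sup>2 * (1 / (1 - T)) + ((2 * l) * walk q n (step n \<omega>) \<omega> - (2 * l)\<^sup>2 * grid_clock t T n (step n \<omega>) / 2)"
        by (simp add: power_mult_distrib)
      then show "?L n \<omega> * ?L n \<omega> \<le> ennreal (exp (l\<^sup>2 * (1 / (1 - T))))
        * ennreal (exp ((2 * l) * walk q n (step n \<omega>) \<omega> - (2 * l)\<^sup>2 * grid_clock t T n (step n \<omega>) / 2))"
        unfolding ennreal_mult[OF exp_ge_zero exp_ge_zero, symmetric] exp_add[symmetric]
        by (intro ennreal_leI) simp
    qed
    also have "\<dots> = ennreal B"
      using walk_exp_martingale[OF n, of "2 * l" q]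
      by (subst nn_integral_cmult) (simp_all add: B_def ennreal_mult[symmetric])
    finally show ?thesis .
  qed
  have bound: "ennreal ?e \<le> ?I + ennreal (B / C)" if C: "C > 0" for C :: real
  proof -
    have trunc: "ennreal ?e \<le> (\<integral>\<^sup>+\<omega>. min (?L n \<omega>) (ennreal C) \<partial>M) + ennreal (B / C)" if n: "n > 0" for n
    proof -
      have "ennreal ?e = (\<integral>\<^sup>+\<omega>. ?L n \<omega> \<partial>M)"
        by (rule walk_exp_martingale[OF n, symmetric])
      \<comment> \<open>x <= min x C + x^2 / C: above C the quadratic term alone suffices. The
        truncated part has the constant majorant C, as reverse Fatou requires, and the rest is at
        most B / C.\<close>
      also have "\<dots> \<le> (\<integral>\<^sup>+\<omega>. min (?L n \<omega>) (ennreal C) + ennreal (1 / C) * (?L n \<omega> * ?L n \<omega>) \<partial>M)"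
      proof (rule nn_integral_mono)
        fix \<omega>
        define x where "x = exp (l * walk q n (step n \<omega>) \<omega> - l\<^sup>2 * grid_clock t T n (step n \<omega>) / 2)"
        have x: "x > 0" by (simp add: x_def)
        have "x \<le> min x C + 1 / C * (x * x)"
        proof (cases "x \<le> C")
          case False
          then have "x * C \<le> x * x" using x by (intro mult_left_mono) auto
          then have "x \<le> 1 / C * (x * x)" using C by (simp add: field_simps)
          then show ?thesis using C x by (simp add: min_def)
        qed (use C x in simp)
        then have "ennreal x \<le> ennreal (min x C + 1 / C * (x * x))" by (rule ennreal_leI)
        also have "\<dots> = min (ennreal x) (ennreal C) + ennreal (1 / C) * (ennreal x * ennreal x)"
          using C x by (auto simp: ennreal_plus ennreal_mult[symmetric] min_def)
        finally show "?L n \<omega> \<le> min (?L n \<omega>) (ennreal C) + ennreal (1 / C) * (?L n \<omega> * ?L n \<omega>)"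
          unfolding x_def .
      qed
      also have "\<dots> = (\<integral>\<^sup>+\<omega>. min (?L n \<omega>) (ennreal C) \<partial>M) + ennreal (1 / C) * (\<integral>\<^sup>+\<omega>. ?L n \<omega> * ?L n \<omega> \<partial>M)"
        by (subst nn_integral_add) (auto simp: nn_integral_cmult)
      also have "\<dots> \<le> (\<integral>\<^sup>+\<omega>. min (?L n \<omega>) (ennreal C) \<partial>M) + ennreal (1 / C) * ennreal B"
        by (intro add_left_mono mult_left_mono second_moment n) simp
      finally show ?thesis using B C by (simp add: ennreal_mult[symmetric])
    qed
    have "ennreal ?e - ennreal (B / C) \<le> limsup (\<lambda>n. \<integral>\<^sup>+\<omega>. min (?L n \<omega>) (ennreal C) \<partial>M)"
    proof (rule le_Limsup)
      show "\<forall>\<^sub>F n in sequentially. ennreal ?e - ennreal (B / C) \<le> (\<integral>\<^sup>+\<omega>. min (?L n \<omega>) (ennreal C) \<partial>M)"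
        using trunc
        by (intro eventually_mono[OF eventually_gt_at_top[of "0 :: nat"]]) (simp add: ennreal_minus_le_iff add.commute)
    qed simp
    also have "\<dots> \<le> (\<integral>\<^sup>+\<omega>. limsup (\<lambda>n. min (?L n \<omega>) (ennreal C)) \<partial>M)"
      by (rule nn_integral_limsup[where w = "\<lambda>_. ennreal C"]) (auto simp: emeasure_space_1)
    also have "\<dots> \<le> ?I"
    proof (rule nn_integral_mono_AE)
      show "AE \<omega> in M. limsup (\<lambda>n. min (?L n \<omega>) (ennreal C))
          \<le> ennreal (exp (l * scaled q (\<sigma> \<omega>) \<omega> - l\<^sup>2 * (1 / (1 - \<sigma> \<omega>)) / 2))"
        using assms AE_space
      proof eventually_elim
        case (elim \<omega>)
        have "limsup (\<lambda>n. min (?L n \<omega>) (ennreal C)) \<le> limsup (\<lambda>n. ?L n \<omega>)"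
          by (intro Limsup_mono always_eventually) auto
        also have "\<dots> \<le> ennreal (exp (l * scaled q (\<sigma> \<omega>) \<omega> - l\<^sup>2 * (1 / (1 - \<sigma> \<omega>)) / 2))"
        proof (rule limsup_exp_le[OF exponent_tendsto[OF elim(2)]])
          fix \<epsilon> :: real assume "\<epsilon> > 0"
          with elim(1) have "\<forall>\<^sub>F n in sequentially. \<forall>k\<le>n. l * walk q n k \<omega> \<le> l * scaled q (grid t T n k) \<omega> + \<epsilon>" by blast
          then show "\<forall>\<^sub>F n in sequentially. l * walk q n (step n \<omega>) \<omega> - l\<^sup>2 * grid_clock t T n (step n \<omega>) / 2
              \<le> l * scaled q (grid t T n (step n \<omega>)) \<omega> - l\<^sup>2 * grid_clock t T n (step n \<omega>) / 2 + \<epsilon>"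
            using eventually_gt_at_top[of "0 :: nat"]
          proof eventually_elim
            case (elim n)
            have "l * walk q n (step n \<omega>) \<omega> \<le> l * scaled q (grid t T n (step n \<omega>)) \<omega> + \<epsilon>"
              by (rule elim(1)[rule_format]) (rule step_le; fact)
            then show ?case by linarith
          qed
        qed
        finally show ?case .
      qed
    qed
    finally show ?thesis by (simp add: ennreal_minus_le_iff add.commute)
  qed
  show ?thesis
  proof (rule ennreal_le_epsilon)
    fix \<epsilon> :: real assume "0 < \<epsilon>"
    then show "ennreal ?e \<le> ?I + ennreal \<epsilon>" using bound[of "B / \<epsilon>"] B by simp
  qed
qed

end

section \<open>Payoff bounds\<close>

text \<open>Read off from the integral over l >= 0, whose integrand increases in x. The derivative y
  mills y + 1 would call for a tail estimate at negative y.\<close>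

lemma mills_mono:
  assumes "x \<le> y"
  shows "mills x \<le> mills y"
proof -
  have "ennreal (mills x) = (\<integral>\<^sup>+l. ennreal (exp (l * x - l\<^sup>2 * 1 / 2)) * indicator {0..} l \<partial>lborel)"
    using nn_integral_exp_quadratic[of 1 x] by simp
  also have "\<dots> \<le> (\<integral>\<^sup>+l. ennreal (exp (l * y - l\<^sup>2 * 1 / 2)) * indicator {0..} l \<partial>lborel)"
    using assms by (intro nn_integral_mono) (auto simp: indicator_def intro!: ennreal_leI mult_left_mono)
  also have "\<dots> = ennreal (mills y)"
    using nn_integral_exp_quadratic[of 1 y] by simp
  finally show ?thesis using mills_pos[of y] by simp
qed

lemma mills_measurable [measurable]: "mills \<in> borel_measurable borel"
proof -
  have "continuous_on UNIV mills"
    using mills_has_derivative DERIV_isCont continuous_at_imp_continuous_on by blast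
  then show ?thesis by (rule borel_measurable_continuous_onI)
qed

text \<open>The weight exp (- l^2 a / 2) in the mixture shifts the clock by a. The factor 1 + a (1 -
  t) is the ratio of shifted to unshifted clock at the start, where it is largest; it pays for
  replacing X / \<open>\<theta>\<close> by X / (\<open>\<theta>\<close> + a).\<close>

definition payoff_bound :: "real \<Rightarrow> real \<Rightarrow> real \<Rightarrow> real \<Rightarrow> real" where
  "payoff_bound t z q a = (1 - shepp_beta\<^sup>2) * (1 + a * (1 - t))
     * (mills ((z - q) / (1 - t) / sqrt (1 / (1 - t) + a)) / sqrt (1 / (1 - t) + a))"

context stopped_bridge
begin

lemma drift_integral_le:
  assumes q: "AE u in \<mu>. u \<le> q" and \<omega>: "\<omega> \<in> space M" and ab: "t \<le> a" "a \<le> b" "b < 1"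
  shows "integral {a..b} (\<lambda>s. drift s (Z s \<omega>)) \<le> integral {a..b} (\<lambda>s. (q - Z s \<omega>) / (1 - s))"
proof (rule integral_le)
  have "continuous_on {a..b} (\<lambda>s. drift s (Z s \<omega>))"
    by (rule continuous_on_subset[OF drift_continuous[OF \<omega> ab(3)]]) (use ab in auto)
  then show "(\<lambda>s. drift s (Z s \<omega>)) integrable_on {a..b}" by (rule integrable_continuous_real)
  have "continuous_on {a..b} (\<lambda>s. Z s \<omega>)"
    by (rule continuous_on_subset[OF Z_continuous[OF \<omega>]]) (use ab in auto)
  then have "continuous_on {a..b} (\<lambda>s. (q - Z s \<omega>) / (1 - s))"
    by (intro continuous_intros) (use ab in auto)
  then show "(\<lambda>s. (q - Z s \<omega>) / (1 - s)) integrable_on {a..b}" by (rule integrable_continuous_real)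
  fix s assume "s \<in> {a..b}"
  then show "drift s (Z s \<omega>) \<le> (q - Z s \<omega>) / (1 - s)"
    using ab start_nonneg by (intro divide_right_mono diff_right_mono prior.post_mean_le q) auto
qed

lemma drift_integral_ge:
  assumes q: "AE u in \<mu>. q \<le> u" and \<omega>: "\<omega> \<in> space M" and ab: "t \<le> a" "a \<le> b" "b < 1"
  shows "integral {a..b} (\<lambda>s. (q - Z s \<omega>) / (1 - s)) \<le> integral {a..b} (\<lambda>s. drift s (Z s \<omega>))"
proof (rule integral_le)
  have "continuous_on {a..b} (\<lambda>s. drift s (Z s \<omega>))"
    by (rule continuous_on_subset[OF drift_continuous[OF \<omega> ab(3)]]) (use ab in auto)
  then show "(\<lambda>s. drift s (Z s \<omega>)) integrable_on {a..b}" by (rule integrable_continuous_real)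
  have "continuous_on {a..b} (\<lambda>s. Z s \<omega>)"
    by (rule continuous_on_subset[OF Z_continuous[OF \<omega>]]) (use ab in auto)
  then have "continuous_on {a..b} (\<lambda>s. (q - Z s \<omega>) / (1 - s))"
    by (intro continuous_intros) (use ab in auto)
  then show "(\<lambda>s. (q - Z s \<omega>) / (1 - s)) integrable_on {a..b}" by (rule integrable_continuous_real)
  fix s assume "s \<in> {a..b}"
  then show "(q - Z s \<omega>) / (1 - s) \<le> drift s (Z s \<omega>)"
    using ab start_nonneg by (intro divide_right_mono diff_right_mono prior.post_mean_ge q) auto
qed

text \<open>\<open>scaled_gap_le\<close> applied path by path, since a prior below q pulls Z no
  higher than the pinning point q does. Multiplication by l >= 0 keeps the order; here the mixture
  becomes confined to nonnegative l.\<close>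

lemma scaled_le_walk:
  assumes q: "AE u in \<mu>. u \<le> q" and l: "l \<ge> 0"
  shows "AE \<omega> in M. \<forall>\<epsilon>>0. \<forall>\<^sub>F n in sequentially. \<forall>k\<le>n. l * scaled q (grid t T n k) \<omega> \<le> l * walk q n k \<omega> + \<epsilon>"
  using AE_increments AE_space
proof eventually_elim
  case (elim \<omega>)
  show ?case
  proof (intro allI impI)
    fix \<epsilon> :: real assume \<epsilon>: "0 < \<epsilon>"
    \<comment> \<open>Dividing by l + 1 also covers l = 0.\<close>
    define \<delta> where "\<delta> = \<epsilon> / (l + 1)"
    have \<delta>: "\<delta> > 0" "l * \<delta> \<le> \<epsilon>" using \<epsilon> l by (auto simp: \<delta>_def field_simps)
    have "\<forall>\<^sub>F n in sequentially. \<forall>k\<le>n. (Z (grid t T n k) \<omega> - q) / (1 - grid t T n k)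
      \<le> (Z t \<omega> - q) / (1 - t) + (\<Sum>j<k. (W (grid t T n (Suc j)) \<omega> - W (grid t T n j) \<omega>) / (1 - grid t T n j)) + \<delta>"
    proof (rule scaled_gap_le[OF T \<delta>(1), where p = "\<lambda>s. Z s \<omega>" and w = "\<lambda>s. W s \<omega>"])
      show "continuous_on {t..T} (\<lambda>s. Z s \<omega>)"
        by (rule continuous_on_subset[OF Z_continuous[OF elim(2)]]) (use T in auto)
      fix a b assume ab: "t \<le> a" "a \<le> b" "b \<le> T"
      then have "b < 1" using T by simp
      from elim(1)[THEN conjunct2, rule_format, OF ab(1,2) this] drift_integral_le[OF q elim(2) ab(1,2) this]
      show "Z b \<omega> - Z a \<omega> \<le> integral {a..b} (\<lambda>s. (q - Z s \<omega>) / (1 - s)) + (W b \<omega> - W a \<omega>)" by linarith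
    qed
    then have "\<forall>\<^sub>F n in sequentially. \<forall>k\<le>n. scaled q (grid t T n k) \<omega> \<le> walk q n k \<omega> + \<delta>"
      unfolding walk_def conjunct1[OF elim(1)] .
    then show "\<forall>\<^sub>F n in sequentially. \<forall>k\<le>n. l * scaled q (grid t T n k) \<omega> \<le> l * walk q n k \<omega> + \<epsilon>"
    proof (rule eventually_mono, intro allI impI)
      fix n k assume "\<forall>k\<le>n. scaled q (grid t T n k) \<omega> \<le> walk q n k \<omega> + \<delta>" "k \<le> n"
      then have "l * scaled q (grid t T n k) \<omega> \<le> l * (walk q n k \<omega> + \<delta>)" using l by (intro mult_left_mono) auto
      then show "l * scaled q (grid t T n k) \<omega> \<le> l * walk q n k \<omega> + \<epsilon>"
        using \<delta>(2) unfolding distrib_left by linarith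
    qed
  qed
qed

lemma walk_minus_le_scaled:
  assumes q: "AE u in \<mu>. q \<le> u"
  shows "AE \<omega> in M. \<forall>\<epsilon>>0. \<forall>\<^sub>F n in sequentially. \<forall>k\<le>n. walk q n k \<omega> - \<epsilon> \<le> scaled q (grid t T n k) \<omega>"
  using AE_increments AE_space
proof eventually_elim
  case (elim \<omega>)
  show ?case
  proof (intro allI impI)
    fix \<delta> :: real assume \<delta>: "0 < \<delta>"
    have "\<forall>\<^sub>F n in sequentially. \<forall>k\<le>n. (Z (grid t T n k) \<omega> - q) / (1 - grid t T n k)
      \<ge> (Z t \<omega> - q) / (1 - t) + (\<Sum>j<k. (W (grid t T n (Suc j)) \<omega> - W (grid t T n j) \<omega>) / (1 - grid t T n j)) - \<delta>"
    proof (rule scaled_gap_ge[OF T \<delta>, where p = "\<lambda>s. Z s \<omega>" and w = "\<lambda>s. W s \<omega>"])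
      show "continuous_on {t..T} (\<lambda>s. Z s \<omega>)"
        by (rule continuous_on_subset[OF Z_continuous[OF elim(2)]]) (use T in auto)
      fix a b assume ab: "t \<le> a" "a \<le> b" "b \<le> T"
      then have "b < 1" using T by simp
      from elim(1)[THEN conjunct2, rule_format, OF ab(1,2) this] drift_integral_ge[OF q elim(2) ab(1,2) this]
      show "integral {a..b} (\<lambda>s. (q - Z s \<omega>) / (1 - s)) + (W b \<omega> - W a \<omega>) \<le> Z b \<omega> - Z a \<omega>" by linarith
    qed
    then show "\<forall>\<^sub>F n in sequentially. \<forall>k\<le>n. walk q n k \<omega> - \<delta> \<le> scaled q (grid t T n k) \<omega>"
      unfolding walk_def conjunct1[OF elim(1)] .
  qed
qed

lemma walk_le_scaled:
  assumes q: "AE u in \<mu>. q \<le> u" and l: "l \<ge> 0"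
  shows "AE \<omega> in M. \<forall>\<epsilon>>0. \<forall>\<^sub>F n in sequentially. \<forall>k\<le>n. l * walk q n k \<omega> \<le> l * scaled q (grid t T n k) \<omega> + \<epsilon>"
  using walk_minus_le_scaled[OF q]
proof eventually_elim
  case (elim \<omega>)
  show ?case
  proof (intro allI impI)
    fix \<epsilon> :: real assume \<epsilon>: "0 < \<epsilon>"
    define \<delta> where "\<delta> = \<epsilon> / (l + 1)"
    have \<delta>: "\<delta> > 0" "l * \<delta> \<le> \<epsilon>" using \<epsilon> l by (auto simp: \<delta>_def field_simps)
    from elim \<delta>(1) have "\<forall>\<^sub>F n in sequentially. \<forall>k\<le>n. walk q n k \<omega> - \<delta> \<le> scaled q (grid t T n k) \<omega>" by blast
    then show "\<forall>\<^sub>F n in sequentially. \<forall>k\<le>n. l * walk q n k \<omega> \<le> l * scaled q (grid t T n k) \<omega> + \<epsilon>"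
    proof (rule eventually_mono, intro allI impI)
      fix n k assume "\<forall>k\<le>n. walk q n k \<omega> - \<delta> \<le> scaled q (grid t T n k) \<omega>" "k \<le> n"
      then have "l * (walk q n k \<omega> - \<delta>) \<le> l * scaled q (grid t T n k) \<omega>" using l by (intro mult_left_mono) auto
      then show "l * walk q n k \<omega> \<le> l * scaled q (grid t T n k) \<omega> + \<epsilon>"
        using \<delta>(2) unfolding right_diff_distrib by linarith
    qed
  qed
qed

text \<open>Negative l reverses the order, so a prior above q yields an upper bound on exp (l X). It
  is used with l = - sqrt (1 - T) to control how far below q the path can be at the horizon.\<close>

lemma scaled_le_walk_neg:
  assumes q: "AE u in \<mu>. q \<le> u" and l: "l \<le> 0"
  shows "AE \<omega> in M. \<forall>\<epsilon>>0. \<forall>\<^sub>F n in sequentially. \<forall>k\<le>n. l * scaled q (grid t T n k) \<omega> \<le> l * walk q n k \<omega> + \<epsilon>"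
proof -
  have "- l \<ge> 0" using l by simp
  from walk_le_scaled[OF q this] show ?thesis
  proof eventually_elim
    case (elim \<omega>)
    show ?case
    proof (intro allI impI)
      fix \<epsilon> :: real assume "0 < \<epsilon>"
      with elim have "\<forall>\<^sub>F n in sequentially. \<forall>k\<le>n. - l * walk q n k \<omega> \<le> - l * scaled q (grid t T n k) \<omega> + \<epsilon>" by blast
      then show "\<forall>\<^sub>F n in sequentially. \<forall>k\<le>n. l * scaled q (grid t T n k) \<omega> \<le> l * walk q n k \<omega> + \<epsilon>"
      proof (rule eventually_mono, intro allI impI)
        fix n k assume "\<forall>k\<le>n. - l * walk q n k \<omega> \<le> - l * scaled q (grid t T n k) \<omega> + \<epsilon>" "k \<le> n"
        then have "- l * walk q n k \<omega> \<le> - l * scaled q (grid t T n k) \<omega> + \<epsilon>" by blast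
        then show "l * scaled q (grid t T n k) \<omega> \<le> l * walk q n k \<omega> + \<epsilon>"
          unfolding mult_minus_left by linarith
      qed
    qed
  qed
qed

text \<open>Closed form of the stopped exponentials integrated over l >= 0 with weight exp (- l^2 a
  / 2).\<close>

definition mixture :: "real \<Rightarrow> real \<Rightarrow> 'a \<Rightarrow> real" where
  "mixture q a \<omega> = mills (scaled q (\<sigma> \<omega>) \<omega> / sqrt (1 / (1 - \<sigma> \<omega>) + a)) / sqrt (1 / (1 - \<sigma> \<omega>) + a)"

text \<open>Tonelli's theorem moves the expectation inside the integral over l, where the martingale
  comparison holds for each l separately.\<close>

lemma nn_integral_mixture:
  assumes a: "a \<ge> 0"
  shows "(\<integral>\<^sup>+\<omega>. ennreal (mixture q a \<omega>) \<partial>M)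
    = (\<integral>\<^sup>+l. (\<integral>\<^sup>+\<omega>. ennreal (exp (l * scaled q (\<sigma> \<omega>) \<omega> - l\<^sup>2 * (1 / (1 - \<sigma> \<omega>)) / 2)) \<partial>M)
        * (ennreal (exp (- l\<^sup>2 * a / 2)) * indicator {0..} l) \<partial>lborel)"
proof -
  interpret pair_sigma_finite M lborel ..
  let ?f = "\<lambda>\<omega> l. ennreal (exp (l * scaled q (\<sigma> \<omega>) \<omega> - l\<^sup>2 * (1 / (1 - \<sigma> \<omega>) + a) / 2)) * indicator {0..} l"
  have "(\<integral>\<^sup>+\<omega>. ennreal (mixture q a \<omega>) \<partial>M) = (\<integral>\<^sup>+\<omega>. \<integral>\<^sup>+l. ?f \<omega> l \<partial>lborel \<partial>M)"
  proof (rule nn_integral_cong)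
    fix \<omega> assume "\<omega> \<in> space M"
    then have "1 / (1 - \<sigma> \<omega>) > 0" using \<sigma>_range[of \<omega>] T by auto
    then have "1 / (1 - \<sigma> \<omega>) + a > 0" using a by linarith
    from nn_integral_exp_quadratic[OF this, of "scaled q (\<sigma> \<omega>) \<omega>"]
    show "ennreal (mixture q a \<omega>) = (\<integral>\<^sup>+l. ?f \<omega> l \<partial>lborel)" by (simp add: mixture_def)
  qed
  also have "\<dots> = (\<integral>\<^sup>+l. \<integral>\<^sup>+\<omega>. ?f \<omega> l \<partial>M \<partial>lborel)"
    by (rule Fubini'[symmetric]) measurable
  also have "\<dots> = (\<integral>\<^sup>+l. (\<integral>\<^sup>+\<omega>. ennreal (exp (l * scaled q (\<sigma> \<omega>) \<omega> - l\<^sup>2 * (1 / (1 - \<sigma> \<omega>)) / 2)) \<partial>M)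
        * (ennreal (exp (- l\<^sup>2 * a / 2)) * indicator {0..} l) \<partial>lborel)"
  proof (rule nn_integral_cong)
    fix l
    have "?f \<omega> l = ennreal (exp (l * scaled q (\<sigma> \<omega>) \<omega> - l\<^sup>2 * (1 / (1 - \<sigma> \<omega>)) / 2))
        * (ennreal (exp (- l\<^sup>2 * a / 2)) * indicator {0..} l)" for \<omega>
    proof -
      have "l * scaled q (\<sigma> \<omega>) \<omega> - l\<^sup>2 * (1 / (1 - \<sigma> \<omega>) + a) / 2
          = (l * scaled q (\<sigma> \<omega>) \<omega> - l\<^sup>2 * (1 / (1 - \<sigma> \<omega>)) / 2) + - l\<^sup>2 * a / 2"
        by (simp only: distrib_left add_divide_distrib)
      then show ?thesis by (simp only: exp_add) (simp add: ennreal_mult mult.assoc)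
    qed
    then show "(\<integral>\<^sup>+\<omega>. ?f \<omega> l \<partial>M)
        = (\<integral>\<^sup>+\<omega>. ennreal (exp (l * scaled q (\<sigma> \<omega>) \<omega> - l\<^sup>2 * (1 / (1 - \<sigma> \<omega>)) / 2)) \<partial>M)
          * (ennreal (exp (- l\<^sup>2 * a / 2)) * indicator {0..} l)"
      by (simp only:) (rule nn_integral_multc; measurable)
  qed
  finally show ?thesis .
qed

lemma start_mixture:
  assumes a: "a \<ge> 0"
  shows "(\<integral>\<^sup>+l. ennreal (exp (l * ((z - q) / (1 - t)) - l\<^sup>2 * (1 / (1 - t)) / 2))
        * (ennreal (exp (- l\<^sup>2 * a / 2)) * indicator {0..} l) \<partial>lborel)
    = ennreal (mills ((z - q) / (1 - t) / sqrt (1 / (1 - t) + a)) / sqrt (1 / (1 - t) + a))"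
proof -
  have "1 / (1 - t) > 0" using T by simp
  then have pos: "1 / (1 - t) + a > 0" using a by linarith
  have "ennreal (exp (l * ((z - q) / (1 - t)) - l\<^sup>2 * (1 / (1 - t)) / 2)) * (ennreal (exp (- l\<^sup>2 * a / 2)) * indicator {0..} l)
      = ennreal (exp (l * ((z - q) / (1 - t)) - l\<^sup>2 * (1 / (1 - t) + a) / 2)) * indicator {0..} l" for l
  proof -
    have "l * ((z - q) / (1 - t)) - l\<^sup>2 * (1 / (1 - t) + a) / 2
        = (l * ((z - q) / (1 - t)) - l\<^sup>2 * (1 / (1 - t)) / 2) + - l\<^sup>2 * a / 2"
      by (simp only: distrib_left add_divide_distrib)
    then show ?thesis by (simp only: exp_add) (simp add: ennreal_mult mult.assoc)
  qed
  then show ?thesis using nn_integral_exp_quadratic[OF pos, of "(z - q) / (1 - t)"] by simp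
qed

lemma mixture_le:
  assumes q: "AE u in \<mu>. u \<le> q" and a: "a \<ge> 0"
  shows "(\<integral>\<^sup>+\<omega>. ennreal (mixture q a \<omega>) \<partial>M)
    \<le> ennreal (mills ((z - q) / (1 - t) / sqrt (1 / (1 - t) + a)) / sqrt (1 / (1 - t) + a))"
  unfolding nn_integral_mixture[OF a] start_mixture[OF a, symmetric]
proof (rule nn_integral_mono)
  fix l
  show "(\<integral>\<^sup>+\<omega>. ennreal (exp (l * scaled q (\<sigma> \<omega>) \<omega> - l\<^sup>2 * (1 / (1 - \<sigma> \<omega>)) / 2)) \<partial>M)
        * (ennreal (exp (- l\<^sup>2 * a / 2)) * indicator {0..} l)
    \<le> ennreal (exp (l * ((z - q) / (1 - t)) - l\<^sup>2 * (1 / (1 - t)) / 2))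
        * (ennreal (exp (- l\<^sup>2 * a / 2)) * indicator {0..} l)"
    using exp_martingale_le[OF scaled_le_walk[OF q, of l]]
    by (cases "l \<ge> 0") (auto intro: mult_right_mono)
qed

lemma mixture_ge:
  assumes q: "AE u in \<mu>. q \<le> u" and a: "a \<ge> 0"
  shows "ennreal (mills ((z - q) / (1 - t) / sqrt (1 / (1 - t) + a)) / sqrt (1 / (1 - t) + a))
    \<le> (\<integral>\<^sup>+\<omega>. ennreal (mixture q a \<omega>) \<partial>M)"
  unfolding nn_integral_mixture[OF a] start_mixture[OF a, symmetric]
proof (rule nn_integral_mono)
  fix l
  show "ennreal (exp (l * ((z - q) / (1 - t)) - l\<^sup>2 * (1 / (1 - t)) / 2))
        * (ennreal (exp (- l\<^sup>2 * a / 2)) * indicator {0..} l)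
    \<le> (\<integral>\<^sup>+\<omega>. ennreal (exp (l * scaled q (\<sigma> \<omega>) \<omega> - l\<^sup>2 * (1 / (1 - \<sigma> \<omega>)) / 2)) \<partial>M)
        * (ennreal (exp (- l\<^sup>2 * a / 2)) * indicator {0..} l)"
    using exp_martingale_ge[OF walk_le_scaled[OF q, of l]]
    by (cases "l \<ge> 0") (auto intro: mult_right_mono)
qed

text \<open>For X >= 0, (\<open>\<theta>\<close> + a) / \<open>\<theta>\<close> = 1 + a (1 -
  \<open>\<sigma>\<close>) is at most 1 + a (1 - t), and X / (\<open>\<theta>\<close> + a) is y /
  sqrt (\<open>\<theta>\<close> + a) for y = X / sqrt (\<open>\<theta>\<close> + a), to which
  \<open>mills_ge_diagonal\<close> applies. For X < 0 the payoff is negative and the mixture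
  positive.\<close>

lemma payoff_le_mixture:
  assumes a: "a \<ge> 0" and \<omega>: "\<omega> \<in> space M"
  shows "Z (\<sigma> \<omega>) \<omega> - q \<le> (1 - shepp_beta\<^sup>2) * (1 + a * (1 - t)) * mixture q a \<omega>"
proof -
  define \<theta> where "\<theta> = 1 / (1 - \<sigma> \<omega>)"
  define X where "X = scaled q (\<sigma> \<omega>) \<omega>"
  have s: "t \<le> \<sigma> \<omega>" "\<sigma> \<omega> < 1" using \<sigma>_range[OF \<omega>] T by auto
  have \<theta>: "\<theta> > 0" using s by (simp add: \<theta>_def)
  have pos: "\<theta> + a > 0" using \<theta> a by simp
  have Z: "Z (\<sigma> \<omega>) \<omega> - q = X / \<theta>" using s by (simp add: X_def \<theta>_def)
  have m: "mixture q a \<omega> = mills (X / sqrt (\<theta> + a)) / sqrt (\<theta> + a)" by (simp add: mixture_def X_def \<theta>_def)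
  have m_pos: "mixture q a \<omega> > 0" unfolding m using mills_pos pos by simp
  show ?thesis
  proof (cases "X \<ge> 0")
    case False
    have "0 \<le> (1 - shepp_beta\<^sup>2) * (1 + a * (1 - t)) * mixture q a \<omega>"
      using shepp_beta_square_less a T m_pos by (intro mult_nonneg_nonneg add_nonneg_nonneg) auto
    moreover have "X / \<theta> \<le> 0" using False \<theta> by (simp add: divide_le_0_iff)
    ultimately show ?thesis unfolding Z by linarith
  next
    case True
    have "1 \<le> \<theta> * (1 - t)" using s by (simp add: \<theta>_def field_simps)
    then have "a \<le> a * (\<theta> * (1 - t))" using a mult_left_mono[of 1 "\<theta> * (1 - t)" a] by simp
    then have "\<theta> + a \<le> (1 + a * (1 - t)) * \<theta>" by (simp add: algebra_simps)
    then have "X * (\<theta> + a) \<le> X * ((1 + a * (1 - t)) * \<theta>)" using True by (rule mult_left_mono)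
    then have "X / \<theta> \<le> (1 + a * (1 - t)) * (X / (\<theta> + a))" using \<theta> pos by (simp add: field_simps)
    also have "X / (\<theta> + a) = X / sqrt (\<theta> + a) / sqrt (\<theta> + a)" using pos by simp
    also have "\<dots> \<le> (1 - shepp_beta\<^sup>2) * mills (X / sqrt (\<theta> + a)) / sqrt (\<theta> + a)"
      using pos by (intro divide_right_mono mills_ge_diagonal) simp
    finally have "X / \<theta> \<le> (1 + a * (1 - t)) * ((1 - shepp_beta\<^sup>2) * mills (X / sqrt (\<theta> + a)) / sqrt (\<theta> + a))"
      using a T by (simp add: mult_left_mono)
    then show ?thesis unfolding Z m by (simp add: mult_ac)
  qed
qed

text \<open>\<open>ennreal\<close> truncates at 0, so this bounds the expected positive part of the
  payoff, to which Fatou's lemma can be applied as T tends to 1.\<close>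

lemma payoff_le:
  assumes q: "AE u in \<mu>. u \<le> q" and a: "a \<ge> 0"
  shows "(\<integral>\<^sup>+\<omega>. ennreal (Z (\<sigma> \<omega>) \<omega> - q) \<partial>M) \<le> ennreal (payoff_bound t z q a)"
proof -
  let ?c = "(1 - shepp_beta\<^sup>2) * (1 + a * (1 - t))"
  have c: "?c \<ge> 0" using shepp_beta_square_less a T by (intro mult_nonneg_nonneg add_nonneg_nonneg) auto
  have "(\<integral>\<^sup>+\<omega>. ennreal (Z (\<sigma> \<omega>) \<omega> - q) \<partial>M) \<le> (\<integral>\<^sup>+\<omega>. ennreal ?c * ennreal (mixture q a \<omega>) \<partial>M)"
    using c payoff_le_mixture[OF a] by (intro nn_integral_mono) (simp add: ennreal_mult'[symmetric] ennreal_leI)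
  also have "\<dots> \<le> ennreal ?c * (\<integral>\<^sup>+\<omega>. ennreal (mixture q a \<omega>) \<partial>M)"
    by (rule nn_integral_cmult[THEN eq_refl]) (simp add: mixture_def[abs_def])
  also have "\<dots> \<le> ennreal ?c * ennreal (mills ((z - q) / (1 - t) / sqrt (1 / (1 - t) + a)) / sqrt (1 / (1 - t) + a))"
    by (intro mult_left_mono mixture_le q a) simp
  finally show ?thesis using c by (simp add: payoff_bound_def ennreal_mult'[symmetric])
qed

end

section \<open>Stopping and hitting times\<close>

context observed_bridge
begin

text \<open>Stopping times are cut at horizons increasing to 1; continuity of the paths up to time 1
  and Fatou's lemma for the positive part recover the original payoff.\<close>

lemma stopped_payoff_le:
  assumes \<tau>: "\<tau> \<in> stopping_times M Z t" and int: "integrable M (\<lambda>\<omega>. Z (t + \<tau> \<omega>) \<omega>)"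
    and q: "AE u in \<mu>. u \<le> q" and a: "a \<ge> 0"
  shows "(\<integral>\<omega>. Z (t + \<tau> \<omega>) \<omega> \<partial>M) \<le> q + payoff_bound t z q a"
proof -
  \<comment> \<open>The summand 2 keeps each horizon strictly above t; with 1 the first one would
    equal t.\<close>
  define T where "T k = 1 - (1 - t) / (real k + 2)" for k :: nat
  have T: "t < T k" "T k < 1" for k
  proof -
    have "(1 - t) / (real k + 2) < (1 - t) / 1"
      using start_less by (intro divide_strict_left_mono) auto
    then show "t < T k" by (simp add: T_def)
    show "T k < 1" using start_less by (simp add: T_def add_pos_pos)
  qed
  have T_lim: "T \<longlonglongrightarrow> 1" unfolding T_def by real_asymp
  define \<sigma> where "\<sigma> k \<omega> = min (t + \<tau> \<omega>) (T k)" for k \<omega>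
  have \<tau>_range: "t + \<tau> \<omega> \<in> {t..1}" if "\<omega> \<in> space M" for \<omega>
    using \<tau> that by (auto simp: stopping_times_def dest!: funcset_mem)
  interpret S: stopped_bridge \<mu> M W t z Z "T k" "\<sigma> k" for k
  proof unfold_locales
    show "t < T k" "T k < 1" by (fact T)+
    show "\<sigma> k \<omega> \<in> {t..T k}" if "\<omega> \<in> space M" for \<omega>
      using \<tau>_range[OF that] T(1)[of k] by (auto simp: \<sigma>_def)
    fix s assume s: "t \<le> s" "s < T k"
    then have "{\<omega> \<in> space M. \<sigma> k \<omega> \<le> s} = {\<omega> \<in> space M. t + \<tau> \<omega> \<le> s}"
      by (auto simp: \<sigma>_def)
    then show "{\<omega> \<in> space M. \<sigma> k \<omega> \<le> s} \<in> sets (past s)"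
      using stopping_time_past[OF \<tau>, of s] s T(2)[of k] by simp
  qed
  have bound_nonneg: "payoff_bound t z q a \<ge> 0"
    unfolding payoff_bound_def using shepp_beta_square_less a start_less mills_pos
    by (intro mult_nonneg_nonneg add_nonneg_nonneg divide_nonneg_nonneg) (auto intro: less_imp_le)
  have "(\<integral>\<^sup>+\<omega>. ennreal (Z (t + \<tau> \<omega>) \<omega> - q) \<partial>M) \<le> (\<integral>\<^sup>+\<omega>. liminf (\<lambda>k. ennreal (Z (\<sigma> k \<omega>) \<omega> - q)) \<partial>M)"
  proof (rule nn_integral_mono)
    fix \<omega> assume \<omega>: "\<omega> \<in> space M"
    have "(\<lambda>k. \<sigma> k \<omega>) \<longlonglongrightarrow> min (t + \<tau> \<omega>) 1"
      unfolding \<sigma>_def by (intro tendsto_min tendsto_const T_lim)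
    then have \<sigma>_lim: "(\<lambda>k. \<sigma> k \<omega>) \<longlonglongrightarrow> t + \<tau> \<omega>" using \<tau>_range[OF \<omega>] by simp
    have "(\<lambda>k. Z (\<sigma> k \<omega>) \<omega>) \<longlonglongrightarrow> Z (t + \<tau> \<omega>) \<omega>"
    proof (rule continuous_on_tendsto_compose[OF Z_continuous[OF \<omega>] \<sigma>_lim \<tau>_range[OF \<omega>]])
      show "\<forall>\<^sub>F k in sequentially. \<sigma> k \<omega> \<in> {t..1}"
        using S.\<sigma>_range[OF \<omega>] T(2) by (intro always_eventually allI) (meson atLeastAtMost_iff less_imp_le order_trans)
    qed
    then have "(\<lambda>k. ennreal (Z (\<sigma> k \<omega>) \<omega> - q)) \<longlonglongrightarrow> ennreal (Z (t + \<tau> \<omega>) \<omega> - q)"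
      by (intro tendsto_ennrealI tendsto_diff tendsto_const)
    then show "ennreal (Z (t + \<tau> \<omega>) \<omega> - q) \<le> liminf (\<lambda>k. ennreal (Z (\<sigma> k \<omega>) \<omega> - q))"
      by (simp add: lim_imp_Liminf)
  qed
  also have "\<dots> \<le> liminf (\<lambda>k. \<integral>\<^sup>+\<omega>. ennreal (Z (\<sigma> k \<omega>) \<omega> - q) \<partial>M)"
  proof (rule nn_integral_liminf)
    show "(\<lambda>\<omega>. ennreal (Z (\<sigma> k \<omega>) \<omega> - q)) \<in> borel_measurable M" for k
      using S.Z_\<sigma>_measurable[of k] by measurable
  qed
  also have "\<dots> \<le> liminf (\<lambda>k::nat. ennreal (payoff_bound t z q a))"
    by (intro Liminf_mono always_eventually allI S.payoff_le q a)
  also have "\<dots> = ennreal (payoff_bound t z q a)" by (simp add: Liminf_const)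
  finally have "(\<integral>\<omega>. Z (t + \<tau> \<omega>) \<omega> - q \<partial>M) \<le> payoff_bound t z q a"
    by (rule integral_real_bounded[OF bound_nonneg])
  then show ?thesis using int by (simp add: prob_space)
qed

lemma value_le:
  assumes "AE u in \<mu>. u \<le> q" "a \<ge> 0"
  shows "value_fn M (\<lambda>_ _. Z) t z \<le> ereal (q + payoff_bound t z q a)"
  unfolding value_fn_def using stopped_payoff_le assms by (intro SUP_least) auto

lemma value_ge_start: "ereal z \<le> value_fn M (\<lambda>_ _. Z) t z"
proof -
  have \<tau>: "(\<lambda>_. 0) \<in> stopping_times M Z t"
    using start_less by (auto simp: stopping_times_def intro: stopping_time_const)
  have int: "integrable M (Z t)"
  proof (rule integrable_cong_AE_imp[of _ "\<lambda>_. z"])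
    show "Z t \<in> borel_measurable M" using start_less by (intro Z_measurable) auto
    show "AE \<omega> in M. z = Z t \<omega>" using AE_start by eventually_elim simp
  qed simp
  have "(\<integral>\<omega>. Z t \<omega> \<partial>M) = (\<integral>\<omega>. z \<partial>M)"
    using int by (intro integral_cong_AE AE_start) auto
  then have "ereal z = ereal (\<integral>\<omega>. Z (t + 0) \<omega> \<partial>M)" by (simp add: prob_space)
  also have "\<dots> \<le> value_fn M (\<lambda>_ _. Z) t z"
    unfolding value_fn_def using \<tau> int by (intro SUP_upper2[of "\<lambda>_. 0"]) auto
  finally show ?thesis .
qed

end

text \<open>The filtration is not completed, so the hitting event is expressed through countably many times.\<close>

lemma continuous_ge_iff_rational:
  fixes g :: "real \<Rightarrow> real"
  assumes "continuous_on {0..1} g"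
  shows "(\<exists>x\<in>{0..1}. 0 \<le> g x) \<longleftrightarrow> (\<forall>m. \<exists>x\<in>\<rat> \<inter> {0..1}. - inverse (real (Suc m)) < g x)"
proof
  assume "\<exists>x\<in>{0..1}. 0 \<le> g x"
  then obtain x where x: "x \<in> {0..1}" "0 \<le> g x" by blast
  show "\<forall>m. \<exists>x\<in>\<rat> \<inter> {0..1}. - inverse (real (Suc m)) < g x"
  proof
    fix m
    have "inverse (real (Suc m)) > 0" by simp
    then obtain d where d: "d > 0" "\<And>y. y \<in> {0..1} \<Longrightarrow> dist y x < d \<Longrightarrow> dist (g y) (g x) < inverse (real (Suc m))"
      using assms x(1) unfolding continuous_on_iff by blast
    have "max 0 (x - d) < min 1 (x + d)" using x(1) d(1) by auto
    then obtain y where y: "y \<in> \<rat>" "max 0 (x - d) < y" "y < min 1 (x + d)"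
      using Rats_dense_in_real by blast
    then have "y \<in> {0..1}" "dist y x < d" by (auto simp: dist_real_def)
    from d(2)[OF this] have "- inverse (real (Suc m)) < g y"
      using x(2) by (simp add: dist_real_def)
    with \<open>y \<in> {0..1}\<close> y(1) show "\<exists>x\<in>\<rat> \<inter> {0..1}. - inverse (real (Suc m)) < g x" by blast
  qed
next
  assume *: "\<forall>m. \<exists>x\<in>\<rat> \<inter> {0..1}. - inverse (real (Suc m)) < g x"
  obtain x where x: "x \<in> {0..1}" "\<And>y. y \<in> {0..1} \<Longrightarrow> g y \<le> g x"
    using continuous_attains_sup[of "{0..1::real}" g] assms by auto
  have "0 \<le> g x"
  proof (rule ccontr)
    assume "\<not> 0 \<le> g x"
    then obtain m where m: "inverse (real (Suc m)) < - g x"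
      using reals_Archimedean[of "- g x"] by auto
    from * obtain y where "y \<in> {0..1}" "- inverse (real (Suc m)) < g y" by blast
    with x(2)[of y] m show False by linarith
  qed
  with x show "\<exists>x\<in>{0..1}. 0 \<le> g x" by blast
qed

context observed_bridge
begin

text \<open>T is inserted so that the infimum is over a nonempty set and equals T when the boundary
  is not reached in time.\<close>

definition hitting_time :: "(real \<Rightarrow> real) \<Rightarrow> real \<Rightarrow> 'a \<Rightarrow> real" where
  "hitting_time b T \<omega> = Inf (insert T {s \<in> {t..T}. b s \<le> Z s \<omega>})"

lemma hitting_time:
  assumes T: "t < T" "T < 1" and b: "continuous_on {t..1} b" and \<omega>: "\<omega> \<in> space M"
  shows hitting_time_range: "hitting_time b T \<omega> \<in> {t..T}"
    and hitting_time_cases: "b (hitting_time b T \<omega>) \<le> Z (hitting_time b T \<omega>) \<omega> \<or> hitting_time b T \<omega> = T"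
    and before_hitting_time: "\<And>s. t \<le> s \<Longrightarrow> s < hitting_time b T \<omega> \<Longrightarrow> Z s \<omega> < b s"
proof -
  let ?A = "insert T {s \<in> {t..T}. b s \<le> Z s \<omega>}"
  have "continuous_on {t..T} (\<lambda>s. Z s \<omega> - b s)"
    by (intro continuous_on_diff continuous_on_subset[OF Z_continuous[OF \<omega>]] continuous_on_subset[OF b]) (use T in auto)
  then have "closed ({t..T} \<inter> (\<lambda>s. Z s \<omega> - b s) -` {0..})"
    by (rule continuous_closed_preimage) auto
  also have "{t..T} \<inter> (\<lambda>s. Z s \<omega> - b s) -` {0..} = {s \<in> {t..T}. b s \<le> Z s \<omega>}" by auto
  finally have closed: "closed ?A" by simp
  have bdd: "bdd_below ?A" using T by (intro bdd_belowI[of _ t]) auto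
  have "hitting_time b T \<omega> \<in> ?A"
    unfolding hitting_time_def by (rule closed_contains_Inf[OF _ bdd closed]) simp
  then show range: "hitting_time b T \<omega> \<in> {t..T}"
    and "b (hitting_time b T \<omega>) \<le> Z (hitting_time b T \<omega>) \<omega> \<or> hitting_time b T \<omega> = T"
    using T by auto
  fix s assume s: "t \<le> s" "s < hitting_time b T \<omega>"
  show "Z s \<omega> < b s"
  proof (rule ccontr)
    assume "\<not> Z s \<omega> < b s"
    then have "s \<in> ?A" using s range by auto
    then have "hitting_time b T \<omega> \<le> s"
      unfolding hitting_time_def by (rule cInf_lower[OF _ bdd])
    with s show False by simp
  qed
qed

lemma hitting_time_le_iff:
  assumes T: "t < T" "T < 1" and b: "continuous_on {t..1} b" and \<omega>: "\<omega> \<in> space M" and s: "t \<le> s" "s < T"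
  shows "hitting_time b T \<omega> \<le> s \<longleftrightarrow> (\<exists>u\<in>{t..s}. b u \<le> Z u \<omega>)"
proof
  assume *: "hitting_time b T \<omega> \<le> s"
  then have "hitting_time b T \<omega> \<noteq> T" using s by simp
  then have "b (hitting_time b T \<omega>) \<le> Z (hitting_time b T \<omega>) \<omega>"
    using hitting_time_cases[OF T b \<omega>] by simp
  then show "\<exists>u\<in>{t..s}. b u \<le> Z u \<omega>"
    using * hitting_time_range[OF T b \<omega>] by (intro bexI[of _ "hitting_time b T \<omega>"]) auto
next
  assume "\<exists>u\<in>{t..s}. b u \<le> Z u \<omega>"
  then obtain u where u: "t \<le> u" "u \<le> s" "b u \<le> Z u \<omega>" by auto
  show "hitting_time b T \<omega> \<le> s"
    using before_hitting_time[OF T b \<omega> u(1)] u by (meson not_le order_trans)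
qed

lemma hitting_time_stopping_time:
  assumes T: "t < T" "T < 1" and b: "continuous_on {t..1} b"
  shows "(\<lambda>\<omega>. hitting_time b T \<omega> - t) \<in> stopping_times M Z t"
  unfolding stopping_times_def
proof (intro CollectI conjI)
  show "(\<lambda>\<omega>. hitting_time b T \<omega> - t) \<in> space M \<rightarrow> {0..1 - t}"
  proof
    fix \<omega> assume "\<omega> \<in> space M"
    then show "hitting_time b T \<omega> - t \<in> {0..1 - t}" using hitting_time_range[OF T b, of \<omega>] T by auto
  qed
  show "stopping_time (gen_filtration M Z t) (\<lambda>\<omega>. hitting_time b T \<omega> - t)"
  proof
    fix s
    let ?F = "gen_filtration M Z t s"
    have "{\<omega> \<in> space M. hitting_time b T \<omega> - t \<le> s} \<in> sets ?F"
    proof -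
      consider "s < 0" | "0 \<le> s" "t + s < T" | "T \<le> t + s" by linarith
      then show ?thesis
      proof cases
        case 1
        then have "{\<omega> \<in> space M. hitting_time b T \<omega> - t \<le> s} = {}"
          using hitting_time_range[OF T b] by fastforce
        then show ?thesis by (simp only: sets.empty_sets)
      next
        case 3
        then have "{\<omega> \<in> space M. hitting_time b T \<omega> - t \<le> s} = space ?F"
          using hitting_time_range[OF T b] unfolding space_gen_filtration by fastforce
        then show ?thesis by (simp only: sets.top)
      next
        case 2
        have gen: "{\<omega> \<in> space M. c < Z (t + u) \<omega>} \<in> sets ?F" if u: "u \<in> {0..s}" for u c
        proof -
          have "Z (t + u) -` {c<..} \<inter> space M
              \<in> {Z (t + u) -` A \<inter> space M | u A. u \<in> {0..s} \<inter> {0..1 - t} \<and> A \<in> sets borel}"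
            using u 2 T by (intro CollectI exI[of _ u] exI[of _ "{c<..}"]) auto
          then have "Z (t + u) -` {c<..} \<inter> space M \<in> sets ?F"
            unfolding gen_filtration_def by (subst sets_measure_of) auto
          also have "Z (t + u) -` {c<..} \<inter> space M = {\<omega> \<in> space M. c < Z (t + u) \<omega>}" by auto
          finally show ?thesis .
        qed
        \<comment> \<open>The points t + s x with x rational in the unit interval are countable and
          dense in {t..t + s}, also when t is irrational or s = 0.\<close>
        have "hitting_time b T \<omega> - t \<le> s \<longleftrightarrow>
            (\<forall>m. \<exists>x\<in>\<rat> \<inter> {0..1}. b (t + s * x) - inverse (real (Suc m)) < Z (t + s * x) \<omega>)"
          if \<omega>: "\<omega> \<in> space M" for \<omega>
        proof -
          have img: "(\<lambda>x. t + s * x) ` {0..1} = {t..t + s}"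
            using 2 image_affinity_atLeastAtMost[of s t 0 1] by (simp add: add.commute)
          have sub: "(\<lambda>x. t + s * x) ` {0..1} \<subseteq> {t..1}" unfolding img using 2 T by auto
          have "continuous_on {0..1} (\<lambda>x. Z (t + s * x) \<omega> - b (t + s * x))"
            by (intro continuous_on_diff continuous_on_compose2[OF Z_continuous[OF \<omega>] _ sub]
                continuous_on_compose2[OF b _ sub]) (intro continuous_intros)+
          note rat = continuous_ge_iff_rational[OF this]
          have "hitting_time b T \<omega> - t \<le> s \<longleftrightarrow> (\<exists>u\<in>{t..t + s}. b u \<le> Z u \<omega>)"
            using hitting_time_le_iff[OF T b \<omega>, of "t + s"] 2 by (simp add: algebra_simps)
          also have "\<dots> \<longleftrightarrow> (\<exists>x\<in>{0..1}. 0 \<le> Z (t + s * x) \<omega> - b (t + s * x))"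
            unfolding img[symmetric] by auto
          also note rat
          finally show ?thesis by (simp only: less_diff_eq diff_less_eq minus_less_iff) (simp add: algebra_simps)
        qed
        then have "{\<omega> \<in> space M. hitting_time b T \<omega> - t \<le> s}
            = (\<Inter>m. \<Union>x\<in>\<rat> \<inter> {0..1}. {\<omega> \<in> space M. b (t + s * x) - inverse (real (Suc m)) < Z (t + s * x) \<omega>})"
          by auto
        also have "\<dots> \<in> sets ?F"
        proof (intro sets.countable_INT image_subsetI sets.countable_UN'' gen)
          show "countable (\<rat> \<inter> {0..1::real})" using countable_rat by (rule countable_subset[rotated]) auto
          fix x assume "x \<in> \<rat> \<inter> {0..1::real}"
          then show "s * x \<in> {0..s}" using 2 mult_left_mono[of x 1 s] by auto
        qed auto
        finally show ?thesis .
      qed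
    qed
    then show "Measurable.pred ?F (\<lambda>\<omega>. hitting_time b T \<omega> - t \<le> s)"
      by (simp add: pred_def space_gen_filtration)
  qed
qed

end

section \<open>The boundary strategy\<close>

text \<open>In this form q plus the bound is Shepp's explicit value below the boundary.\<close>

lemma payoff_bound_0:
  assumes "t < 1"
  shows "payoff_bound t z q 0 = (1 - shepp_beta\<^sup>2) * mills ((z - q) / sqrt (1 - t)) * sqrt (1 - t)"
proof -
  have "sqrt (1 / (1 - t) + 0) = 1 / sqrt (1 - t)" by (simp add: real_sqrt_divide)
  moreover have "(z - q) / (1 - t) / (1 / sqrt (1 - t)) = (z - q) / sqrt (1 - t)"
    using assms by (simp add: field_simps real_div_sqrt)
  ultimately show ?thesis unfolding payoff_bound_def by simp
qed

text \<open>Above the boundary the clock is shifted so that the start lies on the shifted boundary, where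
  the tangent inequality for \<open>mills\<close> is an equality.\<close>

lemma payoff_bound_above:
  assumes t: "t < 1" and above: "q + shepp_beta * sqrt (1 - t) \<le> z"
  shows "\<exists>a\<ge>0. payoff_bound t z q a = z - q"
proof -
  define x where "x = (z - q) / (1 - t)"
  \<comment> \<open>Chosen so that the shifted clock 1 / (1 - t) + a is (x / beta)^2, which puts x
    on the boundary beta sqrt (clock).\<close>
  define a where "a = (x / shepp_beta)\<^sup>2 - 1 / (1 - t)"
  note b = shepp_beta_pos
  have r: "sqrt (1 - t) > 0" "sqrt (1 - t) * sqrt (1 - t) = 1 - t" using t by auto
  have "shepp_beta * sqrt (1 - t) / (1 - t) \<le> x"
    unfolding x_def using above t by (intro divide_right_mono) auto
  then have "shepp_beta * (sqrt (1 - t) / (1 - t)) \<le> x" by simp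
  also have "sqrt (1 - t) / (1 - t) = 1 / sqrt (1 - t)"
    using r by (metis nonzero_divide_mult_cancel_left less_irrefl)
  finally have x: "1 / sqrt (1 - t) \<le> x / shepp_beta"
    using b by (simp add: pos_le_divide_eq mult.commute)
  have "0 < x / shepp_beta" using x r(1) by (meson divide_pos_pos less_le_trans zero_less_one)
  then have x_pos: "x > 0" using b by (simp add: zero_less_divide_iff)
  have "(1 / sqrt (1 - t))\<^sup>2 \<le> (x / shepp_beta)\<^sup>2"
    using x r(1) by (intro power_mono) auto
  then have a: "a \<ge> 0" using t by (simp add: a_def power_divide)
  have clock: "1 / (1 - t) + a = (x / shepp_beta)\<^sup>2" by (simp add: a_def)
  have root: "sqrt ((x / shepp_beta)\<^sup>2) = x / shepp_beta" using x_pos b by simp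
  have factor: "1 + a * (1 - t) = (x / shepp_beta)\<^sup>2 * (1 - t)"
    using t by (simp add: a_def algebra_simps)
  have "payoff_bound t z q a = ((1 - shepp_beta\<^sup>2) * mills shepp_beta) * ((x / shepp_beta)\<^sup>2 * (1 - t)) / (x / shepp_beta)"
    unfolding payoff_bound_def x_def[symmetric] clock root factor using x_pos b by simp
  also have "\<dots> = x * (1 - t)"
    unfolding mills_shepp_beta using x_pos b by (simp add: power2_eq_square)
  also have "\<dots> = z - q" using t by (simp add: x_def)
  finally show ?thesis using a by blast
qed

context observed_bridge
begin

text \<open>Stop at the first hit of the boundary, or at T. At a hit the defining equation of beta
  turns the weighted mixture into the payoff. At T the weighted mixture is at most beta sqrt (1 -
  T), while the payoff may be negative; the subtracted term collects both errors and vanishes as T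
  tends to 1.\<close>

lemma hitting_payoff_ge:
  assumes q: "AE u in \<mu>. q \<le> u" and below: "z < q + shepp_beta * sqrt (1 - t)" and T: "t < T" "T < 1"
  shows "ereal (q + payoff_bound t z q 0 - sqrt (1 - T) * (shepp_beta + exp (1 / 2 + \<bar>(z - q) / (1 - t)\<bar>)))
    \<le> value_fn M (\<lambda>_ _. Z) t z"
proof -
  let ?c = "1 - shepp_beta\<^sup>2"
  define b where "b s = q + shepp_beta * sqrt (1 - s)" for s
  have b_cont: "continuous_on {t..1} b" unfolding b_def[abs_def] by (intro continuous_intros)
  define \<sigma> where "\<sigma> = hitting_time b T"
  note range = hitting_time_range[OF T b_cont, folded \<sigma>_def]
  have \<tau>: "(\<lambda>\<omega>. \<sigma> \<omega> - t) \<in> stopping_times M Z t"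
    unfolding \<sigma>_def by (rule hitting_time_stopping_time[OF T b_cont])
  interpret S: stopped_bridge \<mu> M W t z Z T \<sigma>
  proof unfold_locales
    fix s assume "t \<le> s" "s < T"
    then show "{\<omega> \<in> space M. \<sigma> \<omega> \<le> s} \<in> sets (past s)"
      using stopping_time_past[OF \<tau>, of s] T by simp
  qed (use T range in auto)
  \<comment> \<open>Used as the parameter - m of an exponential martingale: m^2 times the clock at T
    is 1, so the compensator there is the constant 1 / 2.\<close>
  define m where "m = sqrt (1 - T)"
  have m: "m > 0" "m\<^sup>2 = 1 - T" using T by (auto simp: m_def)
  have c: "?c > 0" using shepp_beta_square_less by simp
  define x0 where "x0 = (z - q) / (1 - t)"
  \<comment> \<open>The loss below q, which occurs only when the boundary is missed until T.
    \<open>E\<close> is the exponential that dominates it.\<close>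
  define N where "N \<omega> = max 0 (q - Z (\<sigma> \<omega>) \<omega>)" for \<omega>
  define E where "E \<omega> = exp (- m * S.scaled q (\<sigma> \<omega>) \<omega> - (- m)\<^sup>2 * (1 / (1 - \<sigma> \<omega>)) / 2)" for \<omega>
  have Z_meas [measurable]: "(\<lambda>\<omega>. Z (\<sigma> \<omega>) \<omega>) \<in> borel_measurable M" by (rule S.Z_\<sigma>_measurable)
  have N_meas [measurable]: "N \<in> borel_measurable M" unfolding N_def[abs_def] by measurable
  have E_meas [measurable]: "E \<in> borel_measurable M" unfolding E_def[abs_def] by measurable

  \<comment> \<open>No overshoot: the start is strictly below the boundary, so Z stays below it on a
    nonempty interval before \<open>\<sigma>\<close>, and the inequality passes to the left
    limit.\<close>
  have at_hit: "AE \<omega> in M. Z (\<sigma> \<omega>) \<omega> \<le> b (\<sigma> \<omega>) \<and> (Z (\<sigma> \<omega>) \<omega> = b (\<sigma> \<omega>) \<or> \<sigma> \<omega> = T)"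
    using AE_start AE_space
  proof eventually_elim
    case (elim \<omega>)
    have before: "\<And>s. t \<le> s \<Longrightarrow> s < \<sigma> \<omega> \<Longrightarrow> Z s \<omega> < b s"
      using before_hitting_time[OF T b_cont elim(2)] unfolding \<sigma>_def by blast
    have cases: "b (\<sigma> \<omega>) \<le> Z (\<sigma> \<omega>) \<omega> \<or> \<sigma> \<omega> = T"
      using hitting_time_cases[OF T b_cont elim(2)] unfolding \<sigma>_def .
    have rng: "t \<le> \<sigma> \<omega>" "\<sigma> \<omega> \<le> T" using range[OF elim(2)] by auto
    have "\<sigma> \<omega> \<noteq> t" using cases elim(1) below T unfolding b_def by auto
    then have less: "t < \<sigma> \<omega>" using rng by simp
    have "Z (\<sigma> \<omega>) \<omega> - b (\<sigma> \<omega>) \<le> 0"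
    proof (rule tendsto_upperbound)
      have "continuous_on {t..1} (\<lambda>s. Z s \<omega> - b s)"
        by (intro continuous_on_diff Z_continuous elim b_cont)
      then have "((\<lambda>s. Z s \<omega> - b s) \<longlongrightarrow> Z (\<sigma> \<omega>) \<omega> - b (\<sigma> \<omega>)) (at (\<sigma> \<omega>) within {t..1})"
        using rng T unfolding continuous_on_def by auto
      then show "((\<lambda>s. Z s \<omega> - b s) \<longlongrightarrow> Z (\<sigma> \<omega>) \<omega> - b (\<sigma> \<omega>)) (at (\<sigma> \<omega>) within {t<..<\<sigma> \<omega>})"
        by (rule tendsto_within_subset) (use rng T in auto)
      have "\<forall>\<^sub>F s in at (\<sigma> \<omega>) within {t<..<\<sigma> \<omega>}. s \<in> {t<..<\<sigma> \<omega>}"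
        by (simp add: eventually_at_filter)
      then show "\<forall>\<^sub>F s in at (\<sigma> \<omega>) within {t<..<\<sigma> \<omega>}. Z s \<omega> - b s \<le> 0"
      proof eventually_elim
        case (elim s)
        then have "Z s \<omega> < b s" by (intro before) auto
        then show ?case by simp
      qed
      show "at (\<sigma> \<omega>) within {t<..<\<sigma> \<omega>} \<noteq> bot"
        using less by (simp add: at_within_eq_bot_iff islimpt_greaterThanLessThan2)
    qed
    with cases show ?case by auto
  qed

  \<comment> \<open>With y = - m X the loss is - X m^2 = m y, and y <= exp y, which equals exp (1 /
    2) times \<open>E\<close> at T.\<close>
  have N_le: "AE \<omega> in M. N \<omega> \<le> m * exp (1 / 2) * E \<omega>"
    using at_hit AE_space
  proof eventually_elim
    case (elim \<omega>)
    have E_pos: "E \<omega> > 0" by (simp add: E_def)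
    show ?case
    proof (cases "q \<le> Z (\<sigma> \<omega>) \<omega>")
      case True
      then show ?thesis using m E_pos by (simp add: N_def)
    next
      case False
      then have "Z (\<sigma> \<omega>) \<omega> \<noteq> b (\<sigma> \<omega>)"
        using shepp_beta_pos range[OF elim(2)] T unfolding b_def by auto
      then have \<sigma>: "\<sigma> \<omega> = T" using elim by auto
      define X where "X = S.scaled q (\<sigma> \<omega>) \<omega>"
      have X: "q - Z (\<sigma> \<omega>) \<omega> = - X * m\<^sup>2" using T by (simp add: X_def \<sigma> m)
      have "E \<omega> = exp (- m * X) * exp (- 1 / 2)"
        unfolding E_def X_def[symmetric] using m T by (simp add: \<sigma> exp_add[symmetric])
      then have E: "exp (1 / 2) * E \<omega> = exp (- m * X)" by (simp add: exp_minus)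
      have "- X * m\<^sup>2 = m * (- m * X)" by (simp add: power2_eq_square)
      also have "\<dots> \<le> m * exp (- m * X)"
        using m exp_ge_add_one_self[of "- m * X"] by (intro mult_left_mono) auto
      finally have "- X * m\<^sup>2 \<le> m * (exp (1 / 2) * E \<omega>)" unfolding E .
      moreover have "N \<omega> = - X * m\<^sup>2" using False unfolding X[symmetric] by (simp add: N_def)
      ultimately show ?thesis unfolding mult.assoc[of m] by linarith
    qed
  qed
  have E_int: "(\<integral>\<^sup>+\<omega>. ennreal (E \<omega>) \<partial>M) \<le> ennreal (exp \<bar>x0\<bar>)"
  proof -
    have "(\<integral>\<^sup>+\<omega>. ennreal (E \<omega>) \<partial>M) \<le> ennreal (exp (- m * x0 - (- m)\<^sup>2 * (1 / (1 - t)) / 2))"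
      unfolding E_def x0_def using m by (intro S.exp_martingale_le S.scaled_le_walk_neg q) auto
    also have "- m * x0 - (- m)\<^sup>2 * (1 / (1 - t)) / 2 \<le> \<bar>x0\<bar>"
    proof -
      have "m \<le> 1" using T start_nonneg by (simp add: m_def)
      then have "- m * x0 \<le> 1 * \<bar>x0\<bar>"
        using m abs_ge_minus_self[of "m * x0"] mult_right_mono[of m 1 "\<bar>x0\<bar>"] by (simp add: abs_mult)
      moreover have "0 \<le> (- m)\<^sup>2 * (1 / (1 - t)) / 2" using start_less by simp
      ultimately show ?thesis by linarith
    qed
    finally show ?thesis by (simp add: ennreal_leI)
  qed
  have N_int: "(\<integral>\<^sup>+\<omega>. ennreal (N \<omega>) \<partial>M) \<le> ennreal (m * exp (1 / 2 + \<bar>x0\<bar>))"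
  proof -
    have "(\<integral>\<^sup>+\<omega>. ennreal (N \<omega>) \<partial>M) \<le> (\<integral>\<^sup>+\<omega>. ennreal (m * exp (1 / 2)) * ennreal (E \<omega>) \<partial>M)"
    proof (rule nn_integral_mono_AE)
      show "AE \<omega> in M. ennreal (N \<omega>) \<le> ennreal (m * exp (1 / 2)) * ennreal (E \<omega>)"
        using N_le by eventually_elim (use m in \<open>simp add: ennreal_mult'[symmetric] ennreal_leI\<close>)
    qed
    also have "\<dots> = ennreal (m * exp (1 / 2)) * (\<integral>\<^sup>+\<omega>. ennreal (E \<omega>) \<partial>M)"
      by (rule nn_integral_cmult) measurable
    also have "\<dots> \<le> ennreal (m * exp (1 / 2)) * ennreal (exp \<bar>x0\<bar>)"
      by (intro mult_left_mono E_int) simp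
    also have "\<dots> = ennreal (m * exp (1 / 2 + \<bar>x0\<bar>))"
      using m by (simp add: ennreal_mult'[symmetric] exp_add mult.assoc)
    finally show ?thesis .
  qed
  have N_integrable: "integrable M N"
  proof (rule integrableI_nonneg)
    show "(\<integral>\<^sup>+\<omega>. ennreal (N \<omega>) \<partial>M) < \<infinity>" using N_int by (rule order_le_less_trans) simp
  qed (auto simp: N_def)
  have N_expectation: "(\<integral>\<omega>. N \<omega> \<partial>M) \<le> m * exp (1 / 2 + \<bar>x0\<bar>)"
    using m N_int by (intro integral_real_bounded) auto
  \<comment> \<open>\<open>value_fn\<close> admits only integrable payoffs. Z is bounded above by
    the boundary and below through N.\<close>
  have Z_integrable: "integrable M (\<lambda>\<omega>. Z (\<sigma> \<omega>) \<omega>)"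
  proof (rule Bochner_Integration.integrable_bound)
    show "integrable M (\<lambda>\<omega>. \<bar>q\<bar> + shepp_beta + N \<omega>)" using N_integrable by simp
    show "AE \<omega> in M. norm (Z (\<sigma> \<omega>) \<omega>) \<le> norm (\<bar>q\<bar> + shepp_beta + N \<omega>)"
      using at_hit AE_space
    proof eventually_elim
      case (elim \<omega>)
      have "sqrt (1 - \<sigma> \<omega>) \<le> 1" using range[OF elim(2)] start_nonneg by auto
      then have "shepp_beta * sqrt (1 - \<sigma> \<omega>) \<le> shepp_beta * 1"
        using shepp_beta_pos by (intro mult_left_mono) auto
      then have "Z (\<sigma> \<omega>) \<omega> - q \<le> shepp_beta" using elim(1) unfolding b_def by auto
      then show ?case using shepp_beta_pos unfolding N_def by auto
    qed
  qed measurable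

  \<comment> \<open>By monotonicity of \<open>mills\<close> the weighted mixture is at most beta
    sqrt (1 - \<open>\<sigma>\<close>). At a hit this is the payoff itself; at T it is the
    additional term, since payoff plus N is nonnegative.\<close>
  have mix: "AE \<omega> in M. ?c * S.mixture q 0 \<omega> \<le> (Z (\<sigma> \<omega>) \<omega> - q) + N \<omega> + shepp_beta * m"
    using at_hit AE_space
  proof eventually_elim
    case (elim \<omega>)
    have \<sigma>: "\<sigma> \<omega> \<le> T" "\<sigma> \<omega> < 1" using range[OF elim(2)] T by auto
    define r where "r = sqrt (1 - \<sigma> \<omega>)"
    have r: "r > 0" "r * r = 1 - \<sigma> \<omega>" using \<sigma> by (auto simp: r_def)
    have "sqrt (1 / (1 - \<sigma> \<omega>) + 0) = 1 / r" by (simp add: r_def real_sqrt_divide)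
    then have mixture_eq: "S.mixture q 0 \<omega> = mills ((Z (\<sigma> \<omega>) \<omega> - q) / r) * r"
      unfolding S.mixture_def r(2)[symmetric] using r(1) by simp
    have le: "(Z (\<sigma> \<omega>) \<omega> - q) / r \<le> shepp_beta"
      using elim(1) r(1) unfolding b_def r_def[symmetric] by (simp add: pos_divide_le_eq)
    have "mills ((Z (\<sigma> \<omega>) \<omega> - q) / r) * r \<le> mills shepp_beta * r"
      using r(1) by (intro mult_right_mono mills_mono le) auto
    then have "?c * (mills ((Z (\<sigma> \<omega>) \<omega> - q) / r) * r) \<le> ?c * (mills shepp_beta * r)"
      using c by (intro mult_left_mono) auto
    then have bound: "?c * S.mixture q 0 \<omega> \<le> shepp_beta * r"
      unfolding mixture_eq using mills_shepp_beta by (simp add: mult.assoc[symmetric])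
    have nonneg: "0 \<le> (Z (\<sigma> \<omega>) \<omega> - q) + N \<omega>" by (auto simp: N_def)
    show ?case
    proof (cases "\<sigma> \<omega> = T")
      case True
      then have "r = m" by (simp add: r_def m_def)
      show ?thesis using bound nonneg unfolding \<open>r = m\<close> by linarith
    next
      case False
      then have "Z (\<sigma> \<omega>) \<omega> - q = shepp_beta * r" using elim(1) by (simp add: b_def r_def)
      moreover have "0 \<le> N \<omega>" by (simp add: N_def)
      moreover have "0 \<le> shepp_beta * m" using shepp_beta_pos m by simp
      ultimately show ?thesis using bound by linarith
    qed
  qed
  have "ennreal (payoff_bound t z q 0) \<le> (\<integral>\<^sup>+\<omega>. ennreal ((Z (\<sigma> \<omega>) \<omega> - q) + N \<omega> + shepp_beta * m) \<partial>M)"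
  proof -
    have "ennreal (payoff_bound t z q 0) = ennreal ?c * ennreal (mills (x0 / sqrt (1 / (1 - t) + 0)) / sqrt (1 / (1 - t) + 0))"
      using c by (simp add: payoff_bound_def x0_def ennreal_mult'[symmetric])
    also have "\<dots> \<le> ennreal ?c * (\<integral>\<^sup>+\<omega>. ennreal (S.mixture q 0 \<omega>) \<partial>M)"
      unfolding x0_def by (intro mult_left_mono S.mixture_ge q) auto
    also have "\<dots> = (\<integral>\<^sup>+\<omega>. ennreal ?c * ennreal (S.mixture q 0 \<omega>) \<partial>M)"
      by (rule nn_integral_cmult[symmetric]) (simp add: S.mixture_def[abs_def])
    also have "\<dots> \<le> (\<integral>\<^sup>+\<omega>. ennreal ((Z (\<sigma> \<omega>) \<omega> - q) + N \<omega> + shepp_beta * m) \<partial>M)"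
    proof (rule nn_integral_mono_AE)
      show "AE \<omega> in M. ennreal ?c * ennreal (S.mixture q 0 \<omega>) \<le> ennreal ((Z (\<sigma> \<omega>) \<omega> - q) + N \<omega> + shepp_beta * m)"
        using mix by eventually_elim (use c in \<open>simp add: ennreal_mult'[symmetric] ennreal_leI\<close>)
    qed
    finally show ?thesis .
  qed
  also have "\<dots> = ennreal (\<integral>\<omega>. (Z (\<sigma> \<omega>) \<omega> - q) + N \<omega> + shepp_beta * m \<partial>M)"
  proof (rule nn_integral_eq_integral)
    show "integrable M (\<lambda>\<omega>. (Z (\<sigma> \<omega>) \<omega> - q) + N \<omega> + shepp_beta * m)"
      using Z_integrable N_integrable by simp
    show "AE \<omega> in M. 0 \<le> (Z (\<sigma> \<omega>) \<omega> - q) + N \<omega> + shepp_beta * m"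
    proof (rule AE_I2)
      fix \<omega>
      have "0 \<le> (Z (\<sigma> \<omega>) \<omega> - q) + N \<omega>" by (auto simp: N_def)
      moreover have "0 \<le> shepp_beta * m" using shepp_beta_pos m by simp
      ultimately show "0 \<le> (Z (\<sigma> \<omega>) \<omega> - q) + N \<omega> + shepp_beta * m" by linarith
    qed
  qed
  also have "(\<integral>\<omega>. (Z (\<sigma> \<omega>) \<omega> - q) + N \<omega> + shepp_beta * m \<partial>M)
      = (\<integral>\<omega>. Z (\<sigma> \<omega>) \<omega> \<partial>M) - q + (\<integral>\<omega>. N \<omega> \<partial>M) + shepp_beta * m"
    using Z_integrable N_integrable by (simp add: prob_space)
  finally have main: "ennreal (payoff_bound t z q 0)
      \<le> ennreal ((\<integral>\<omega>. Z (\<sigma> \<omega>) \<omega> \<partial>M) - q + (\<integral>\<omega>. N \<omega> \<partial>M) + shepp_beta * m)" .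
  \<comment> \<open>\<open>ennreal\<close> identifies all nonpositive numbers, so the inequality
    returns to the reals only because its left side is positive.\<close>
  have "payoff_bound t z q 0 > 0"
    unfolding payoff_bound_0[OF start_less] using c mills_pos start_less by simp
  with main have "payoff_bound t z q 0 \<le> (\<integral>\<omega>. Z (\<sigma> \<omega>) \<omega> \<partial>M) - q + (\<integral>\<omega>. N \<omega> \<partial>M) + shepp_beta * m"
    by (auto simp: ennreal_le_iff2)
  then have "q + payoff_bound t z q 0 - m * (shepp_beta + exp (1 / 2 + \<bar>x0\<bar>)) \<le> (\<integral>\<omega>. Z (\<sigma> \<omega>) \<omega> \<partial>M)"
    using N_expectation by (simp add: algebra_simps)
  then have "ereal (q + payoff_bound t z q 0 - m * (shepp_beta + exp (1 / 2 + \<bar>x0\<bar>)))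
      \<le> ereal (\<integral>\<omega>. Z (t + (\<sigma> \<omega> - t)) \<omega> \<partial>M)" by simp
  also have "\<dots> \<le> value_fn M (\<lambda>_ _. Z) t z"
    unfolding value_fn_def using \<tau> Z_integrable by (intro SUP_upper2[of "\<lambda>\<omega>. \<sigma> \<omega> - t"]) auto
  finally show ?thesis by (simp add: m_def x0_def)
qed

lemma value_ge:
  assumes q: "AE u in \<mu>. q \<le> u" and below: "z < q + shepp_beta * sqrt (1 - t)"
  shows "ereal (q + payoff_bound t z q 0) \<le> value_fn M (\<lambda>_ _. Z) t z"
proof (rule LIMSEQ_le_const2)
  let ?T = "\<lambda>k::nat. 1 - (1 - t) / (real k + 2)"
  let ?C = "shepp_beta + exp (1 / 2 + \<bar>(z - q) / (1 - t)\<bar>)"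
  have "(\<lambda>k. q + payoff_bound t z q 0 - sqrt (1 - ?T k) * ?C) \<longlonglongrightarrow> q + payoff_bound t z q 0 - sqrt (1 - 1) * ?C"
  proof (intro tendsto_intros)
    show "?T \<longlonglongrightarrow> 1" by real_asymp
  qed
  then show "(\<lambda>k. ereal (q + payoff_bound t z q 0 - sqrt (1 - ?T k) * ?C)) \<longlonglongrightarrow> ereal (q + payoff_bound t z q 0)"
    by simp
  have "ereal (q + payoff_bound t z q 0 - sqrt (1 - ?T k) * ?C) \<le> value_fn M (\<lambda>_ _. Z) t z" for k
  proof (rule hitting_payoff_ge[OF q below])
    have "(1 - t) / (real k + 2) < (1 - t) / 1"
      using start_less by (intro divide_strict_left_mono) auto
    then show "t < ?T k" by simp
    show "?T k < 1" using start_less by (simp add: add_pos_pos)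
  qed
  then show "\<exists>N. \<forall>n\<ge>N. ereal (q + payoff_bound t z q 0 - sqrt (1 - ?T n) * ?C) \<le> value_fn M (\<lambda>_ _. Z) t z"
    by blast
qed

end

section \<open>From the stated hypotheses to the setting of the locales\<close>

lemma light_tailed_of_bounded_post_variance:
  assumes "real_distribution \<mu>" "bounded_post_variance \<mu>"
  shows "light_tailed \<mu>"
proof -
  interpret real_distribution \<mu> by fact
  \<comment> \<open>At time 0 the tilt is exp (u C), so its integrability for every C is the
    exponential moment condition.\<close>
  have "integrable \<mu> (tilt 0 C)" for C
    using assms(2) by (auto simp: bounded_post_variance_def dest!: bspec[of _ _ 0])
  then show ?thesis
    by unfold_locales (simp add: tilt_def[abs_def])
qed

lemma light_tailed_return: "light_tailed (return borel r)"
proof -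
  interpret prob_space "return borel r" by (rule prob_space_return) simp
  show ?thesis
    by unfold_locales (auto simp: integrable_iff_bounded nn_integral_return)
qed

text \<open>Outside the support each point has a null open neighbourhood; by Lindelof countably many
  of them cover the complement of S.\<close>

lemma AE_support:
  fixes \<mu> :: "real measure"
  assumes "sets \<mu> = sets borel" "measure_support \<mu> \<subseteq> S" "closed S"
  shows "AE u in \<mu>. u \<in> S"
proof -
  define F where "F = {U. open U \<and> emeasure \<mu> U = 0}"
  obtain F' where F': "F' \<subseteq> F" "countable F'" "\<Union>F' = \<Union>F"
    using Lindelof[of F] by (auto simp: F_def)
  have "(\<Union>U\<in>F'. U) \<in> null_sets \<mu>"
    using F' assms(1) by (intro null_sets_UN') (auto simp: F_def null_sets_def)
  then have "emeasure \<mu> (\<Union>F') = 0" by auto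
  moreover have "- S \<subseteq> \<Union>F'"
    unfolding F'(3) using assms(2) by (auto simp: F_def measure_support_def not_less zero_less_iff_neq_zero)
  moreover have "\<Union>F' \<in> sets \<mu>"
    unfolding assms(1) using F'(1) by (intro borel_open open_Union) (auto simp: F_def)
  ultimately show ?thesis
    by (intro AE_I[where N = "\<Union>F'"]) auto
qed

lemma observed_bridge_of_model:
  assumes "light_tailed \<mu>" "bridge_model M W \<mu> Z" "t \<in> {0..<1}"
  shows "observed_bridge \<mu> M W t z (Z t z)"
  using assms unfolding bridge_model_def brownian_motion_def
  by (auto simp: observed_bridge_def observed_bridge_axioms_def brownian_past_def brownian_past_axioms_def brownian_motion_def)

text \<open>Bridges the full family of processes and the locale, which fixes a single start and
  treats its process as a constant family.\<close>

lemma value_fn_slice: "value_fn M Z t z = value_fn M (\<lambda>_ _. Z t z) t z"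
  by (simp add: value_fn_def)

section \<open>Comparison of the value functions\<close>

text \<open>Strict, because mills touches the diagonal only at beta; this is what puts the region
  below the boundary into the continuation region.\<close>

lemma payoff_bound_0_above_diagonal:
  assumes "t < 1" "z < q + shepp_beta * sqrt (1 - t)"
  shows "z < q + payoff_bound t z q 0"
proof -
  let ?r = "sqrt (1 - t)"
  have r: "?r > 0" using assms by simp
  have "(z - q) / ?r \<noteq> shepp_beta" using assms r by (simp add: divide_eq_eq)
  from mills_above_diagonal[OF this]
  have "(z - q) / ?r * ?r < (1 - shepp_beta\<^sup>2) * mills ((z - q) / ?r) * ?r"
    using r by (intro mult_strict_right_mono) auto
  then show ?thesis unfolding payoff_bound_0[OF assms(1)] using r by simp
qed

lemma value_fn_upper:
  assumes "observed_bridge \<mu> M W t z (Z t z)" "AE u in \<mu>. u \<le> q"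
  shows "value_fn M Z t z \<le> ereal (q + payoff_bound t z q 0)"
    and "q + shepp_beta * sqrt (1 - t) \<le> z \<Longrightarrow> value_fn M Z t z \<le> ereal z"
proof -
  interpret observed_bridge \<mu> M W t z "Z t z" by fact
  show "value_fn M Z t z \<le> ereal (q + payoff_bound t z q 0)"
    unfolding value_fn_slice[of M Z] by (rule value_le[OF assms(2)]) simp
  assume "q + shepp_beta * sqrt (1 - t) \<le> z"
  then obtain a where "a \<ge> 0" "payoff_bound t z q a = z - q"
    using payoff_bound_above[OF start_less] by blast
  with value_le[OF assms(2), of a] show "value_fn M Z t z \<le> ereal z"
    unfolding value_fn_slice[of M Z] by simp
qed

lemma value_fn_lower:
  assumes "observed_bridge \<mu> M W t z (Z t z)"
  shows "ereal z \<le> value_fn M Z t z"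
    and "AE u in \<mu>. q \<le> u \<Longrightarrow> z < q + shepp_beta * sqrt (1 - t) \<Longrightarrow> ereal (q + payoff_bound t z q 0) \<le> value_fn M Z t z"
  using observed_bridge.value_ge_start[OF assms] observed_bridge.value_ge[OF assms]
  unfolding value_fn_slice[of M Z] by auto

text \<open>A number separates the two values: z on and above the boundary of q, Shepp's value below
  it. The processes themselves are never compared, so they may live on different probability
  spaces.\<close>

lemma value_fn_comparison:
  assumes "observed_bridge \<mu> M W t z (Z t z)" "AE u in \<mu>. u \<le> q"
    and "observed_bridge \<nu> N V t z (Y t z)" "AE u in \<nu>. q \<le> u"
  shows "value_fn M Z t z \<le> value_fn N Y t z"
proof (cases "q + shepp_beta * sqrt (1 - t) \<le> z")
  case True
  then show ?thesis
    using value_fn_upper(2)[where Z = Z, OF assms(1,2)] value_fn_lower(1)[where Z = Y, OF assms(3)] by (meson order_trans)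
next
  case False
  then show ?thesis
    using value_fn_upper(1)[where Z = Z, OF assms(1,2)] value_fn_lower(2)[where Z = Y, OF assms(3,4)] by (meson not_le order_trans)
qed

theorem proposition3p1:
  fixes \<mu> :: "real measure" and r :: real
    and M :: "'a measure" and W :: "real \<Rightarrow> 'a \<Rightarrow> real" and Z :: "real \<Rightarrow> real \<Rightarrow> real \<Rightarrow> 'a \<Rightarrow> real"
    and M1 :: "'b measure" and W1 :: "real \<Rightarrow> 'b \<Rightarrow> real" and Z1 :: "real \<Rightarrow> real \<Rightarrow> real \<Rightarrow> 'b \<Rightarrow> real"
    and M2 :: "'c measure" and W2 :: "real \<Rightarrow> 'c \<Rightarrow> real" and Z2 :: "real \<Rightarrow> real \<Rightarrow> real \<Rightarrow> 'c \<Rightarrow> real"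
  assumes "real_distribution \<mu>"
    and "integrable \<mu> (\<lambda>u. u)"
    and "bounded_post_variance \<mu>"
    and "bridge_model M W \<mu> Z"
    and "bridge_model M1 W1 (return borel r) Z1"
    and "bridge_model M2 W2 (return borel (- r)) Z2"
  shows
    "(measure_support \<mu> \<subseteq> {..r} \<longrightarrow>
        (\<forall>t\<in>{0..<1}. \<forall>z. value_fn M Z t z \<le> value_fn M1 Z1 t z) \<and>
        {(t, z). t \<in> {0..1} \<and> z \<ge> r + shepp_beta * sqrt (1 - t)}
          \<subseteq> stopping_region (value_fn M Z)) \<and>
     (measure_support \<mu> \<subseteq> {- r..} \<longrightarrow>
        (\<forall>t\<in>{0..<1}. \<forall>z. value_fn M Z t z \<ge> value_fn M2 Z2 t z) \<and>
        {(t, z). t \<in> {0..<1} \<and> z < - r + shepp_beta * sqrt (1 - t)}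
          \<subseteq> continuation_region (value_fn M Z))"
proof -
  have sets: "sets \<mu> = sets borel"
    using assms(1) by (simp add: real_distribution_def real_distribution_axioms_def)
  note B = observed_bridge_of_model[OF light_tailed_of_bounded_post_variance[OF assms(1,3)] assms(4)]
  note B1 = observed_bridge_of_model[OF light_tailed_return assms(5)]
  note B2 = observed_bridge_of_model[OF light_tailed_return assms(6)]
  have AE_ret: "AE u in return borel q. u \<le> q" "AE u in return borel q. q \<le> u" for q :: real
    by (simp_all add: AE_return)
  have below: "AE u in \<mu>. u \<le> r" if "measure_support \<mu> \<subseteq> {..r}"
    using AE_support[OF sets that closed_atMost] by eventually_elim simp
  have above: "AE u in \<mu>. - r \<le> u" if "measure_support \<mu> \<subseteq> {- r..}"
    using AE_support[OF sets that closed_atLeast] by eventually_elim simp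
  show ?thesis
  proof (intro conjI impI ballI allI)
    fix t z :: real assume supp: "measure_support \<mu> \<subseteq> {..r}" and t: "t \<in> {0..<1}"
    show "value_fn M Z t z \<le> value_fn M1 Z1 t z"
      \<comment> \<open>The separating point is q = r: the prior lies below it, and the point mass
        at r enters through its lower bound.\<close>
      by (rule value_fn_comparison[where Z = Z and Y = Z1, OF B[OF t] below[OF supp] B1[OF t] AE_ret(2)])
  next
    assume supp: "measure_support \<mu> \<subseteq> {..r}"
    have "\<not> ereal z < value_fn M Z t z" if "t \<in> {0..<1}" "r + shepp_beta * sqrt (1 - t) \<le> z" for t z
      unfolding not_less by (rule value_fn_upper(2)[where Z = Z, OF B[OF that(1)] below[OF supp] that(2)])
    \<comment> \<open>Points with t = 1 lie outside the continuation region by definition, so the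
      inequality for t < 1 suffices.\<close>
    then show "{(t, z). t \<in> {0..1} \<and> z \<ge> r + shepp_beta * sqrt (1 - t)} \<subseteq> stopping_region (value_fn M Z)"
      unfolding stopping_region_def continuation_region_def by fastforce
  next
    fix t z :: real assume supp: "measure_support \<mu> \<subseteq> {- r..}" and t: "t \<in> {0..<1}"
    show "value_fn M2 Z2 t z \<le> value_fn M Z t z"
      \<comment> \<open>The roles are exchanged at q = - r: the point mass is now the smaller side
        and enters through its upper bound.\<close>
      by (rule value_fn_comparison[where Z = Z2 and Y = Z, OF B2[OF t] AE_ret(1) B[OF t] above[OF supp]])
  next
    assume supp: "measure_support \<mu> \<subseteq> {- r..}"
    have "ereal z < value_fn M Z t z" if t: "t \<in> {0..<1}" and z: "z < - r + shepp_beta * sqrt (1 - t)" for t z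
    proof -
      have "ereal z < ereal (- r + payoff_bound t z (- r) 0)"
        using payoff_bound_0_above_diagonal[OF _ z] t by simp
      also have "\<dots> \<le> value_fn M Z t z"
        by (rule value_fn_lower(2)[where Z = Z, OF B[OF t] above[OF supp] z])
      finally show ?thesis .
    qed
    then show "{(t, z). t \<in> {0..<1} \<and> z < - r + shepp_beta * sqrt (1 - t)} \<subseteq> continuation_region (value_fn M Z)"
      unfolding continuation_region_def by auto
  qed
qed

end
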